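(* Let $V$ be a simple vertex algebra of countable dimension and $G$ a finite automorphism group of $V$. Let $\Lambda$ be the set of irreducible characters of $\mathbb{C}[G]$, let $W_\lambda$ be the irreducible $G$-module with character $\lambda\in\Lambda$, and let $V_\lambda=\mathrm{Hom}_G(W_\lambda,V)$ be the multiplicity space of $W_\lambda$ in $V$, with its $V^G$-module structure. Then the $\mathbb{C}[G]\otimes V^G$-module decomposition $$V=\bigoplus_{\lambda\in\Lambda}W_\lambda\otimes V_\lambda$$ gives a dual pair $(\mathbb{C}[G],V^G)$ on $V$, that is: (1) $V_\lambda$ is nonzero for any $\lambda\in\Lambda$. (2) Each $V_\lambda$ is an irreducible $V^G$-module. (3) $V_\lambda$ and $V_\mu$ are isomorphic $V^G$-modules if and only if $\lambda=\mu$. In particular, $V$ is a completely reducible $V^G$-module.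
   Context: All vector spaces are over $\mathbb{C}$, $\otimes=\otimes_{\mathbb{C}}$; $\delta(z)=\sum_{n\in\mathbb{Z}}z^n$ and binomials are expanded in nonnegative powers of the second variable. A vertex algebra is a vector space $V$ with a vector $\mathbf{1}\in V$ and a linear map $v\mapsto Y(v,z)=\sum_{n\in\mathbb{Z}}v_nz^{-n-1}\in(\mathrm{End}\,V)[[z,z^{-1}]]$ such that $u_nv=0$ for $n$ large, $Y(\mathbf{1},z)=\mathrm{Id}_V$, $Y(v,z)\mathbf{1}\in V[[z]]$ with constant term $v$, and the Jacobi identity holds: $$z_0^{-1}\delta\left(\tfrac{z_1-z_2}{z_0}\right)Y(u,z_1)Y(v,z_2)-z_0^{-1}\delta\left(\tfrac{z_2-z_1}{-z_0}\right)Y(v,z_2)Y(u,z_1)=z_2^{-1}\delta\left(\tfrac{z_1-z_0}{z_2}\right)Y(Y(u,z_0)v,z_2).$$ A $V$-module is a vector space $M$ with a linear map $v\mapsto Y_M(v,z)=\sum_{n\in\mathbb{Z}}v_nz^{-n-1}\in(\mathrm{End}\,M)[[z,z^{-1}]]$ with $v_nw=0$ for $n$ large ($w\in M$), $Y_M(\mathbf{1},z)=\mathrm{Id}_M$ and the Jacobi identity above with the outer $Y$'s replaced by $Y_M$. Submodules are subspaces stable under all $v_n$; isomorphisms are linear bijections commuting with all $v_n$; irreducible means nonzero with no proper nonzero submodule. $V$ is simple if it is irreducible as a module over itself. An automorphism is an invertible linear map $g$ of $V$ with $g\mathbf{1}=\mathbf{1}$ and $gY(u,z)g^{-1}=Y(gu,z)$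 for all $u\in V$; a finite automorphism group is a finite group of automorphisms. $V^G=\{v\in V:gv=v\ \forall g\in G\}$ is a vertex subalgebra, and $V$ is a $V^G$-module whose $V^G$-action commutes with $G$. $V_\lambda=\mathrm{Hom}_G(W_\lambda,V)$ is a $V^G$-module via $(v_nf)(w)=v_n(f(w))$. The identification of $\bigoplus_\lambda W_\lambda\otimes V_\lambda$ with $V$ sends $w\otimes f$ to $f(w)$, with $G$ acting on the first factor and $V^G$ on the second; a $\mathbb{C}[G]\otimes V^G$-module means a space that is a $\mathbb{C}[G]$-module and a $V^G$-module with commuting actions. *)

theory Defs
  imports
    Complex_Main
    "HOL-Algebra.Group_Action"
    "HOL-Library.Function_Algebras"
    "HOL-Library.Groups_Big_Fun"
    "HOL-Library.Countable_Set"
begin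

section \<open>Linear algebra on subspaces\<close>

text \<open>
  A complex vector space is a subspace of an ambient type carrying a scalar multiplication
  for which \<^locale>\<open>vector_space\<close> holds.  Function types are vector spaces pointwise.
\<close>

definition fun_scale :: "(complex \<Rightarrow> 'b \<Rightarrow> 'b) \<Rightarrow> complex \<Rightarrow> ('a \<Rightarrow> 'b) \<Rightarrow> 'a \<Rightarrow> 'b" where
  "fun_scale s c f = (\<lambda>x. s c (f x))"

definition linear_on ::
  "(complex \<Rightarrow> 'a::ab_group_add \<Rightarrow> 'a) \<Rightarrow> 'a set \<Rightarrow> (complex \<Rightarrow> 'b::ab_group_add \<Rightarrow> 'b) \<Rightarrow>
    ('a \<Rightarrow> 'b) \<Rightarrow> bool" where
  "linear_on s S s' f \<longleftrightarrow>
     (\<forall>x\<in>S. \<forall>y\<in>S. f (x + y) = f x + f y) \<and> (\<forall>c. \<forall>x\<in>S. f (s c x) = s' c (f x))"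

definition countable_dimension ::
  "(complex \<Rightarrow> 'a::ab_group_add \<Rightarrow> 'a) \<Rightarrow> 'a set \<Rightarrow> bool" where
  "countable_dimension s S \<longleftrightarrow>
     (\<exists>B. countable B \<and> \<not> module.dependent s B \<and> module.span s B = S)"

text \<open>The trace of an endomorphism of a finite-dimensional subspace; the basis is irrelevant.\<close>

definition trace_on ::
  "(complex \<Rightarrow> 'a::ab_group_add \<Rightarrow> 'a) \<Rightarrow> 'a set \<Rightarrow> ('a \<Rightarrow> 'a) \<Rightarrow> complex" where
  "trace_on s S f =
     (let B = (SOME B. \<not> module.dependent s B \<and> module.span s B = S)
      in \<Sum>b\<in>B. module.representation s B (f b) b)"


section \<open>Tensor products and direct sums\<close>

definition bilinear_forms ::
  "(complex \<Rightarrow> 'a::ab_group_add \<Rightarrow> 'a) \<Rightarrow> 'a set \<Rightarrow>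
   (complex \<Rightarrow> 'b::ab_group_add \<Rightarrow> 'b) \<Rightarrow> 'b set \<Rightarrow> ('a \<Rightarrow> 'b \<Rightarrow> complex) set" where
  "bilinear_forms s1 S1 s2 S2 =
     {\<beta>. (\<forall>y\<in>S2. linear_on s1 S1 (*) (\<lambda>x. \<beta> x y)) \<and> (\<forall>x\<in>S1. linear_on s2 S2 (*) (\<beta> x))}"

text \<open>
  The algebraic tensor product is realised inside the dual of the space of bilinear forms,
  \<open>x \<otimes> y\<close> being evaluation at \<open>(x, y)\<close>.  Over a field this has the universal
  property of the tensor product, see \<open>tensor_universal\<close> below.
\<close>

definition pure_tensor ::
  "(complex \<Rightarrow> 'a::ab_group_add \<Rightarrow> 'a) \<Rightarrow> 'a set \<Rightarrow>
   (complex \<Rightarrow> 'b::ab_group_add \<Rightarrow> 'b) \<Rightarrow> 'b set \<Rightarrow>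
   'a \<Rightarrow> 'b \<Rightarrow> ('a \<Rightarrow> 'b \<Rightarrow> complex) \<Rightarrow> complex" where
  "pure_tensor s1 S1 s2 S2 x y =
     (\<lambda>\<beta>. if \<beta> \<in> bilinear_forms s1 S1 s2 S2 then \<beta> x y else 0)"

definition tensor ::
  "(complex \<Rightarrow> 'a::ab_group_add \<Rightarrow> 'a) \<Rightarrow> 'a set \<Rightarrow>
   (complex \<Rightarrow> 'b::ab_group_add \<Rightarrow> 'b) \<Rightarrow> 'b set \<Rightarrow>
   (('a \<Rightarrow> 'b \<Rightarrow> complex) \<Rightarrow> complex) set" where
  "tensor s1 S1 s2 S2 =
     module.span (fun_scale (*)) {pure_tensor s1 S1 s2 S2 x y | x y. x \<in> S1 \<and> y \<in> S2}"

lemma vector_space_fun_scale: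
  assumes "vector_space s"
  shows "vector_space (fun_scale s :: complex \<Rightarrow> ('i \<Rightarrow> 'a::ab_group_add) \<Rightarrow> ('i \<Rightarrow> 'a))"
proof -
  interpret vector_space s by fact
  show ?thesis
    by standard (auto simp: fun_scale_def fun_eq_iff scale_right_distrib scale_left_distrib)
qed

lemma vector_space_times: "vector_space ((*) :: complex \<Rightarrow> complex \<Rightarrow> complex)"
  by standard (auto simp: algebra_simps)

lemma pure_tensor_bilinear:
  shows "y \<in> S2 \<Longrightarrow> linear_on s1 S1 (fun_scale (*)) (\<lambda>x. pure_tensor s1 S1 s2 S2 x y)"
    and "x \<in> S1 \<Longrightarrow> linear_on s2 S2 (fun_scale (*)) (pure_tensor s1 S1 s2 S2 x)"
  by (auto simp: linear_on_def pure_tensor_def fun_scale_def fun_eq_iff bilinear_forms_def)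

lemma tensor_universal:
  fixes s1 :: "complex \<Rightarrow> 'a::ab_group_add \<Rightarrow> 'a" and s2 :: "complex \<Rightarrow> 'b::ab_group_add \<Rightarrow> 'b"
    and sX :: "complex \<Rightarrow> 'x::ab_group_add \<Rightarrow> 'x" and B :: "'a \<Rightarrow> 'b \<Rightarrow> 'x"
  assumes X: "vector_space sX"
    and B1: "\<And>y. y \<in> S2 \<Longrightarrow> linear_on s1 S1 sX (\<lambda>x. B x y)"
    and B2: "\<And>x. x \<in> S1 \<Longrightarrow> linear_on s2 S2 sX (B x)"
  shows "\<exists>L. linear_on (fun_scale (*)) (tensor s1 S1 s2 S2) sX L \<and>
           (\<forall>x\<in>S1. \<forall>y\<in>S2. L (pure_tensor s1 S1 s2 S2 x y) = B x y)"
proof -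
  interpret X: vector_space sX by fact
  interpret C: vector_space "(*) :: complex \<Rightarrow> complex \<Rightarrow> complex" by (rule vector_space_times)
  interpret F: vector_space "fun_scale (*) :: complex \<Rightarrow> (('a \<Rightarrow> 'b \<Rightarrow> complex) \<Rightarrow> complex) \<Rightarrow> _"
    by (rule vector_space_fun_scale) (rule vector_space_times)
  interpret FX: vector_space_pair "fun_scale (*) :: complex \<Rightarrow> (('a \<Rightarrow> 'b \<Rightarrow> complex) \<Rightarrow> complex) \<Rightarrow> _" sX ..
  interpret XC: vector_space_pair sX "(*) :: complex \<Rightarrow> complex \<Rightarrow> complex" ..
  let ?p = "pure_tensor s1 S1 s2 S2"
  define P where "P = {?p x y | x y. x \<in> S1 \<and> y \<in> S2}"
  obtain E where E: "E \<subseteq> P" "F.independent E" "P \<subseteq> F.span E"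
    using F.maximal_independent_subset[of P] by blast
  have "\<forall>e\<in>E. \<exists>q. fst q \<in> S1 \<and> snd q \<in> S2 \<and> e = ?p (fst q) (snd q)"
    using E(1) by (fastforce simp: P_def)
  then obtain q where q: "\<And>e. e \<in> E \<Longrightarrow> fst (q e) \<in> S1 \<and> snd (q e) \<in> S2 \<and> e = ?p (fst (q e)) (snd (q e))"
    by metis
  define f where "f e = B (fst (q e)) (snd (q e))" for e
  define L where "L = FX.construct E f"
  have L: "Vector_Spaces.linear (fun_scale (*)) sX L"
    unfolding L_def by (rule FX.linear_construct[OF E(2)])
  have LE: "L e = f e" if "e \<in> E" for e
    unfolding L_def by (rule FX.construct_basis[OF E(2) that])
  interpret L: Vector_Spaces.linear "fun_scale (*)" sX L by (rule L)
  have "L (?p x y) = B x y" if xy: "x \<in> S1" "y \<in> S2" for x y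
  proof (rule ccontr)
    assume neq: "L (?p x y) \<noteq> B x y"
    define d where "d = B x y - L (?p x y)"
    have "d \<noteq> 0" using neq by (simp add: d_def)
    then have "X.independent {d}" by simp
    then obtain l where l: "Vector_Spaces.linear sX (*) l" "l d = 1"
      using XC.linear_independent_extend[of "{d}" "\<lambda>_. 1"] by auto
    interpret l: Vector_Spaces.linear sX "(*)" l by (rule l(1))
    define \<beta> where "\<beta> x y = l (B x y)" for x y
    have \<beta>: "\<beta> \<in> bilinear_forms s1 S1 s2 S2"
      using B1 B2 unfolding bilinear_forms_def linear_on_def \<beta>_def
      by (auto simp: l.add l.scale)
    have "?p x y \<in> F.span E" using E(3) xy by (auto simp: P_def)
    then obtain T r where T: "finite T" "T \<subseteq> E" "?p x y = (\<Sum>e\<in>T. fun_scale (*) (r e) e)"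
      unfolding F.span_explicit by blast
    have "L (?p x y) = (\<Sum>e\<in>T. sX (r e) (f e))"
      using T LE by (auto simp: L.sum L.scale intro!: sum.cong)
    then have "l (L (?p x y)) = (\<Sum>e\<in>T. r e * l (f e))"
      by (simp add: l.sum l.scale)
    also have "\<dots> = (\<Sum>e\<in>T. r e * e \<beta>)"
    proof (rule sum.cong[OF refl])
      fix e assume "e \<in> T"
      then have "e \<in> E" using T by blast
      then have "e \<beta> = \<beta> (fst (q e)) (snd (q e))"
        using q[of e] \<beta> by (metis pure_tensor_def)
      then show "r e * l (f e) = r e * e \<beta>" by (simp add: \<beta>_def f_def)
    qed
    also have "\<dots> = (\<Sum>e\<in>T. fun_scale (*) (r e) e) \<beta>"
      using T(1) by (induction T rule: finite_induct) (auto simp: fun_scale_def)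
    also have "\<dots> = ?p x y \<beta>" using T(3) by simp
    also have "\<dots> = l (B x y)" using \<beta> by (simp add: pure_tensor_def \<beta>_def)
    finally have "l d = 0" by (simp add: d_def l.diff)
    then show False using l(2) by simp
  qed
  moreover have "linear_on (fun_scale (*)) (tensor s1 S1 s2 S2) sX L"
    by (simp add: linear_on_def L.add L.scale)
  ultimately show ?thesis by blast
qed

text \<open>
  \<open>A \<otimes> B\<close> for linear endomorphisms \<open>A\<close> of \<open>S1\<close> and \<open>B\<close> of \<open>S2\<close>; it sends \<open>x \<otimes> y\<close> to
  \<open>A x \<otimes> B y\<close>.
\<close>

definition tensor_endo ::
  "(complex \<Rightarrow> 'a::ab_group_add \<Rightarrow> 'a) \<Rightarrow> 'a set \<Rightarrow>
   (complex \<Rightarrow> 'b::ab_group_add \<Rightarrow> 'b) \<Rightarrow> 'b set \<Rightarrow> ('a \<Rightarrow> 'a) \<Rightarrow> ('b \<Rightarrow> 'b) \<Rightarrow>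
   (('a \<Rightarrow> 'b \<Rightarrow> complex) \<Rightarrow> complex) \<Rightarrow> (('a \<Rightarrow> 'b \<Rightarrow> complex) \<Rightarrow> complex)" where
  "tensor_endo s1 S1 s2 S2 A B t =
     (\<lambda>\<beta>. if \<beta> \<in> bilinear_forms s1 S1 s2 S2 then t (\<lambda>x y. \<beta> (A x) (B y)) else 0)"

definition direct_sum :: "'i set \<Rightarrow> ('i \<Rightarrow> 'a::zero set) \<Rightarrow> ('i \<Rightarrow> 'a) set" where
  "direct_sum I T =
     {t. (\<forall>i\<in>I. t i \<in> T i) \<and> (\<forall>i. i \<notin> I \<longrightarrow> t i = 0) \<and> finite {i. t i \<noteq> 0}}"

definition summand :: "'i \<Rightarrow> 'a::zero \<Rightarrow> 'i \<Rightarrow> 'a" where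
  "summand i x = (\<lambda>j. if j = i then x else 0)"


section \<open>Formal distributions and the Jacobi identity\<close>

text \<open>
  A formal distribution in \<open>z\<^sub>0, z\<^sub>1, z\<^sub>2\<close> is the function sending \<open>(a, b, c)\<close> to the
  coefficient of \<open>z\<^sub>0\<^sup>a z\<^sub>1\<^sup>b z\<^sub>2\<^sup>c\<close>.
\<close>

text \<open>Coefficient of \<open>x\<^sup>a y\<^sup>b\<close> in \<open>(x - y)\<^sup>k\<close>, expanded in nonnegative powers of \<open>y\<close>.\<close>

definition binomial_series :: "int \<Rightarrow> int \<Rightarrow> int \<Rightarrow> complex" where
  "binomial_series k a b =
     (if 0 \<le> b \<and> a + b = k then (-1) ^ nat b * (of_int k gchoose nat b) else 0)"

text \<open>
  The three delta distributions
  \<open>z\<^sub>0\<^sup>-\<^sup>1 \<delta>((z\<^sub>1 - z\<^sub>2) / z\<^sub>0) = \<Sum>\<^sub>k (z\<^sub>1 - z\<^sub>2)\<^sup>k z\<^sub>0\<^sup>-\<^sup>k\<^sup>-\<^sup>1\<close>,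
  \<open>z\<^sub>0\<^sup>-\<^sup>1 \<delta>((z\<^sub>2 - z\<^sub>1) / (- z\<^sub>0)) = \<Sum>\<^sub>k (-1)\<^sup>k (z\<^sub>2 - z\<^sub>1)\<^sup>k z\<^sub>0\<^sup>-\<^sup>k\<^sup>-\<^sup>1\<close> and
  \<open>z\<^sub>2\<^sup>-\<^sup>1 \<delta>((z\<^sub>1 - z\<^sub>0) / z\<^sub>2) = \<Sum>\<^sub>k (z\<^sub>1 - z\<^sub>0)\<^sup>k z\<^sub>2\<^sup>-\<^sup>k\<^sup>-\<^sup>1\<close>.
\<close>

definition delta_12 :: "int \<times> int \<times> int \<Rightarrow> complex" where
  "delta_12 = (\<lambda>(a, b, c). binomial_series (- a - 1) b c)"

definition delta_21 :: "int \<times> int \<times> int \<Rightarrow> complex" where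
  "delta_21 = (\<lambda>(a, b, c). (-1) powi (- a - 1) * binomial_series (- a - 1) c b)"

definition delta_10 :: "int \<times> int \<times> int \<Rightarrow> complex" where
  "delta_10 = (\<lambda>(a, b, c). binomial_series (- c - 1) b a)"

text \<open>
  Cauchy product of a scalar with a vector-valued distribution.  In the Jacobi identity every
  coefficient is a finite sum because of the truncation axiom.
\<close>

definition formal_mult ::
  "(complex \<Rightarrow> 'm::ab_group_add \<Rightarrow> 'm) \<Rightarrow> (int \<times> int \<times> int \<Rightarrow> complex) \<Rightarrow>
   (int \<times> int \<times> int \<Rightarrow> 'm) \<Rightarrow> int \<times> int \<times> int \<Rightarrow> 'm" where
  "formal_mult s K F =
     (\<lambda>(a, b, c). Sum_any (\<lambda>(i, j, k). s (K (i, j, k)) (F (a - i, b - j, c - k))))"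

text \<open>
  Here and below \<open>Y v n\<close> is the mode \<open>v\<^sub>n\<close>, the coefficient of \<open>z\<^sup>-\<^sup>n\<^sup>-\<^sup>1\<close> in \<open>Y(v, z)\<close>.
\<close>

definition jacobi_identity ::
  "(complex \<Rightarrow> 'm::ab_group_add \<Rightarrow> 'm) \<Rightarrow> ('v \<Rightarrow> int \<Rightarrow> 'v \<Rightarrow> 'v) \<Rightarrow>
   ('v \<Rightarrow> int \<Rightarrow> 'm \<Rightarrow> 'm) \<Rightarrow> 'v \<Rightarrow> 'v \<Rightarrow> 'm \<Rightarrow> bool" where
  "jacobi_identity s Y YM u v w \<longleftrightarrow>
     (\<forall>e.
        formal_mult s delta_12
          (\<lambda>(a, b, c). if a = 0 then YM u (- b - 1) (YM v (- c - 1) w) else 0) e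
      - formal_mult s delta_21
          (\<lambda>(a, b, c). if a = 0 then YM v (- c - 1) (YM u (- b - 1) w) else 0) e
      = formal_mult s delta_10
          (\<lambda>(a, b, c). if b = 0 then YM (Y u (- a - 1) v) (- c - 1) w else 0) e)"


lemma Sum_any_reindex:
  assumes "inj h" and "\<And>x. g x \<noteq> 0 \<Longrightarrow> x \<in> range h" and "\<And>n. g (h n) = f n"
  shows "Sum_any g = Sum_any f"
proof -
  have "{x. g x \<noteq> 0} = h ` {n. f n \<noteq> 0}" using assms(2) by (auto simp flip: assms(3))
  then show ?thesis
    by (simp add: Sum_any.expand_set sum.reindex inj_on_subset[OF assms(1)] assms(3))
qed

lemma Sum_any_reindex3:
  assumes "inj h" and "\<And>i j k. g i j k \<noteq> 0 \<Longrightarrow> (i, j, k) \<in> range h"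
    and "\<And>n. (case h n of (i, j, k) \<Rightarrow> g i j k) = f n"
  shows "Sum_any (\<lambda>(i, j, k). g i j k) = Sum_any f"
  using assms by (intro Sum_any_reindex[of h]) (auto simp: split_beta)

text \<open>
  Extracting the coefficient of
  \<open>z\<^sub>0\<^sup>-\<^sup>l\<^sup>-\<^sup>1 z\<^sub>1\<^sup>-\<^sup>m\<^sup>-\<^sup>1 z\<^sub>2\<^sup>-\<^sup>n\<^sup>-\<^sup>1\<close> gives the Borcherds identity.
\<close>

lemma jacobi_identity_iff:
  assumes "vector_space s"
  shows "jacobi_identity s Y YM u v w \<longleftrightarrow>
    (\<forall>l m n.
        (Sum_any (\<lambda>i. s ((-1) ^ i * (of_int l gchoose i)) (YM u (m + l - int i) (YM v (n + int i) w))))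
      - (Sum_any (\<lambda>i. s ((-1) powi l * ((-1) ^ i * (of_int l gchoose i)))
              (YM v (n + l - int i) (YM u (m + int i) w))))
      = (Sum_any (\<lambda>i. s (of_int m gchoose i) (YM (Y u (l + int i) v) (m + n - int i) w))))"
proof -
  interpret vector_space s by fact
  have 1: "formal_mult s delta_12 (\<lambda>(a, b, c). if a = 0 then F b c else 0) (- l - 1, - m - 1, - n - 1)
     = Sum_any (\<lambda>i. s ((-1) ^ i * (of_int l gchoose i)) (F (- (m + l - int i) - 1) (- (n + int i) - 1)))" for F l m n
    unfolding formal_mult_def prod.case
  proof (rule Sum_any_reindex3[of "\<lambda>i. (- l - 1, l - int i, int i)"], goal_cases)
    case (2 i j k)
    then have "i = - l - 1" "0 \<le> k" "j + k = - i - 1"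
      by (auto simp: delta_12_def binomial_series_def split: if_splits)
    then have "(i, j, k) = (- l - 1, l - int (nat k), int (nat k))" by simp
    then show ?case by (rule range_eqI)
  next
    case (3 i)
    have "- m - 1 - (l - int i) = - (m + l - int i) - 1" "- n - 1 - int i = - (n + int i) - 1" by simp_all
    then show ?case by (simp only: prod.case delta_12_def binomial_series_def diff_self) simp
  qed (simp add: inj_def)
  have 2: "formal_mult s delta_21 (\<lambda>(a, b, c). if a = 0 then F b c else 0) (- l - 1, - m - 1, - n - 1)
     = Sum_any (\<lambda>i. s ((-1) powi l * ((-1) ^ i * (of_int l gchoose i))) (F (- (m + int i) - 1) (- (n + l - int i) - 1)))" for F l m n
    unfolding formal_mult_def prod.case
  proof (rule Sum_any_reindex3[of "\<lambda>i. (- l - 1, int i, l - int i)"], goal_cases)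
    case (2 i j k)
    then have "i = - l - 1" "0 \<le> j" "k + j = - i - 1"
      by (auto simp: delta_21_def binomial_series_def split: if_splits)
    then have "(i, j, k) = (- l - 1, int (nat j), l - int (nat j))" by simp
    then show ?case by (rule range_eqI)
  next
    case (3 i)
    have "- m - 1 - int i = - (m + int i) - 1" "- n - 1 - (l - int i) = - (n + l - int i) - 1" by simp_all
    then show ?case by (simp only: prod.case delta_21_def binomial_series_def diff_self) simp
  qed (simp add: inj_def)
  have g: "(-1) ^ i * ((of_int (int i - m - 1) :: complex) gchoose i) = of_int m gchoose i" for m i
    using gbinomial_negated_upper[of "of_int m :: complex" i] by simp
  have K: "delta_10 (int i, - m - 1, m - int i) = of_int m gchoose i" for i m
    using g[of i m] by (simp add: delta_10_def binomial_series_def algebra_simps)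
  have 3: "formal_mult s delta_10 (\<lambda>(a, b, c). if b = 0 then F a c else 0) (- l - 1, - m - 1, - n - 1)
     = Sum_any (\<lambda>i. s (of_int m gchoose i) (F (- (l + int i) - 1) (- (m + n - int i) - 1)))" for F l m n
    unfolding formal_mult_def prod.case
  proof (rule Sum_any_reindex3[of "\<lambda>i. (int i, - m - 1, m - int i)"], goal_cases)
    case (2 i j k)
    then have "j = - m - 1" "0 \<le> i" "j + i = - k - 1"
      by (auto simp: delta_10_def binomial_series_def split: if_splits)
    then have "(i, j, k) = (int (nat i), - m - 1, m - int (nat i))" by simp
    then show ?case by (rule range_eqI)
  next
    case (3 i)
    have "- l - 1 - int i = - (l + int i) - 1" "- n - 1 - (m - int i) = - (m + n - int i) - 1" by simp_all
    then show ?case by (simp only: prod.case K diff_self) simp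
  qed (simp add: inj_def)
  have *: "(\<forall>e. P e) \<longleftrightarrow> (\<forall>l m n. P (- l - 1, - m - 1, - n - 1))" for P :: "int \<times> int \<times> int \<Rightarrow> bool"
  proof safe
    fix a b c assume "\<forall>l m n. P (- l - 1, - m - 1, - n - 1)"
    from this[rule_format, of "- a - 1" "- b - 1" "- c - 1"] show "P (a, b, c)" by simp
  qed auto
  show ?thesis
    unfolding jacobi_identity_def * 1 2 3 by simp
qed


section \<open>Vertex algebras and their modules\<close>

locale vertex_algebra = vector_space s
  for s :: "complex \<Rightarrow> 'v::ab_group_add \<Rightarrow> 'v" +
  fixes V :: "'v set" and vac :: 'v and Y :: "'v \<Rightarrow> int \<Rightarrow> 'v \<Rightarrow> 'v"
  assumes subspace_V: "module.subspace s V"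
    and vac_closed: "vac \<in> V"
    and Y_closed: "\<lbrakk>u \<in> V; v \<in> V\<rbrakk> \<Longrightarrow> Y u n v \<in> V"
    and Y_linear_left: "v \<in> V \<Longrightarrow> linear_on s V s (\<lambda>u. Y u n v)"
    and Y_linear_right: "u \<in> V \<Longrightarrow> linear_on s V s (Y u n)"
    and Y_truncation: "\<lbrakk>u \<in> V; v \<in> V\<rbrakk> \<Longrightarrow> \<exists>N. \<forall>n\<ge>N. Y u n v = 0"
    and Y_vacuum: "v \<in> V \<Longrightarrow> Y vac n v = (if n = - 1 then v else 0)"
    and Y_creation: "\<lbrakk>v \<in> V; n \<ge> 0\<rbrakk> \<Longrightarrow> Y v n vac = 0"
    and Y_creation_const: "v \<in> V \<Longrightarrow> Y v (- 1) vac = v"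
    and Y_jacobi: "\<lbrakk>u \<in> V; v \<in> V; w \<in> V\<rbrakk> \<Longrightarrow> jacobi_identity s Y Y u v w"

locale vertex_module = V: vertex_algebra s V vac Y + M: vector_space sM
  for s :: "complex \<Rightarrow> 'v::ab_group_add \<Rightarrow> 'v" and V vac Y
    and sM :: "complex \<Rightarrow> 'm::ab_group_add \<Rightarrow> 'm" +
  fixes M :: "'m set" and YM :: "'v \<Rightarrow> int \<Rightarrow> 'm \<Rightarrow> 'm"
  assumes subspace_M: "module.subspace sM M"
    and YM_closed: "\<lbrakk>v \<in> V; w \<in> M\<rbrakk> \<Longrightarrow> YM v n w \<in> M"
    and YM_linear_left: "w \<in> M \<Longrightarrow> linear_on s V sM (\<lambda>v. YM v n w)"
    and YM_linear_right: "v \<in> V \<Longrightarrow> linear_on sM M sM (YM v n)"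
    and YM_truncation: "\<lbrakk>v \<in> V; w \<in> M\<rbrakk> \<Longrightarrow> \<exists>N. \<forall>n\<ge>N. YM v n w = 0"
    and YM_vacuum: "w \<in> M \<Longrightarrow> YM vac n w = (if n = - 1 then w else 0)"
    and YM_jacobi: "\<lbrakk>u \<in> V; v \<in> V; w \<in> M\<rbrakk> \<Longrightarrow> jacobi_identity sM Y YM u v w"

definition vertex_submodule ::
  "'v set \<Rightarrow> (complex \<Rightarrow> 'm::ab_group_add \<Rightarrow> 'm) \<Rightarrow> 'm set \<Rightarrow> ('v \<Rightarrow> int \<Rightarrow> 'm \<Rightarrow> 'm) \<Rightarrow>
   'm set \<Rightarrow> bool" where
  "vertex_submodule V sM M YM N \<longleftrightarrow>
     module.subspace sM N \<and> N \<subseteq> M \<and> (\<forall>v\<in>V. \<forall>n. \<forall>w\<in>N. YM v n w \<in> N)"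

definition irreducible_vertex_module ::
  "(complex \<Rightarrow> 'v::ab_group_add \<Rightarrow> 'v) \<Rightarrow> 'v set \<Rightarrow> 'v \<Rightarrow> ('v \<Rightarrow> int \<Rightarrow> 'v \<Rightarrow> 'v) \<Rightarrow>
   (complex \<Rightarrow> 'm::ab_group_add \<Rightarrow> 'm) \<Rightarrow> 'm set \<Rightarrow> ('v \<Rightarrow> int \<Rightarrow> 'm \<Rightarrow> 'm) \<Rightarrow> bool" where
  "irreducible_vertex_module s V vac Y sM M YM \<longleftrightarrow>
     vertex_module s V vac Y sM M YM \<and> M \<noteq> {0} \<and>
     (\<forall>N. vertex_submodule V sM M YM N \<longrightarrow> N = {0} \<or> N = M)"

definition isomorphic_vertex_modules ::
  "'v set \<Rightarrow> (complex \<Rightarrow> 'm::ab_group_add \<Rightarrow> 'm) \<Rightarrow> 'm set \<Rightarrow> ('v \<Rightarrow> int \<Rightarrow> 'm \<Rightarrow> 'm) \<Rightarrow>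
   (complex \<Rightarrow> 'n::ab_group_add \<Rightarrow> 'n) \<Rightarrow> 'n set \<Rightarrow> ('v \<Rightarrow> int \<Rightarrow> 'n \<Rightarrow> 'n) \<Rightarrow> bool" where
  "isomorphic_vertex_modules V sM M YM sN N YN \<longleftrightarrow>
     (\<exists>f. linear_on sM M sN f \<and> bij_betw f M N \<and>
          (\<forall>v\<in>V. \<forall>n. \<forall>w\<in>M. f (YM v n w) = YN v n (f w)))"

text \<open>Complete reducibility: being an internal direct sum of irreducible submodules.\<close>

definition completely_reducible_vertex_module ::
  "(complex \<Rightarrow> 'v::ab_group_add \<Rightarrow> 'v) \<Rightarrow> 'v set \<Rightarrow> 'v \<Rightarrow> ('v \<Rightarrow> int \<Rightarrow> 'v \<Rightarrow> 'v) \<Rightarrow>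
   (complex \<Rightarrow> 'm::ab_group_add \<Rightarrow> 'm) \<Rightarrow> 'm set \<Rightarrow> ('v \<Rightarrow> int \<Rightarrow> 'm \<Rightarrow> 'm) \<Rightarrow> bool" where
  "completely_reducible_vertex_module s V vac Y sM M YM \<longleftrightarrow>
     vertex_module s V vac Y sM M YM \<and>
     (\<exists>\<N>. (\<forall>N\<in>\<N>. vertex_submodule V sM M YM N \<and> irreducible_vertex_module s V vac Y sM N YM) \<and>
          (\<forall>N\<in>\<N>. N \<inter> module.span sM (\<Union>(\<N> - {N})) = {0}) \<and>
          module.span sM (\<Union>\<N>) = M)"

definition simple_vertex_algebra ::
  "(complex \<Rightarrow> 'v::ab_group_add \<Rightarrow> 'v) \<Rightarrow> 'v set \<Rightarrow> 'v \<Rightarrow> ('v \<Rightarrow> int \<Rightarrow> 'v \<Rightarrow> 'v) \<Rightarrow> bool" where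
  "simple_vertex_algebra s V vac Y \<longleftrightarrow>
     vertex_algebra s V vac Y \<and> irreducible_vertex_module s V vac Y s V Y"

text \<open>
  As in \<^const>\<open>BijGroup\<close>, a self-map of \<open>V\<close> is represented by its extensional function.
\<close>

definition vertex_automorphisms ::
  "(complex \<Rightarrow> 'v::ab_group_add \<Rightarrow> 'v) \<Rightarrow> 'v set \<Rightarrow> 'v \<Rightarrow> ('v \<Rightarrow> int \<Rightarrow> 'v \<Rightarrow> 'v) \<Rightarrow>
   ('v \<Rightarrow> 'v) set" where
  "vertex_automorphisms s V vac Y =
     {g \<in> Bij V. linear_on s V s g \<and> g vac = vac \<and>
        (\<forall>u\<in>V. \<forall>n. \<forall>w\<in>V. g (Y u n (inv_into V g w)) = Y (g u) n w)}"

definition finite_automorphism_group ::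
  "(complex \<Rightarrow> 'v::ab_group_add \<Rightarrow> 'v) \<Rightarrow> 'v set \<Rightarrow> 'v \<Rightarrow> ('v \<Rightarrow> int \<Rightarrow> 'v \<Rightarrow> 'v) \<Rightarrow>
   ('v \<Rightarrow> 'v) set \<Rightarrow> bool" where
  "finite_automorphism_group s V vac Y G \<longleftrightarrow>
     finite G \<and> G \<subseteq> vertex_automorphisms s V vac Y \<and> subgroup G (BijGroup V)"

definition fixed_points :: "'v set \<Rightarrow> ('v \<Rightarrow> 'v) set \<Rightarrow> 'v set" where
  "fixed_points V G = {v \<in> V. \<forall>g\<in>G. g v = v}"


section \<open>Group representations\<close>

text \<open>Modules over the complex group algebra of \<open>G\<close> are treated as representations of \<open>G\<close>.\<close>

locale group_representation = group_action G W \<rho> + vector_space sW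
  for G :: "('g, 'x) monoid_scheme" and sW :: "complex \<Rightarrow> 'w::ab_group_add \<Rightarrow> 'w"
    and W :: "'w set" and \<rho> :: "'g \<Rightarrow> 'w \<Rightarrow> 'w" +
  assumes subspace_W: "module.subspace sW W"
    and linear_rep: "g \<in> carrier G \<Longrightarrow> linear_on sW W sW (\<rho> g)"

definition irreducible_representation ::
  "('g, 'x) monoid_scheme \<Rightarrow> (complex \<Rightarrow> 'w::ab_group_add \<Rightarrow> 'w) \<Rightarrow> 'w set \<Rightarrow>
   ('g \<Rightarrow> 'w \<Rightarrow> 'w) \<Rightarrow> bool" where
  "irreducible_representation G sW W \<rho> \<longleftrightarrow>
     group_representation G sW W \<rho> \<and> W \<noteq> {0} \<and>
     (\<forall>U. module.subspace sW U \<and> U \<subseteq> W \<and> (\<forall>g\<in>carrier G. \<forall>x\<in>U. \<rho> g x \<in> U)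
        \<longrightarrow> U = {0} \<or> U = W)"

definition rep_character ::
  "('g, 'x) monoid_scheme \<Rightarrow> (complex \<Rightarrow> 'w::ab_group_add \<Rightarrow> 'w) \<Rightarrow> 'w set \<Rightarrow>
   ('g \<Rightarrow> 'w \<Rightarrow> 'w) \<Rightarrow> 'g \<Rightarrow> complex" where
  "rep_character G sW W \<rho> = (\<lambda>g\<in>carrier G. trace_on sW W (\<rho> g))"

text \<open>
  For finite \<open>G\<close> every irreducible representation is finite-dimensional, hence has a copy on
  a subspace of \<^typ>\<open>nat \<Rightarrow> complex\<close>; so no irreducible character is lost by fixing this type.
\<close>

definition irreducible_characters :: "('g, 'x) monoid_scheme \<Rightarrow> ('g \<Rightarrow> complex) set" where
  "irreducible_characters G =
     {rep_character G (fun_scale (*)) W \<rho> | (W :: (nat \<Rightarrow> complex) set) \<rho>.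
        irreducible_representation G (fun_scale (*)) W \<rho>}"

text \<open>
  Linear maps defined on \<open>W\<close> are normalised to be \<open>0\<close> outside \<open>W\<close>, which makes \<open>Hom\<^sub>G(W, U)\<close>
  a subspace of a function type (unlike extensionality by \<^const>\<open>undefined\<close>).
\<close>

definition rep_hom ::
  "('g, 'x) monoid_scheme \<Rightarrow> (complex \<Rightarrow> 'w::ab_group_add \<Rightarrow> 'w) \<Rightarrow> 'w set \<Rightarrow>
   ('g \<Rightarrow> 'w \<Rightarrow> 'w) \<Rightarrow> (complex \<Rightarrow> 'u::ab_group_add \<Rightarrow> 'u) \<Rightarrow> 'u set \<Rightarrow>
   ('g \<Rightarrow> 'u \<Rightarrow> 'u) \<Rightarrow> ('w \<Rightarrow> 'u) set" where
  "rep_hom G sW W \<rho> sU U \<sigma> =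
     {f. f \<in> W \<rightarrow> U \<and> linear_on sW W sU f \<and>
         (\<forall>g\<in>carrier G. \<forall>x\<in>W. f (\<rho> g x) = \<sigma> g (f x)) \<and> (\<forall>x. x \<notin> W \<longrightarrow> f x = 0)}"

text \<open>The action \<open>(v\<^sub>n f)(w) = v\<^sub>n (f w)\<close> on linear maps into a module.\<close>

definition hom_modes :: "('v \<Rightarrow> int \<Rightarrow> 'm \<Rightarrow> 'm) \<Rightarrow> 'v \<Rightarrow> int \<Rightarrow> ('w \<Rightarrow> 'm) \<Rightarrow> 'w \<Rightarrow> 'm" where
  "hom_modes YM v n f = (\<lambda>w. YM v n (f w))"

definition group_vertex_module ::
  "('g, 'x) monoid_scheme \<Rightarrow>
   (complex \<Rightarrow> 'v::ab_group_add \<Rightarrow> 'v) \<Rightarrow> 'v set \<Rightarrow> 'v \<Rightarrow> ('v \<Rightarrow> int \<Rightarrow> 'v \<Rightarrow> 'v) \<Rightarrow>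
   (complex \<Rightarrow> 'm::ab_group_add \<Rightarrow> 'm) \<Rightarrow> 'm set \<Rightarrow> ('g \<Rightarrow> 'm \<Rightarrow> 'm) \<Rightarrow>
   ('v \<Rightarrow> int \<Rightarrow> 'm \<Rightarrow> 'm) \<Rightarrow> bool" where
  "group_vertex_module G s V vac Y sM M \<rho> YM \<longleftrightarrow>
     group_representation G sM M \<rho> \<and> vertex_module s V vac Y sM M YM \<and>
     (\<forall>g\<in>carrier G. \<forall>v\<in>V. \<forall>n. \<forall>w\<in>M. \<rho> g (YM v n w) = YM v n (\<rho> g w))"

end

theory Submission
  imports
    Defs
    "HOL-Computational_Algebra.Fundamental_Theorem_Algebra"
    "HOL-Analysis.Continuum_Not_Denumerable"
begin

text \<open>
  On finitely many vectors, products of modes are linear combinations of modes (by the Borcherds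
  identity), so the span of the modes \<open>u\<^sub>n\<close> behaves like an algebra acting irreducibly on \<open>V\<close>.  As \<open>V\<close>
  has countable dimension, Dixmier's lemma says that its commutant is \<open>\<complex>\<close>, and Jacobson's density theorem
  realises every linear map on a finite-dimensional subspace of \<open>V\<close> by modes.  Averaging over \<open>G\<close>,
  every equivariant linear map on a finite-dimensional \<open>G\<close>-stable subspace is realised by modes of
  \<open>V\<^sup>G\<close>; this makes the multiplicity spaces irreducible and pairwise non-isomorphic.  They are nonzero
  because distinct automorphisms of \<open>V\<close> are linearly independent, which follows from density as
  Dedekind's lemma does for field automorphisms.
\<close>

section \<open>Linear maps on subspaces\<close>

text \<open>As an operator on \<open>V\<close>, a product of two modes need not be a finite
  combination of modes: the length of the expansion from the Borcherds identity depends on the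
  vector. So the modes do not form an algebra, and Jacobson's argument is set up for families closed
  under composition on each finite set separately, which is all it uses. Density is proved for
  \<open>V\<close> and not for the fixed points because only the modes of all of \<open>V\<close>
  act irreducibly; passing to the fixed points costs one average, which leaves an equivariant map
  unchanged up to the factor |G|. Countable dimension is used once, against the uncountability of
  the complex numbers. The element \<Sum>g. \<phi>(g^-1 u) g of the group algebra is the common tool
  for everything about characters. Its trace separates irreducible characters; its coefficients
  would give a relation between automorphisms if some multiplicity space were zero; acting on
  \<open>V\<close>, it projects to isotypic parts and reads off single components, which shows that
  the sum is direct.\<close>

lemma linear_onD:
  assumes "linear_on s S s' f"
  shows linear_on_add: "x \<in> S \<Longrightarrow> y \<in> S \<Longrightarrow> f (x + y) = f x + f y"
    and linear_on_scale: "x \<in> S \<Longrightarrow> f (s c x) = s' c (f x)"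
  using assms by (auto simp: linear_on_def)

context
  fixes s :: "complex \<Rightarrow> 'a::ab_group_add \<Rightarrow> 'a" and s' :: "complex \<Rightarrow> 'b::ab_group_add \<Rightarrow> 'b" and S f
  assumes vs: "vector_space s" "vector_space s'" and S: "module.subspace s S" and f: "linear_on s S s' f"
begin

interpretation A: vector_space s by (rule vs)
interpretation B: vector_space s' by (rule vs)

lemma linear_on_zero: "f 0 = 0"
  using linear_on_scale[OF f A.subspace_0[OF S], of 0] by simp

lemma linear_on_sum: "(\<And>i. i \<in> I \<Longrightarrow> x i \<in> S) \<Longrightarrow> f (\<Sum>i\<in>I. x i) = (\<Sum>i\<in>I. f (x i))"
  by (induction I rule: infinite_finite_induct)
    (simp_all add: linear_on_zero linear_on_add[OF f] A.subspace_sum[OF S])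

lemma linear_on_diff: "x \<in> S \<Longrightarrow> y \<in> S \<Longrightarrow> f (x - y) = f x - f y"
  using linear_on_add[OF f A.subspace_diff[OF S], of x y y] by (simp add: algebra_simps)

lemma linear_on_image_span:
  assumes "B \<subseteq> S" "x \<in> A.span B"
  shows "f x \<in> B.span (f ` B)"
proof -
  \<comment> \<open>Membership in \<open>S\<close> is carried through the induction because
    \<open>f\<close> is additive only on \<open>S\<close>.\<close>
  have "x \<in> S \<and> f x \<in> B.span (f ` B)" using assms(2)
  proof (induction rule: A.span_induct_alt)
    case base
    then show ?case using A.subspace_0[OF S] linear_on_zero B.span_zero by simp
  next
    case (step c x y)
    then show ?case
      using f assms(1)
      by (auto simp: linear_on_def subset_iff A.subspace_add[OF S] A.subspace_scale[OF S]
          intro!: B.span_add B.span_scale intro: B.span_base)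
  qed
  then show ?thesis ..
qed

lemma subspace_image: "B.subspace (f ` S)"
proof (rule B.subspaceI)
  show "0 \<in> f ` S" using linear_on_zero A.subspace_0[OF S] by force
next
  fix x y assume "x \<in> f ` S" "y \<in> f ` S"
  then obtain u v where "x = f u" "y = f v" "u \<in> S" "v \<in> S" by blast
  then show "x + y \<in> f ` S"
    using linear_on_add[OF f] A.subspace_add[OF S] by (metis imageI)
next
  fix c x assume "x \<in> f ` S"
  then obtain u where "x = f u" "u \<in> S" by blast
  then show "s' c x \<in> f ` S"
    using linear_on_scale[OF f] A.subspace_scale[OF S] by (metis imageI)
qed

end

lemma linear_on_compose:
  assumes "linear_on s S s' f" "f \<in> S \<rightarrow> T" "linear_on s' T s'' g"
  shows "linear_on s S s'' (\<lambda>x. g (f x))"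
  using assms by (auto simp: linear_on_def Pi_iff)

lemma linear_on_subset: "linear_on s S s' f \<Longrightarrow> T \<subseteq> S \<Longrightarrow> linear_on s T s' f"
  unfolding linear_on_def by blast

lemma linear_on_eq_on_span:
  assumes "vector_space s" "vector_space s'" "E \<subseteq> S" "module.subspace s S"
    and "linear_on s S s' f" "linear_on s S s' g" "\<And>x. x \<in> E \<Longrightarrow> f x = g x"
    and "x \<in> module.span s E"
  shows "f x = g x"
proof -
  interpret A: vector_space s by fact
  have "x \<in> S \<and> f x = g x" using assms(8)
  proof (induction rule: A.span_induct_alt)
    case base
    show ?case
      using linear_on_zero[OF assms(1,2,4,5)] linear_on_zero[OF assms(1,2,4,6)] A.subspace_0[OF assms(4)]
      by simp
  next
    case (step c x y)
    then have "x \<in> S" "y \<in> S" "s c x \<in> S"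
      using assms(3) A.subspace_scale[OF assms(4)] by auto
    then show ?case using step assms(5-7) A.subspace_add[OF assms(4)] by (simp add: linear_on_def)
  qed
  then show ?thesis ..
qed

lemma linear_on_of_linear: "Vector_Spaces.linear s s' f \<Longrightarrow> linear_on s S s' f"
  by (auto simp: linear_on_def Vector_Spaces.linear_iff)

text \<open>The bound on \<open>card B\<close> serves the minimality argument in
  \<open>exists_irreducible_subspace\<close>.\<close>

lemma (in vector_space) subspace_of_finite_span:
  assumes "finite E" "subspace U" "U \<subseteq> span E"
  obtains B where "finite B" "independent B" "span B = U" "B \<subseteq> U" "card B \<le> card E"
proof -
  obtain B where B: "B \<subseteq> U" "independent B" "U \<subseteq> span B"
    using maximal_independent_subset[of U] by blast
  have "span B = U" using B span_minimal[OF B(1) assms(2)] by blast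
  moreover have "finite B \<and> card B \<le> card E"
    using independent_span_bound[OF assms(1) B(2)] B(1) assms(3) by blast
  ultimately show thesis using that B by blast
qed

lemma (in vector_space) sum_representation:
  assumes "finite B" "independent B" "x \<in> span B"
  shows "(\<Sum>b\<in>B. scale (representation B x b) b) = x"
  using sum_representation_eq[OF assms(2,3,1) subset_refl] .

lemma linear_on_representation:
  assumes "vector_space s" "\<not> module.dependent s B"
  shows "linear_on s (module.span s B) (*) (\<lambda>x. module.representation s B x b)"
proof -
  interpret vector_space s by fact
  show ?thesis
    by (simp add: linear_on_def representation_add[OF assms(2)] representation_scale[OF assms(2)])
qed

lemma (in vector_space) exists_functional:
  assumes "x \<noteq> 0"
  obtains \<phi> where "Vector_Spaces.linear scale (*) \<phi>" "\<phi> x = 1"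
proof -
  interpret C: vector_space "(*) :: 'a \<Rightarrow> 'a \<Rightarrow> 'a"
    by standard (auto simp: algebra_simps)
  interpret P: vector_space_pair scale "(*) :: 'a \<Rightarrow> 'a \<Rightarrow> 'a" ..
  have "independent {x}" using assms by simp
  then show thesis
    using P.linear_independent_extend[of "{x}" "\<lambda>_. 1"] that by auto
qed

section \<open>Irreducible families of operators\<close>

text \<open>\<open>A\<close> is a bare set of maps, so that the same results cover the modes of a
  simple vertex algebra and the operators of an irreducible group representation.\<close>

locale irreducible_operators = vector_space s
  for s :: "complex \<Rightarrow> 'v::ab_group_add \<Rightarrow> 'v" +
  fixes M :: "'v set" and A :: "('v \<Rightarrow> 'v) set"
  assumes subspace_M: "subspace M"
    and op_closed: "a \<in> A \<Longrightarrow> x \<in> M \<Longrightarrow> a x \<in> M"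
    and op_linear: "a \<in> A \<Longrightarrow> linear_on s M s a"
    and M_nonzero: "M \<noteq> {0}"
    and irreducible: "subspace N \<Longrightarrow> N \<subseteq> M \<Longrightarrow> (\<And>a x. a \<in> A \<Longrightarrow> x \<in> N \<Longrightarrow> a x \<in> N) \<Longrightarrow> N = {0} \<or> N = M"
    and countably_spanned: "\<exists>B. countable B \<and> M \<subseteq> span B"
begin

text \<open>A countable spanning set has only countably many finite subsets; every vector lies in
  the span of one of them, and each such span contains only finitely many elements of an independent
  set.\<close>

lemma countable_independent:
  assumes "independent I" "I \<subseteq> M"
  shows "countable I"
proof -
  obtain B where B: "countable B" "M \<subseteq> span B" using countably_spanned by blast
  let ?\<F> = "{F. finite F \<and> F \<subseteq> B}"
  have "countable ?\<F>" using countable_Collect_finite_subset[OF B(1)] by (simp add: conj_commute)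
  moreover have "countable (I \<inter> span F)" if "F \<in> ?\<F>" for F
  proof -
    have "independent (I \<inter> span F)" using assms(1) independent_mono by blast
    then show ?thesis using independent_span_bound[of F "I \<inter> span F"] that countable_finite by blast
  qed
  moreover have "I \<subseteq> (\<Union>F\<in>?\<F>. I \<inter> span F)"
  proof
    fix x assume x: "x \<in> I"
    then have "x \<in> span B" using assms(2) B(2) by blast
    then obtain t r where "finite t" "t \<subseteq> B" "x = (\<Sum>a\<in>t. s (r a) a)"
      unfolding span_explicit by blast
    then have "x \<in> span t" by (auto intro: span_sum span_scale span_base)
    then show "x \<in> (\<Union>F\<in>?\<F>. I \<inter> span F)" using x \<open>finite t\<close> \<open>t \<subseteq> B\<close> by blast
  qed
  ultimately show ?thesis by (meson countable_UN countable_subset)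
qed

text \<open>Schur's lemma: kernel and image of \<open>T\<close> are stable under \<open>A\<close>,
  so irreducibility leaves only the kernel 0 and the image \<open>M\<close>.\<close>

lemma nonzero_endomorphism_bijective:
  assumes T: "linear_on s M s T" "\<And>x. x \<in> M \<Longrightarrow> T x \<in> M"
    and comm: "\<And>a x. a \<in> A \<Longrightarrow> x \<in> M \<Longrightarrow> T (a x) = a (T x)"
    and nz: "x0 \<in> M" "T x0 \<noteq> 0"
  shows "bij_betw T M M"
proof -
  have T0: "T 0 = 0" by (rule linear_on_zero[OF _ _ subspace_M T(1)]) unfold_locales
  have a0: "a 0 = 0" if "a \<in> A" for a
    by (rule linear_on_zero[OF _ _ subspace_M op_linear[OF that]]) unfold_locales
  note lin = linear_on_add[OF T(1)] linear_on_scale[OF T(1)]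
  let ?K = "{x \<in> M. T x = 0}"
  have "subspace ?K"
    using subspace_M by (auto simp: subspace_def lin T0)
  then have "?K = {0} \<or> ?K = M"
    by (rule irreducible) (auto simp: op_closed comm a0)
  then have K: "?K = {0}" using nz by blast
  have inj: "inj_on T M"
  proof (rule inj_onI)
    fix x y assume xy: "x \<in> M" "y \<in> M" "T x = T y"
    have "T (x - y) = T x - T y"
      by (rule linear_on_diff[OF _ _ subspace_M T(1) xy(1,2)]) unfold_locales
    then have "x - y \<in> ?K" using xy subspace_diff[OF subspace_M] by simp
    then show "x = y" using K by auto
  qed
  have "subspace (T ` M)" by (rule subspace_image[OF _ _ subspace_M T(1)]) unfold_locales
  then have "T ` M = {0} \<or> T ` M = M"
    by (rule irreducible) (use T(2) op_closed in \<open>auto simp: comm[symmetric]\<close>)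
  then have "T ` M = M" using nz by auto
  with inj show ?thesis by (simp add: bij_betw_def)
qed

end

section \<open>Polynomials in a commuting endomorphism (Horner form) and Dixmier's lemma\<close>

definition poly_op :: "(complex \<Rightarrow> 'v::ab_group_add \<Rightarrow> 'v) \<Rightarrow> ('v \<Rightarrow> 'v) \<Rightarrow> complex poly \<Rightarrow> 'v \<Rightarrow> 'v" where
  "poly_op s \<theta> p = fold_coeffs (\<lambda>a h x. s a x + \<theta> (h x)) p (\<lambda>x. 0)"

locale commuting_endomorphism = irreducible_operators +
  fixes \<theta> :: "'a \<Rightarrow> 'a"
  assumes endo: "x \<in> M \<Longrightarrow> \<theta> x \<in> M"
    and endo_linear: "linear_on s M s \<theta>"
    and endo_commutes: "a \<in> A \<Longrightarrow> x \<in> M \<Longrightarrow> \<theta> (a x) = a (\<theta> x)"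
begin

lemma vs: "vector_space s" by unfold_locales

lemma endo_simps:
  "x \<in> M \<Longrightarrow> y \<in> M \<Longrightarrow> \<theta> (x + y) = \<theta> x + \<theta> y" "x \<in> M \<Longrightarrow> \<theta> (s c x) = s c (\<theta> x)"
  "\<theta> 0 = 0" "x \<in> M \<Longrightarrow> y \<in> M \<Longrightarrow> \<theta> (x - y) = \<theta> x - \<theta> y"
  using linear_on_add[OF endo_linear] linear_on_scale[OF endo_linear]
    linear_on_zero[OF vs vs subspace_M endo_linear] linear_on_diff[OF vs vs subspace_M endo_linear]
  by auto

lemma poly_op_0: "poly_op s \<theta> 0 x = 0"
  by (simp add: poly_op_def)

text \<open>For \<open>a = 0\<close> and \<open>p = 0\<close> the left side is the zero polynomial,
  and the equation then rests on \<open>\<theta> 0 = 0\<close>.\<close>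

lemma poly_op_pCons: "poly_op s \<theta> (pCons a p) x = s a x + \<theta> (poly_op s \<theta> p x)"
  by (cases "p = 0"; cases "a = 0") (auto simp: poly_op_def fold_coeffs_def cCons_def endo_simps)

lemma poly_op_closed: "x \<in> M \<Longrightarrow> poly_op s \<theta> p x \<in> M"
  by (induction p)
    (auto simp: poly_op_0 poly_op_pCons subspace_0[OF subspace_M]
       intro!: subspace_add[OF subspace_M] subspace_scale[OF subspace_M] endo)

lemma poly_op_add: "x \<in> M \<Longrightarrow> poly_op s \<theta> (p + q) x = poly_op s \<theta> p x + poly_op s \<theta> q x"
proof (induction p q rule: poly_induct2)
  case (pCons a p b q)
  then show ?case
    by (simp add: poly_op_pCons endo_simps poly_op_closed scale_left_distrib add_ac)
qed (simp add: poly_op_0)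

lemma poly_op_smult: "x \<in> M \<Longrightarrow> poly_op s \<theta> (smult c p) x = s c (poly_op s \<theta> p x)"
  by (induction p)
    (auto simp: poly_op_0 poly_op_pCons endo_simps poly_op_closed scale_right_distrib)

lemma poly_op_linear_factor:
  "x \<in> M \<Longrightarrow> poly_op s \<theta> ([:- z, 1:] * p) x = \<theta> (poly_op s \<theta> p x) - s z (poly_op s \<theta> p x)"
  by (simp only: mult_pCons_left poly_op_add poly_op_smult)
    (simp add: poly_op_pCons poly_op_add poly_op_0 scale_minus_left endo_simps)

lemma poly_op_simps:
  "poly_op s \<theta> p 0 = 0"
  "x \<in> M \<Longrightarrow> y \<in> M \<Longrightarrow> poly_op s \<theta> p (x + y) = poly_op s \<theta> p x + poly_op s \<theta> p y"
  "x \<in> M \<Longrightarrow> poly_op s \<theta> p (s c x) = s c (poly_op s \<theta> p x)"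
  "x \<in> M \<Longrightarrow> poly_op s \<theta> p (\<theta> x) = \<theta> (poly_op s \<theta> p x)"
  by ((induction p; auto simp: poly_op_0 poly_op_pCons endo_simps poly_op_closed endo add_ac mult.commute
        scale_right_distrib subspace_scale[OF subspace_M])[1])+

lemma poly_op_diff: "x \<in> M \<Longrightarrow> y \<in> M \<Longrightarrow> poly_op s \<theta> p (x - y) = poly_op s \<theta> p x - poly_op s \<theta> p y"
  using poly_op_simps(2)[of x "s (-1) y" p] poly_op_simps(3)[of y p "-1"]
  by (simp add: subspace_neg[OF subspace_M])

lemma poly_op_sum: "x \<in> M \<Longrightarrow> poly_op s \<theta> (\<Sum>i\<in>I. p i) x = (\<Sum>i\<in>I. poly_op s \<theta> (p i) x)"
  by (induction I rule: infinite_finite_induct) (auto simp: poly_op_add poly_op_0)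

text \<open>
  Dixmier's argument: otherwise every \<open>\<theta> - c\<close> is invertible, and for \<open>v \<noteq> 0\<close> the uncountably many
  vectors \<open>(\<theta> - c)\<^sup>-\<^sup>1 v\<close> are linearly independent, since nonzero polynomials in \<open>\<theta>\<close> are injective.
\<close>

theorem scalar: "\<exists>c. \<forall>x\<in>M. \<theta> x = s c x"
proof (rule ccontr)
  assume neg: "\<not> ?thesis"
  define T where "T c x = \<theta> x - s c x" for c x
  have T_closed: "T c x \<in> M" if "x \<in> M" for c x
    using that by (simp add: T_def endo subspace_diff[OF subspace_M] subspace_scale[OF subspace_M])
  have bij: "bij_betw (T c) M M" for c
  proof -
    obtain x0 where x0: "x0 \<in> M" "\<theta> x0 \<noteq> s c x0" using neg by blast
    show ?thesis
    proof (rule nonzero_endomorphism_bijective)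
      show "linear_on s M s (T c)"
        by (auto simp: linear_on_def T_def endo_simps scale_right_distrib scale_right_diff_distrib mult.commute[of c])
      fix a x assume ax: "a \<in> A" "x \<in> M"
      have "a (\<theta> x - s c x) = a (\<theta> x) - a (s c x)"
        using ax by (intro linear_on_diff[OF vs vs subspace_M op_linear] endo subspace_scale[OF subspace_M])
      then show "T c (a x) = a (T c x)"
        using ax linear_on_scale[OF op_linear] by (simp add: T_def endo_commutes)
    qed (use x0 in \<open>auto simp: T_closed\<close>, simp add: T_def)
  qed
  obtain v where v: "v \<in> M" "v \<noteq> 0" using M_nonzero subspace_0[OF subspace_M] by blast
  have inj: "poly_op s \<theta> p x \<noteq> 0" if "p \<noteq> 0" "x \<in> M" "x \<noteq> 0" for p x
    using that
  proof (induction "degree p" arbitrary: p)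
    case 0
    then obtain a where "p = [:a:]" using degree_eq_zeroE by metis
    with 0 show ?case by (simp add: poly_op_pCons poly_op_0 endo_simps)
  next
    case (Suc n)
    then have "\<not> constant (poly p)" by (simp add: constant_degree)
    \<comment> \<open>Splitting off a root gives p(\<theta>) = (\<theta> - z) q(\<theta>), a
      composite of an injective map and one covered by induction on the degree.\<close>
    then obtain z where "poly p z = 0" using fundamental_theorem_of_algebra by blast
    then obtain q where q: "p = [:- z, 1:] * q" by (meson dvdE poly_eq_0_iff_dvd)
    with Suc have "q \<noteq> 0" by auto
    then have "degree p = Suc (degree q)" unfolding q by (subst degree_mult_eq) simp_all
    then have "poly_op s \<theta> q x \<noteq> 0" using Suc \<open>q \<noteq> 0\<close> by simp
    moreover have "poly_op s \<theta> p x = T z (poly_op s \<theta> q x)"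
      using Suc by (simp only: q poly_op_linear_factor T_def)
    moreover have "T z 0 = 0" by (simp add: T_def endo_simps)
    ultimately show ?case
      using bij[of z] poly_op_closed[OF Suc(4)] subspace_0[OF subspace_M]
      by (metis bij_betw_inv_into_left)
  qed
  define R where "R c = inv_into M (T c) v" for c
  have R: "R c \<in> M" "T c (R c) = v" for c
    using bij[of c] v(1) unfolding R_def
    by (auto simp: bij_betw_def intro!: inv_into_into f_inv_into_f)
  have inj_R: "inj R"
  proof (rule injI)
    fix c d assume eq: "R c = R d"
    have "\<theta> (R c) - s c (R c) = \<theta> (R c) - s d (R c)"
      using R(2)[of c] R(2)[of d] unfolding eq[symmetric] T_def by simp
    then have "s (c - d) (R c) = 0" by (auto simp: scale_left_diff_distrib)
    moreover have "R c \<noteq> 0" using R(2)[of c] v(2) by (auto simp: T_def endo_simps)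
    ultimately show "c = d" by simp
  qed
  have "independent (range R)"
    unfolding independent_explicit_finite_subsets
  proof (intro allI impI ballI)
    fix F u x
    assume F: "F \<subseteq> range R" "finite F" and eq: "(\<Sum>x\<in>F. s (u x) x) = 0" and x: "x \<in> F"
    obtain C where C: "F = R ` C" using F(1) by (meson subset_imageE)
    have finC: "finite C" using F(2) C inj_R finite_imageD subset_UNIV inj_on_subset by metis
    obtain c0 where c0: "c0 \<in> C" "x = R c0" using x C by blast
    define q where "q D = (\<Prod>d\<in>D. [:- d, 1:])" for D :: "complex set"
    \<comment> \<open>This is the numerator of \<Sum>c. u(R c) / (X - c) over the common denominator
      \<open>q C\<close>. As \<open>R c\<close> is (\<theta> - c)^-1 v, applying p(\<theta>) to
      \<open>v\<close> is the same as applying (q C)(\<theta>) to the given relation, which yields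
      0.\<close>
    define p where "p = (\<Sum>c\<in>C. smult (u (R c)) (q (C - {c})))"
    have step: "poly_op s \<theta> (q C) (R c) = poly_op s \<theta> (q (C - {c})) v" if "c \<in> C" for c
    proof -
      have "q C = [:- c, 1:] * q (C - {c})"
        unfolding q_def using finC that by (rule prod.remove)
      then have "poly_op s \<theta> (q C) (R c) = T c (poly_op s \<theta> (q (C - {c})) (R c))"
        by (simp only: poly_op_linear_factor R T_def)
      also have "\<dots> = poly_op s \<theta> (q (C - {c})) (T c (R c))"
        by (simp add: T_def poly_op_diff poly_op_simps R endo subspace_scale[OF subspace_M])
      finally show ?thesis by (simp add: R)
    qed
    have "poly_op s \<theta> p v = (\<Sum>c\<in>C. s (u (R c)) (poly_op s \<theta> (q (C - {c})) v))"
      by (simp add: p_def poly_op_sum poly_op_smult v)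
    also have "\<dots> = (\<Sum>c\<in>C. poly_op s \<theta> (q C) (s (u (R c)) (R c)))"
      by (intro sum.cong) (simp_all add: step poly_op_simps R)
    also have "\<dots> = poly_op s \<theta> (q C) (\<Sum>c\<in>C. s (u (R c)) (R c))"
      by (rule linear_on_sum[OF vs vs subspace_M, symmetric])
        (auto simp: linear_on_def poly_op_simps R subspace_scale[OF subspace_M])
    also have "(\<Sum>c\<in>C. s (u (R c)) (R c)) = 0"
      using eq unfolding C by (subst (asm) sum.reindex) (auto intro: inj_on_subset[OF inj_R])
    finally have "p = 0" using inj v by (auto simp: poly_op_simps)
    \<comment> \<open>Evaluate as in Lagrange interpolation: every product except the one omitting
      \<open>c0\<close> contains the factor X - c0.\<close>
    then have "0 = poly p c0" by simp
    also have "\<dots> = (\<Sum>c\<in>C. u (R c) * poly (q (C - {c})) c0)"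
      by (simp add: p_def poly_sum)
    also have "\<dots> = u (R c0) * poly (q (C - {c0})) c0"
    proof (rule sum.remove[OF finC c0(1), THEN trans])
      have "poly (q (C - {c})) c0 = 0" if "c \<in> C - {c0}" for c
        using that c0 finC by (auto simp: q_def poly_prod)
      then show "u (R c0) * poly (q (C - {c0})) c0 + (\<Sum>c\<in>C - {c0}. u (R c) * poly (q (C - {c})) c0)
        = u (R c0) * poly (q (C - {c0})) c0" by simp
    qed
    finally have "u (R c0) * poly (q (C - {c0})) c0 = 0" by simp
    moreover have "poly (q (C - {c0})) c0 \<noteq> 0" using finC by (auto simp: q_def poly_prod)
    ultimately show "u x = 0" using c0 by simp
  qed
  then have "countable (range R)" by (rule countable_independent) (use R in auto)
  then show False
    using inj_R uncountable_UNIV_complex by (simp add: countable_image_inj_eq)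
qed

end

section \<open>The density theorem\<close>

text \<open>Closure under composition is only required up to agreement on finite sets.\<close>

locale dense_operators = irreducible_operators +
  assumes op_id: "\<exists>e\<in>A. \<forall>x\<in>M. e x = x"
    and op_zero: "(\<lambda>x. 0) \<in> A"
    and op_add: "a \<in> A \<Longrightarrow> b \<in> A \<Longrightarrow> (\<lambda>x. a x + b x) \<in> A"
    and op_scale: "a \<in> A \<Longrightarrow> (\<lambda>x. s c (a x)) \<in> A"
    and op_comp: "a \<in> A \<Longrightarrow> b \<in> A \<Longrightarrow> finite F \<Longrightarrow> F \<subseteq> M \<Longrightarrow> \<exists>d\<in>A. \<forall>x\<in>F. d x = a (b x)"
begin

text \<open>The values at \<open>y\<close> of the operators killing \<open>F\<close> form a stable
  subspace; it is nonzero by assumption, hence all of \<open>M\<close>.\<close>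

lemma annihilator_orbit:
  assumes F: "finite F" "F \<subseteq> M" and y: "y \<in> M"
    and nz: "\<exists>a\<in>A. (\<forall>x\<in>F. a x = 0) \<and> a y \<noteq> 0"
    and z: "z \<in> M"
  shows "\<exists>a\<in>A. (\<forall>x\<in>F. a x = 0) \<and> a y = z"
proof -
  let ?N = "{a y | a. a \<in> A \<and> (\<forall>x\<in>F. a x = 0)}"
  have "subspace ?N"
  proof (rule subspaceI)
    show "0 \<in> ?N" using op_zero by fastforce
  next
    fix u v assume "u \<in> ?N" "v \<in> ?N"
    then obtain a b where ab: "u = a y" "v = b y" "a \<in> A" "b \<in> A" "\<forall>x\<in>F. a x = 0" "\<forall>x\<in>F. b x = 0" by blast
    then show "u + v \<in> ?N"
      by (intro CollectI exI[of _ "\<lambda>x. a x + b x"]) (auto intro: op_add)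
  next
    fix c u assume "u \<in> ?N"
    then obtain a where "u = a y" "a \<in> A" "\<forall>x\<in>F. a x = 0" by blast
    then show "s c u \<in> ?N"
      by (intro CollectI exI[of _ "\<lambda>x. s c (a x)"]) (auto intro: op_scale)
  qed
  then have "?N = {0} \<or> ?N = M"
  proof (rule irreducible)
    show "?N \<subseteq> M" using op_closed y by blast
    fix b u assume b: "b \<in> A" and "u \<in> ?N"
    then obtain a where a: "u = a y" "a \<in> A" "\<forall>x\<in>F. a x = 0" by blast
    obtain d where d: "d \<in> A" "\<forall>x\<in>insert y F. d x = b (a x)"
      using op_comp[OF b a(2), of "insert y F"] F y by auto
    have "b 0 = 0" by (rule linear_on_zero[OF _ _ subspace_M op_linear[OF b]]) unfold_locales
    with d a show "b u \<in> ?N" by (intro CollectI exI[of _ d]) auto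
  qed
  with nz z have "z \<in> ?N" by blast
  then show ?thesis by blast
qed

text \<open>The core of the density theorem. When \<open>y\<close> is added to \<open>F\<close>,
  suppose that every operator killing \<open>F\<close> and \<open>y\<close> also kills
  \<open>x\<close>. Then a y \<mapsto> a x, for \<open>a\<close> killing \<open>F\<close>, is a
  well-defined map commuting with \<open>A\<close>, hence a scalar c. So every operator killing
  \<open>F\<close> also kills x - c y, against the induction hypothesis.\<close>

lemma separation:
  assumes "finite F" "F \<subseteq> M" "x \<in> M" "x \<notin> span F"
  shows "\<exists>a\<in>A. (\<forall>y\<in>F. a y = 0) \<and> a x \<noteq> 0"
  using assms
proof (induction F arbitrary: x rule: finite_induct)
  case empty
  from op_id obtain e where "e \<in> A" "e x = x" using empty by blast
  with empty show ?case by (intro bexI[of _ e]) auto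
next
  case (insert y F)
  have vs: "vector_space s" by unfold_locales
  show ?case
  proof (cases "y \<in> span F")
    case True
    have "x \<notin> span F" using insert.prems(3) by (meson in_mono span_mono subset_insertI)
    with insert obtain a where a: "a \<in> A" "\<forall>y\<in>F. a y = 0" "a x \<noteq> 0" by blast
    have "a y = 0"
      by (rule linear_on_eq_on_span[OF vs vs, of F M a "\<lambda>_. 0"])
        (use insert a True subspace_M op_linear in \<open>auto simp: linear_on_def\<close>)
    with a show ?thesis by auto
  next
    case False
    have F: "F \<subseteq> M" "y \<in> M" using insert.prems by auto
    from insert.IH[OF F False] have nz: "\<exists>a\<in>A. (\<forall>y\<in>F. a y = 0) \<and> a y \<noteq> 0" .
    note orb = annihilator_orbit[OF insert.hyps(1) F nz]
    show ?thesis
    proof (rule ccontr)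
      assume "\<not> ?thesis"
      then have kill: "a x = 0" if "a \<in> A" "\<forall>z\<in>F. a z = 0" "a y = 0" for a
        using that by auto
      define P where "P z a \<longleftrightarrow> a \<in> A \<and> (\<forall>z\<in>F. a z = 0) \<and> a y = z" for z a
      \<comment> \<open>By \<open>kill\<close> the choice of \<open>a\<close> does not matter, and
        by \<open>annihilator_orbit\<close> a choice exists for every \<open>z\<close> in
        \<open>M\<close>.\<close>
      define \<theta> where "\<theta> z = (SOME a. P z a) x" for z
      have \<theta>: "\<theta> z = a x" if a: "P z a" for z a
      proof -
        define b where "b = (SOME a. P z a)"
        have b: "P z b" unfolding b_def using someI_ex[of "P z"] a by blast
        have "a \<in> A" "b \<in> A" using a b by (auto simp: P_def)
        then have "(\<lambda>w. a w + s (-1) (b w)) \<in> A" by (intro op_add op_scale)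
        then have "a x + s (-1) (b x) = 0"
          by (rule kill) (use a b in \<open>auto simp: P_def\<close>)
        then show ?thesis by (simp add: \<theta>_def b_def)
      qed
      have ex: "\<exists>a. P z a" if "z \<in> M" for z using orb[OF that] by (auto simp: P_def)
      interpret T: commuting_endomorphism s M A \<theta>
      proof
        fix z assume "z \<in> M"
        then obtain a where a: "P z a" using ex by blast
        then show "\<theta> z \<in> M" using \<theta>[OF a] insert.prems by (auto simp: P_def op_closed)
        fix b assume b: "b \<in> A"
        \<comment> \<open>The composite of \<open>b\<close> and \<open>a\<close> is only needed at
          \<open>x\<close>, \<open>y\<close> and the points of \<open>F\<close>, so closure on
          finite sets is enough.\<close>
        obtain d where d: "d \<in> A" "\<forall>w\<in>insert x (insert y F). d w = b (a w)"
          using op_comp[OF b, of a "insert x (insert y F)"] insert a by (auto simp: P_def)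
        have "b 0 = 0" by (rule linear_on_zero[OF vs vs subspace_M op_linear[OF b]])
        with d a have "P (b z) d" by (auto simp: P_def)
        then show "\<theta> (b z) = b (\<theta> z)" using \<theta> a d by auto
      next
        show "linear_on s M s \<theta>"
          unfolding linear_on_def
        proof (intro conjI ballI allI)
          fix u v assume "u \<in> M" "v \<in> M"
          then obtain a b where ab: "P u a" "P v b" using ex by blast
          then have "P (u + v) (\<lambda>w. a w + b w)" by (auto simp: P_def op_add)
          then show "\<theta> (u + v) = \<theta> u + \<theta> v" using \<theta> ab by metis
        next
          fix c u assume "u \<in> M"
          then obtain a where a: "P u a" using ex by blast
          then have "P (s c u) (\<lambda>w. s c (a w))" by (auto simp: P_def op_scale)
          then show "\<theta> (s c u) = s c (\<theta> u)" using \<theta> a by metis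
        qed
      qed
      obtain c where c: "\<forall>z\<in>M. \<theta> z = s c z" using T.scalar by blast
      have sy: "s c y \<in> M" using F subspace_scale[OF subspace_M] by blast
      have "x - s c y \<notin> span F"
      proof
        assume "x - s c y \<in> span F"
        then have "x - s c y \<in> span (insert y F)" by (meson in_mono span_mono subset_insertI)
        moreover have "s c y \<in> span (insert y F)" by (simp add: span_scale span_base)
        ultimately have "x - s c y + s c y \<in> span (insert y F)" by (rule span_add)
        then show False using insert.prems by simp
      qed
      then obtain a where a: "a \<in> A" "\<forall>y\<in>F. a y = 0" "a (x - s c y) \<noteq> 0"
        using insert.IH[OF F(1) subspace_diff[OF subspace_M insert.prems(2) sy]] by blast
      have "a (x - s c y) = a x - a (s c y)"
        by (rule linear_on_diff[OF vs vs subspace_M op_linear[OF a(1)] insert.prems(2) sy])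
      also have "a (s c y) = s c (a y)" using linear_on_scale[OF op_linear[OF a(1)]] F by blast
      also have "\<dots> = \<theta> (a y)" using c op_closed[OF a(1)] F by simp
      also have "\<dots> = a x" by (rule \<theta>) (use a in \<open>auto simp: P_def\<close>)
      finally show False using a(3) by simp
    qed
  qed
qed

lemma op_sum: "finite I \<Longrightarrow> (\<And>i. i \<in> I \<Longrightarrow> a i \<in> A) \<Longrightarrow> (\<lambda>x. \<Sum>i\<in>I. a i x) \<in> A"
  by (induction I rule: finite_induct) (auto intro: op_zero op_add)

text \<open>For each vector b of a basis, \<open>separation\<close> gives an operator that kills the
  other basis vectors but not b, and \<open>annihilator_orbit\<close> adjusts its value at b to T b.
  These operators are then added up.\<close>

theorem density:
  assumes E: "finite E" "E \<subseteq> M" and T: "linear_on s (span E) s T" "\<And>x. x \<in> E \<Longrightarrow> T x \<in> M"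
  shows "\<exists>a\<in>A. \<forall>x\<in>span E. a x = T x"
proof -
  have vs: "vector_space s" by unfold_locales
  have sub: "span E \<subseteq> M" by (rule span_minimal[OF E(2) subspace_M])
  obtain B where B: "B \<subseteq> E" "independent B" "E \<subseteq> span B"
    using maximal_independent_subset[of E] by blast
  have fB: "finite B" using B(1) E(1) finite_subset by blast
  have sB: "span B = span E" using B by (metis span_mono span_span subset_antisym)
  have "\<exists>a. a \<in> A \<and> (\<forall>x\<in>B - {b}. a x = 0) \<and> a b = T b" if "b \<in> B" for b
  proof -
    have "b \<notin> span (B - {b})" using B(2) that by (simp add: dependent_def)
    moreover have "B - {b} \<subseteq> M" "b \<in> M" "T b \<in> M" using B(1) E T that by auto
    ultimately show ?thesis
      using annihilator_orbit[of "B - {b}" b "T b"] separation[of "B - {b}" b] fB by blast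
  qed
  then obtain a where a: "\<And>b. b \<in> B \<Longrightarrow> a b \<in> A \<and> (\<forall>x\<in>B - {b}. a b x = 0) \<and> a b b = T b" by metis
  define d where "d = (\<lambda>x. \<Sum>b\<in>B. a b x)"
  have dA: "d \<in> A" unfolding d_def by (rule op_sum) (use fB a in auto)
  have "d x = T x" if "x \<in> B" for x
  proof -
    have "d x = a x x + (\<Sum>b\<in>B - {x}. a b x)" unfolding d_def by (rule sum.remove[OF fB that])
    also have "(\<Sum>b\<in>B - {x}. a b x) = 0" using a that by (intro sum.neutral) auto
    finally show ?thesis using a that by simp
  qed
  then have "d x = T x" if "x \<in> span B" for x
    using linear_on_eq_on_span[OF vs vs span_superset subspace_span, where f = d and g = T and E = B]
      T(1) linear_on_subset[OF op_linear[OF dA] sub] that by (simp only: sB)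
  then show ?thesis using dA sB by auto
qed

end

section \<open>Traces\<close>

text \<open>The basis picked by \<open>SOME\<close> in \<open>trace_on\<close> depends only on the
  space, so a single basis computes the traces of all maps at once.\<close>

lemma trace_on_basis:
  assumes "vector_space s" "finite E" "module.span s E = S"
  obtains B where "finite B" "\<not> module.dependent s B" "module.span s B = S"
    "\<And>f. trace_on s S f = (\<Sum>b\<in>B. module.representation s B (f b) b)"
proof -
  interpret vector_space s by fact
  let ?B = "SOME B. independent B \<and> span B = S"
  obtain B0 where "independent B0" "span B0 = S"
    using subspace_of_finite_span[OF assms(2) subspace_span[of E] subset_refl] assms(3) by metis
  then have B: "independent ?B \<and> span ?B = S"
    by (intro someI[of "\<lambda>B. independent B \<and> span B = S"]) blast
  moreover have "finite ?B"
    using independent_span_bound[OF assms(2), of ?B] B assms(3) span_superset by blast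
  ultimately show thesis by (intro that[of ?B]) (auto simp: trace_on_def Let_def)
qed

lemma trace_on_cong:
  assumes "vector_space s" "finite E" "module.span s E = S" "\<And>x. x \<in> S \<Longrightarrow> f x = g x"
  shows "trace_on s S f = trace_on s S g"
proof -
  interpret vector_space s by fact
  obtain B where "span B = S" "\<And>f. trace_on s S f = (\<Sum>b\<in>B. representation B (f b) b)"
    using trace_on_basis[OF assms(1-3)] by metis
  then show ?thesis using assms(4) span_base by (auto intro: sum.cong)
qed

lemma trace_on_linear_combination:
  assumes "vector_space s" "finite E" "module.span s E = S"
    and "\<And>i x. i \<in> I \<Longrightarrow> x \<in> S \<Longrightarrow> f i x \<in> S"
  shows "trace_on s S (\<lambda>x. \<Sum>i\<in>I. s (c i) (f i x)) = (\<Sum>i\<in>I. c i * trace_on s S (f i))"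
proof -
  interpret vector_space s by fact
  obtain B where B: "finite B" "independent B" "span B = S"
    and tr: "\<And>f. trace_on s S f = (\<Sum>b\<in>B. representation B (f b) b)"
    using trace_on_basis[OF assms(1-3)] by metis
  have "representation B (\<Sum>i\<in>I. s (c i) (f i b)) b = (\<Sum>i\<in>I. c i * representation B (f i b) b)"
    if "b \<in> B" for b
  proof -
    have "b \<in> S" using that B(3) span_base by blast
    then have f: "f i b \<in> span B" if "i \<in> I" for i using assms(4) that B(3) by blast
    then have "representation B (\<Sum>i\<in>I. s (c i) (f i b)) b = (\<Sum>i\<in>I. representation B (s (c i) (f i b)) b)"
      by (subst representation_sum[OF B(2)]) (auto intro: span_scale)
    also have "\<dots> = (\<Sum>i\<in>I. c i * representation B (f i b) b)"
      by (rule sum.cong) (auto simp: representation_scale[OF B(2)] f)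
    finally show ?thesis .
  qed
  then show ?thesis unfolding tr
    by (simp add: sum_distrib_left) (rule sum.swap)
qed

text \<open>The diagonal entries are \<psi>(b) times the coordinates of \<open>y\<close>, and they
  add up to \<psi> of the expansion of \<open>y\<close>. Together with linearity this evaluates
  traces without any change of basis.\<close>

lemma trace_on_rank_one:
  assumes "vector_space s" "finite E" "module.span s E = S" "linear_on s S (*) \<psi>" "y \<in> S"
  shows "trace_on s S (\<lambda>x. s (\<psi> x) y) = \<psi> y"
proof -
  interpret vector_space s by fact
  obtain B where B: "finite B" "independent B" "span B = S"
    and tr: "\<And>f. trace_on s S f = (\<Sum>b\<in>B. representation B (f b) b)"
    using trace_on_basis[OF assms(1-3)] by metis
  have BS: "b \<in> S" if "b \<in> B" for b using that B(3) span_base by blast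
  have S: "subspace S" using B(3) subspace_span by blast
  have "trace_on s S (\<lambda>x. s (\<psi> x) y) = (\<Sum>b\<in>B. \<psi> (s (representation B y b) b))"
    unfolding tr using assms(5) BS
    by (intro sum.cong) (auto simp: representation_scale[OF B(2)] B(3) linear_on_scale[OF assms(4)])
  also have "\<dots> = \<psi> (\<Sum>b\<in>B. s (representation B y b) b)"
    by (rule linear_on_sum[OF assms(1) vector_space_times S assms(4), symmetric])
      (auto intro: subspace_scale[OF S] BS)
  also have "(\<Sum>b\<in>B. s (representation B y b) b) = y"
    by (rule sum_representation) (use B assms(5) in auto)
  finally show ?thesis .
qed

text \<open>Basis independence of the trace. Writing y \<mapsto> f y as a sum of rank-one maps, one
  for each transported basis vector T b, allows \<open>trace_on_rank_one\<close> to be used in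
  whatever basis \<open>trace_on\<close> has chosen on \<open>U\<close>.\<close>

lemma trace_on_transport:
  assumes s: "vector_space s" and s': "vector_space s'"
    and B: "finite B" "\<not> module.dependent s B" "module.span s B = S"
    and T: "linear_on s S s' T" "bij_betw T S U" and U: "module.subspace s' U"
    and f: "linear_on s' U s' f" "\<And>y. y \<in> U \<Longrightarrow> f y \<in> U"
  shows "trace_on s' U f = (\<Sum>b\<in>B. module.representation s B (inv_into S T (f (T b))) b)"
proof -
  interpret A: vector_space s by fact
  interpret C: vector_space s' by fact
  let ?i = "inv_into S T"
  have S: "A.subspace S" using B(3) A.subspace_span by blast
  have BS: "b \<in> S" if "b \<in> B" for b using that B(3) A.span_base by blast
  have TS: "T x \<in> U" if "x \<in> S" for x using T(2) that by (auto simp: bij_betw_def)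
  have i: "?i y \<in> S" "T (?i y) = y" if "y \<in> U" for y
    using T(2) that by (auto simp: bij_betw_def inv_into_into f_inv_into_f)
  have i': "?i (T x) = x" if "x \<in> S" for x
    using T(2) that by (simp add: bij_betw_def)
  have lin: "linear_on s' U s ?i"
    unfolding linear_on_def
  proof (intro conjI ballI allI)
    fix x y assume "x \<in> U" "y \<in> U"
    then show "?i (x + y) = ?i x + ?i y"
      using i i'[of "?i x + ?i y"] A.subspace_add[OF S] linear_on_add[OF T(1)] by simp
  next
    fix c x assume "x \<in> U"
    then show "?i (s' c x) = s c (?i x)"
      using i i'[of "s c (?i x)"] A.subspace_scale[OF S] linear_on_scale[OF T(1)] by simp
  qed
  have span: "C.span (T ` B) = U"
  proof
    show "C.span (T ` B) \<subseteq> U" by (rule C.span_minimal[OF _ U]) (use TS BS in auto)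
    show "U \<subseteq> C.span (T ` B)"
      using linear_on_image_span[OF s s' S T(1), of B] BS T(2) B(3) by (auto simp: bij_betw_def)
  qed
  have \<psi>: "linear_on s' U (*) (\<lambda>y. A.representation B (?i y) b)" for b
    using linear_on_compose[OF lin _ linear_on_representation[OF s B(2), of b, unfolded B(3)]] i(1) by auto
  \<comment> \<open>The factor \<open>s' 1\<close> only gives the sum the shape required by
    \<open>trace_on_linear_combination\<close>.\<close>
  have "f y = (\<Sum>b\<in>B. s' 1 (s' (A.representation B (?i y) b) (f (T b))))" if y: "y \<in> U" for y
  proof -
    have "f y = f (T (\<Sum>b\<in>B. s (A.representation B (?i y) b) b))"
      using A.sum_representation[OF B(1,2), of "?i y"] i[OF y] B(3) by simp
    also have "T (\<Sum>b\<in>B. s (A.representation B (?i y) b) b) = (\<Sum>b\<in>B. s' (A.representation B (?i y) b) (T b))"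
      by (subst linear_on_sum[OF s s' S T(1)])
        (auto simp: linear_on_scale[OF T(1)] BS intro: A.subspace_scale[OF S])
    also have "f \<dots> = (\<Sum>b\<in>B. s' 1 (s' (A.representation B (?i y) b) (f (T b))))"
      by (subst linear_on_sum[OF s' s' U f(1)])
        (auto simp: linear_on_scale[OF f(1)] BS TS intro: C.subspace_scale[OF U])
    finally show ?thesis .
  qed
  then have "trace_on s' U f = trace_on s' U (\<lambda>y. \<Sum>b\<in>B. s' 1 (s' (A.representation B (?i y) b) (f (T b))))"
    by (intro trace_on_cong[OF s' _ span]) (use B in auto)
  also have "\<dots> = (\<Sum>b\<in>B. 1 * trace_on s' U (\<lambda>y. s' (A.representation B (?i y) b) (f (T b))))"
    by (rule trace_on_linear_combination[OF s' _ span])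
      (use B BS TS f in \<open>auto intro: C.subspace_scale[OF U]\<close>)
  also have "\<dots> = (\<Sum>b\<in>B. A.representation B (?i (f (T b))) b)"
  proof (rule sum.cong[OF refl])
    fix b assume "b \<in> B"
    then have "f (T b) \<in> U" using BS TS f by blast
    then show "1 * trace_on s' U (\<lambda>y. s' (A.representation B (?i y) b) (f (T b))) = A.representation B (?i (f (T b))) b"
      using trace_on_rank_one[OF s' _ span \<psi>[of b]] B(1) by simp
  qed
  finally show ?thesis .
qed

section \<open>Representations of finite groups\<close>

text \<open>Unlike in \<open>rep_hom\<close>, nothing is prescribed outside \<open>W\<close>, so
  averages and composites qualify without renormalisation.\<close>

definition intertwines ::
  "('g, 'x) monoid_scheme \<Rightarrow> (complex \<Rightarrow> 'w::ab_group_add \<Rightarrow> 'w) \<Rightarrow> 'w set \<Rightarrow> ('g \<Rightarrow> 'w \<Rightarrow> 'w) \<Rightarrow>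
   (complex \<Rightarrow> 'u::ab_group_add \<Rightarrow> 'u) \<Rightarrow> 'u set \<Rightarrow> ('g \<Rightarrow> 'u \<Rightarrow> 'u) \<Rightarrow> ('w \<Rightarrow> 'u) \<Rightarrow> bool" where
  "intertwines G sW W \<rho> sU U \<sigma> T \<longleftrightarrow>
     T \<in> W \<rightarrow> U \<and> linear_on sW W sU T \<and> (\<forall>g\<in>carrier G. \<forall>x\<in>W. T (\<rho> g x) = \<sigma> g (T x))"

text \<open>The factor 1/|G| is left out; where it matters, the division is made afterwards.\<close>

definition rep_average ::
  "('g, 'x) monoid_scheme \<Rightarrow> ('g \<Rightarrow> 'w \<Rightarrow> 'w) \<Rightarrow> ('g \<Rightarrow> 'u \<Rightarrow> 'u::ab_group_add) \<Rightarrow> ('w \<Rightarrow> 'u) \<Rightarrow> 'w \<Rightarrow> 'u" where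
  "rep_average G \<rho> \<sigma> T x = (\<Sum>g\<in>carrier G. \<sigma> g (T (\<rho> (inv\<^bsub>G\<^esub> g) x)))"

context group_representation
begin

lemmas rep_axioms = group_representation_axioms

lemma group_G: "group G"
  using group_hom group_hom.axioms(1) by blast

lemma vector_space_W: "vector_space sW"
  by unfold_locales

lemma rep_closed: "g \<in> carrier G \<Longrightarrow> x \<in> W \<Longrightarrow> \<rho> g x \<in> W"
  using element_image by blast

lemma rep_one: "x \<in> W \<Longrightarrow> \<rho> \<one>\<^bsub>G\<^esub> x = x"
  using id_eq_one by (metis restrict_apply')

lemma rep_inv: "g \<in> carrier G \<Longrightarrow> x \<in> W \<Longrightarrow> \<rho> (inv\<^bsub>G\<^esub> g) (\<rho> g x) = x"
  using orbit_sym_aux by blast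

lemma rep_zero: "g \<in> carrier G \<Longrightarrow> \<rho> g 0 = 0"
  by (rule linear_on_zero[OF vector_space_W vector_space_W subspace_W linear_rep])

lemma stable_span:
  assumes "E \<subseteq> W" "\<And>x. x \<in> E \<Longrightarrow> \<rho> g x \<in> span E" "g \<in> carrier G" "x \<in> span E"
  shows "\<rho> g x \<in> span E"
proof -
  have "x \<in> W \<and> \<rho> g x \<in> span E" using assms(4)
  proof (induction rule: span_induct_alt)
    case base
    then show ?case using rep_zero assms(3) subspace_0[OF subspace_W] span_zero by auto
  next
    case (step c x y)
    then show ?case
      using assms(1-3) linear_rep[OF assms(3)]
      by (auto simp: linear_on_def subset_iff subspace_scale[OF subspace_W] subspace_add[OF subspace_W]
          intro!: span_add span_scale)
  qed
  then show ?thesis ..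
qed

lemma stable_orbit_span:
  assumes "x \<in> W" "g \<in> carrier G" "y \<in> span ((\<lambda>h. \<rho> h x) ` carrier G)"
  shows "\<rho> g y \<in> span ((\<lambda>h. \<rho> h x) ` carrier G)"
proof (rule stable_span[OF _ _ assms(2,3)])
  show "(\<lambda>h. \<rho> h x) ` carrier G \<subseteq> W" using assms(1) rep_closed by auto
  fix y assume "y \<in> (\<lambda>h. \<rho> h x) ` carrier G"
  then obtain h where h: "h \<in> carrier G" "y = \<rho> h x" by blast
  then have "\<rho> g y = \<rho> (g \<otimes>\<^bsub>G\<^esub> h) x" using composition_rule assms(1,2) by simp
  moreover have "g \<otimes>\<^bsub>G\<^esub> h \<in> carrier G" using assms(2) h group_G by (simp add: group.is_monoid monoid.m_closed)
  ultimately show "\<rho> g y \<in> span ((\<lambda>h. \<rho> h x) ` carrier G)" by (auto intro: span_base)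
qed

lemma mem_orbit_span: "x \<in> W \<Longrightarrow> x \<in> span ((\<lambda>h. \<rho> h x) ` carrier G)"
  using rep_one group.is_monoid[OF group_G] monoid.one_closed by (metis image_eqI span_base)

text \<open>\<open>N\<close> may be infinite-dimensional, but the orbit of a vector spans a
  finite-dimensional stable subspace. Among nonzero stable subspaces with a finite spanning set, one
  with the fewest spanning vectors is irreducible: a nonzero stable subspace of it needs as many
  vectors, so it has the same dimension.\<close>

lemma exists_irreducible_subspace:
  assumes fin: "finite (carrier G)"
    and N: "subspace N" "N \<subseteq> W" "N \<noteq> {0}" "\<And>g x. g \<in> carrier G \<Longrightarrow> x \<in> N \<Longrightarrow> \<rho> g x \<in> N"
  obtains U E where "finite E" "independent E" "span E = U" "U \<subseteq> N" "U \<noteq> {0}"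
    "\<forall>g\<in>carrier G. \<forall>x\<in>U. \<rho> g x \<in> U"
    "\<forall>X. subspace X \<and> X \<subseteq> U \<and> (\<forall>g\<in>carrier G. \<forall>x\<in>X. \<rho> g x \<in> X) \<longrightarrow> X = {0} \<or> X = U"
proof -
  define P where "P E \<longleftrightarrow> finite E \<and> span E \<subseteq> N \<and> span E \<noteq> {0} \<and>
    (\<forall>g\<in>carrier G. \<forall>x\<in>span E. \<rho> g x \<in> span E)" for E
  obtain x where x: "x \<in> N" "x \<noteq> 0" using N subspace_0 by blast
  have "P ((\<lambda>h. \<rho> h x) ` carrier G)"
    unfolding P_def
  proof (intro conjI ballI)
    show "span ((\<lambda>h. \<rho> h x) ` carrier G) \<subseteq> N" by (rule span_minimal) (use N x in auto)
    show "span ((\<lambda>h. \<rho> h x) ` carrier G) \<noteq> {0}" using mem_orbit_span[of x] x N by blast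
  qed (use fin stable_orbit_span x N in blast)+
  then obtain E where E: "P E" and least: "\<And>E'. P E' \<Longrightarrow> card E \<le> card E'"
    using ex_has_least_nat[of P _ card] by blast
  have fE: "finite E" using E by (simp add: P_def)
  obtain E' where E': "finite E'" "independent E'" "span E' = span E" "card E' \<le> card E"
    by (rule subspace_of_finite_span[OF fE subspace_span subset_refl])
  show thesis
  proof (rule that[of E' "span E"])
    show "\<forall>X. subspace X \<and> X \<subseteq> span E \<and> (\<forall>g\<in>carrier G. \<forall>x\<in>X. \<rho> g x \<in> X) \<longrightarrow> X = {0} \<or> X = span E"
    proof (intro allI impI, elim conjE)
      fix X assume X: "subspace X" "X \<subseteq> span E" "\<forall>g\<in>carrier G. \<forall>x\<in>X. \<rho> g x \<in> X"
      obtain D where D: "finite D" "independent D" "span D = X" "card D \<le> card E"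
        by (rule subspace_of_finite_span[OF fE X(1,2)])
      show "X = {0} \<or> X = span E"
      proof (cases "X = {0}")
        case False
        then have "P D" using D X E by (auto simp: P_def)
        then have card: "card D = card E" using least D(4) by (metis le_antisym)
        have "span E \<subseteq> span D"
        proof
          fix y assume y: "y \<in> span E"
          show "y \<in> span D"
          proof (rule ccontr)
            assume not: "y \<notin> span D"
            then have "independent (insert y D)" using D(2) independent_insertI by blast
            moreover have "insert y D \<subseteq> span E" using y D(3) X(2) span_superset by blast
            ultimately have "card (insert y D) \<le> card E"
              using independent_span_bound[of E] E by (auto simp: P_def)
            moreover have "y \<notin> D" using not span_base by blast
            ultimately show False using D(1) card by simp
          qed
        qed
        then show ?thesis using D(3) X(2) by blast
      qed simp
    qed
  qed (use E E' in \<open>auto simp: P_def\<close>)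
qed

end

lemma linear_on_sum_fun:
  assumes "vector_space s'" "\<And>i. i \<in> I \<Longrightarrow> linear_on s S s' (f i)"
  shows "linear_on s S s' (\<lambda>x. \<Sum>i\<in>I. f i x)"
proof -
  interpret vector_space s' by fact
  show ?thesis using assms(2)
    by (auto simp: linear_on_def scale_sum_right simp flip: sum.distrib intro!: sum.cong)
qed

lemma rep_average_intertwines:
  assumes W: "group_representation G sW W \<rho>" and U: "group_representation G sU U \<sigma>"
    and fin: "finite (carrier G)" and T: "linear_on sW W sU T" "T \<in> W \<rightarrow> U"
  shows "intertwines G sW W \<rho> sU U \<sigma> (rep_average G \<rho> \<sigma> T)"
proof -
  interpret W: group_representation G sW W \<rho> by fact
  interpret U: group_representation G sU U \<sigma> by fact
  interpret group G by (rule W.group_G)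
  have lin: "linear_on sW W sU (\<lambda>x. \<sigma> g (T (\<rho> (inv\<^bsub>G\<^esub> g) x)))" if "g \<in> carrier G" for g
    using that T W.rep_closed
    by (intro linear_on_compose[OF linear_on_compose[OF W.linear_rep[of "inv\<^bsub>G\<^esub> g"] _ T(1)] _ U.linear_rep]) auto
  show ?thesis
    unfolding intertwines_def
  proof (intro conjI ballI)
    show "rep_average G \<rho> \<sigma> T \<in> W \<rightarrow> U"
      using T(2) by (auto simp: rep_average_def W.rep_closed Pi_iff
          intro!: U.subspace_sum[OF U.subspace_W] U.rep_closed)
    show "linear_on sW W sU (rep_average G \<rho> \<sigma> T)"
      unfolding rep_average_def by (rule linear_on_sum_fun[OF U.vector_space_W lin])
    fix h x assume h: "h \<in> carrier G" and x: "x \<in> W"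
    have T_in: "T (\<rho> (inv\<^bsub>G\<^esub> g) x) \<in> U" if "g \<in> carrier G" for g
      using that x T(2) W.rep_closed by auto
    have "rep_average G \<rho> \<sigma> T (\<rho> h x) = (\<Sum>g\<in>carrier G. \<sigma> h (\<sigma> g (T (\<rho> (inv\<^bsub>G\<^esub> g) x))))"
      unfolding rep_average_def
    proof (rule sum.reindex_bij_witness[where i = "\<lambda>g. h \<otimes>\<^bsub>G\<^esub> g" and j = "\<lambda>g. inv\<^bsub>G\<^esub> h \<otimes>\<^bsub>G\<^esub> g"])
      fix g assume g: "g \<in> carrier G"
      have "\<rho> (inv\<^bsub>G\<^esub> (inv\<^bsub>G\<^esub> h \<otimes>\<^bsub>G\<^esub> g)) x = \<rho> (inv\<^bsub>G\<^esub> g) (\<rho> h x)"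
        using g h x by (simp add: inv_mult_group W.composition_rule)
      moreover have "\<sigma> g y = \<sigma> h (\<sigma> (inv\<^bsub>G\<^esub> h \<otimes>\<^bsub>G\<^esub> g) y)" if "y \<in> U" for y
        using g h that by (simp flip: U.composition_rule m_assoc)
      ultimately show "\<sigma> h (\<sigma> (inv\<^bsub>G\<^esub> h \<otimes>\<^bsub>G\<^esub> g) (T (\<rho> (inv\<^bsub>G\<^esub> (inv\<^bsub>G\<^esub> h \<otimes>\<^bsub>G\<^esub> g)) x)))
          = \<sigma> g (T (\<rho> (inv\<^bsub>G\<^esub> g) (\<rho> h x)))"
        using T(2) W.rep_closed g h x by (metis PiE inv_closed)
    qed (use h in \<open>auto simp flip: m_assoc\<close>)
    also have "\<dots> = \<sigma> h (rep_average G \<rho> \<sigma> T x)"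
      unfolding rep_average_def
      by (rule linear_on_sum[OF U.vector_space_W U.vector_space_W U.subspace_W U.linear_rep[OF h], symmetric])
        (auto intro: U.rep_closed T_in)
    finally show "rep_average G \<rho> \<sigma> T (\<rho> h x) = \<sigma> h (rep_average G \<rho> \<sigma> T x)" .
  qed
qed

lemma irreducible_repD:
  assumes "irreducible_representation G sW W \<rho>"
  shows "group_representation G sW W \<rho>" "W \<noteq> {0}" "vector_space sW" "module.subspace sW W"
    and "module.subspace sW U \<Longrightarrow> U \<subseteq> W \<Longrightarrow> (\<And>g x. g \<in> carrier G \<Longrightarrow> x \<in> U \<Longrightarrow> \<rho> g x \<in> U) \<Longrightarrow> U = {0} \<or> U = W"
proof -
  show "group_representation G sW W \<rho>" "W \<noteq> {0}"
    using assms by (auto simp: irreducible_representation_def)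
  then interpret group_representation G sW W \<rho> by simp
  show "vector_space sW" "subspace W" by (fact vector_space_W subspace_W)+
qed (use assms in \<open>auto simp: irreducible_representation_def\<close>)

text \<open>The finite orbit of a nonzero vector spans a nonzero stable subspace, hence all of
  \<open>W\<close>.\<close>

lemma irreducible_rep_basis:
  assumes irr: "irreducible_representation G sW W \<rho>" and fin: "finite (carrier G)"
  obtains B where "finite B" "\<not> module.dependent sW B" "module.span sW B = W"
proof -
  interpret group_representation G sW W \<rho> by (rule irreducible_repD[OF irr])
  obtain x where x: "x \<in> W" "x \<noteq> 0"
    using irreducible_repD(2)[OF irr] subspace_0[OF subspace_W] by blast
  let ?E = "(\<lambda>h. \<rho> h x) ` carrier G"
  have "span ?E \<subseteq> W" by (rule span_minimal[OF _ subspace_W]) (use x rep_closed in auto)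
  then have "span ?E = {0} \<or> span ?E = W"
    by (rule irreducible_repD(5)[OF irr subspace_span]) (rule stable_orbit_span[OF x(1)])
  then have "span ?E = W" using mem_orbit_span x by blast
  then show thesis
    using subspace_of_finite_span[OF _ subspace_W, of ?E] that fin by (metis finite_imageI order_refl)
qed

section \<open>Schur's lemma\<close>

lemma intertwinesD:
  assumes "intertwines G sW W \<rho> sU U \<sigma> T"
  shows "linear_on sW W sU T" "x \<in> W \<Longrightarrow> T x \<in> U" "g \<in> carrier G \<Longrightarrow> x \<in> W \<Longrightarrow> T (\<rho> g x) = \<sigma> g (T x)"
  using assms by (auto simp: intertwines_def)

lemma schur_injective:
  assumes irr: "irreducible_representation G sW W \<rho>" and U: "group_representation G sU U \<sigma>"
    and T: "intertwines G sW W \<rho> sU U \<sigma> T" and x0: "x0 \<in> W" "T x0 \<noteq> 0"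
  shows "inj_on T W"
proof -
  interpret W: group_representation G sW W \<rho> by (rule irreducible_repD[OF irr])
  interpret U: group_representation G sU U \<sigma> by fact
  note T = intertwinesD[OF T]
  note T0 = linear_on_zero[OF W.vector_space_W U.vector_space_W W.subspace_W T(1)]
  let ?K = "{x \<in> W. T x = 0}"
  have "W.subspace ?K"
    using W.subspace_W by (auto simp: W.subspace_def T0 linear_on_add[OF T(1)] linear_on_scale[OF T(1)])
  then have "?K = {0} \<or> ?K = W"
    by (rule irreducible_repD(5)[OF irr]) (auto simp: W.rep_closed T(3) U.rep_zero)
  then have K: "?K = {0}" using x0 by blast
  show ?thesis
  proof (rule inj_onI)
    fix x y assume xy: "x \<in> W" "y \<in> W" "T x = T y"
    then have "T (x - y) = 0"
      by (simp add: linear_on_diff[OF W.vector_space_W U.vector_space_W W.subspace_W T(1)])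
    then have "x - y \<in> ?K" using xy W.subspace_diff[OF W.subspace_W] by simp
    then show "x = y" using K by auto
  qed
qed

lemma schur_bijective:
  assumes irr: "irreducible_representation G sW W \<rho>" "irreducible_representation G sU U \<sigma>"
    and T: "intertwines G sW W \<rho> sU U \<sigma> T" and x0: "x0 \<in> W" "T x0 \<noteq> 0"
  shows "bij_betw T W U"
proof -
  interpret W: group_representation G sW W \<rho> by (rule irreducible_repD[OF irr(1)])
  interpret U: group_representation G sU U \<sigma> by (rule irreducible_repD[OF irr(2)])
  note T' = intertwinesD[OF T]
  have "U.subspace (T ` W)"
    by (rule subspace_image[OF W.vector_space_W U.vector_space_W W.subspace_W T'(1)])
  then have "T ` W = {0} \<or> T ` W = U"
    by (rule irreducible_repD(5)[OF irr(2)])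
      (use T'(2) W.rep_closed in \<open>auto simp: T'(3)[symmetric]\<close>)
  then have "T ` W = U" using x0 by auto
  then show ?thesis using schur_injective[OF irr(1) U.rep_axioms T x0] by (simp add: bij_betw_def)
qed

text \<open>An instance of Dixmier's argument: \<open>W\<close> is finite-dimensional, hence
  countably spanned, and the operators \<rho> g form the irreducible family.\<close>

lemma schur_scalar:
  assumes irr: "irreducible_representation G sW W \<rho>" and fin: "finite (carrier G)"
    and T: "intertwines G sW W \<rho> sW W \<rho> T"
  shows "\<exists>c. \<forall>x\<in>W. T x = sW c x"
proof -
  interpret W: group_representation G sW W \<rho> by (rule irreducible_repD[OF irr])
  obtain B where B: "finite B" "W.span B = W" using irreducible_rep_basis[OF irr fin] by metis
  interpret commuting_endomorphism sW W "\<rho> ` carrier G" T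
  proof
    show "\<exists>B. countable B \<and> W \<subseteq> W.span B" using B countable_finite by blast
    show "W \<noteq> {0}" by (rule irreducible_repD[OF irr])
  next
    fix N assume N: "W.subspace N" "N \<subseteq> W" "\<And>a x. a \<in> \<rho> ` carrier G \<Longrightarrow> x \<in> N \<Longrightarrow> a x \<in> N"
    then show "N = {0} \<or> N = W" by (intro irreducible_repD(5)[OF irr]) auto
  qed (use intertwinesD[OF T] W.subspace_W W.rep_closed W.linear_rep in auto)
  show ?thesis by (rule scalar)
qed

section \<open>Matrix coefficients, orthogonality and characters\<close>

abbreviation group_sum ::
  "('g, 'x) monoid_scheme \<Rightarrow> ('g \<Rightarrow> 'w \<Rightarrow> 'w) \<Rightarrow> (complex \<Rightarrow> 'u::ab_group_add \<Rightarrow> 'u) \<Rightarrow>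
   ('g \<Rightarrow> 'u \<Rightarrow> 'u) \<Rightarrow> ('w \<Rightarrow> complex) \<Rightarrow> 'w \<Rightarrow> 'u \<Rightarrow> 'u" where
  "group_sum G \<rho> sU \<sigma> \<phi> u w \<equiv> \<Sum>g\<in>carrier G. sU (\<phi> (\<rho> (inv\<^bsub>G\<^esub> g) u)) (\<sigma> g w)"

text \<open>\<open>group_sum\<close> has two readings. In \<open>w\<close> it is a group algebra
  element acting on \<open>U\<close>; in \<open>u\<close> it is the average of the rank-one map u
  \<mapsto> \<phi>(u) w. The second reading makes it equivariant and so accessible to Schur's
  lemma.\<close>

lemma matrix_coefficient_intertwines:
  assumes W: "group_representation G sW W \<rho>" and U: "group_representation G sU U \<sigma>"
    and fin: "finite (carrier G)" and \<phi>: "linear_on sW W (*) \<phi>" and w: "w \<in> U"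
  shows "intertwines G sW W \<rho> sU U \<sigma> (\<lambda>u. group_sum G \<rho> sU \<sigma> \<phi> u w)"
proof -
  interpret W: group_representation G sW W \<rho> by fact
  interpret U: group_representation G sU U \<sigma> by fact
  have "intertwines G sW W \<rho> sU U \<sigma> (rep_average G \<rho> \<sigma> (\<lambda>u. sU (\<phi> u) w))"
    using \<phi> w
    by (intro rep_average_intertwines[OF W U fin])
      (auto simp: linear_on_def U.scale_left_distrib intro: U.subspace_scale[OF U.subspace_W])
  moreover have "rep_average G \<rho> \<sigma> (\<lambda>u. sU (\<phi> u) w) = (\<lambda>u. group_sum G \<rho> sU \<sigma> \<phi> u w)"
    using w by (auto simp: rep_average_def fun_eq_iff linear_on_scale[OF U.linear_rep] intro!: sum.cong)
  ultimately show ?thesis by simp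
qed

text \<open>This is |G| / dim W, with the dimension written as the trace of the identity.\<close>

definition schur_constant :: "('g, 'x) monoid_scheme \<Rightarrow> (complex \<Rightarrow> 'w::ab_group_add \<Rightarrow> 'w) \<Rightarrow> 'w set \<Rightarrow> complex" where
  "schur_constant G sW W = of_nat (card (carrier G)) / trace_on sW W (\<lambda>x. x)"

text \<open>Both sides are scalar in \<open>u\<close> by Schur's lemma; the scalar is determined by comparing traces.\<close>

lemma schur_orthogonality:
  assumes irr: "irreducible_representation G sW W \<rho>" and fin: "finite (carrier G)"
  shows "schur_constant G sW W \<noteq> 0"
    and "linear_on sW W (*) \<phi> \<Longrightarrow> u \<in> W \<Longrightarrow> w \<in> W \<Longrightarrow>
      group_sum G \<rho> sW \<rho> \<phi> u w = sW (schur_constant G sW W * \<phi> w) u"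
proof -
  interpret W: group_representation G sW W \<rho> by (rule irreducible_repD[OF irr])
  interpret group G by (rule W.group_G)
  obtain B where B: "finite B" "W.span B = W" using irreducible_rep_basis[OF irr fin] by metis
  define d where "d = trace_on sW W (\<lambda>x. x)"
  let ?n = "of_nat (card (carrier G)) :: complex"
  have n: "?n \<noteq> 0" using fin one_closed by (auto simp: card_eq_0_iff)
  have *: "\<exists>l. l * d = ?n * \<phi> w \<and> (\<forall>u\<in>W. group_sum G \<rho> sW \<rho> \<phi> u w = sW l u)"
    if \<phi>: "linear_on sW W (*) \<phi>" and w: "w \<in> W" for \<phi> w
  proof -
    let ?T = "\<lambda>u. group_sum G \<rho> sW \<rho> \<phi> u w"
    obtain l where l: "\<forall>u\<in>W. ?T u = sW l u"
      using schur_scalar[OF irr fin matrix_coefficient_intertwines[OF W.rep_axioms W.rep_axioms fin \<phi> w]] by blast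
    \<comment> \<open>The sum over a one-element set presents the scalar map as a linear
      combination, as \<open>trace_on_linear_combination\<close> expects.\<close>
    have "l * d = trace_on sW W (\<lambda>u. \<Sum>i\<in>{()}. sW l u)"
      unfolding d_def by (subst trace_on_linear_combination[OF W.vector_space_W B]) auto
    also have "\<dots> = trace_on sW W (\<lambda>u. \<Sum>g\<in>carrier G. sW 1 (sW (\<phi> (\<rho> (inv\<^bsub>G\<^esub> g) u)) (\<rho> g w)))"
      using l by (intro trace_on_cong[OF W.vector_space_W B]) simp
    also have "\<dots> = (\<Sum>g\<in>carrier G. 1 * trace_on sW W (\<lambda>u. sW (\<phi> (\<rho> (inv\<^bsub>G\<^esub> g) u)) (\<rho> g w)))"
      using w by (intro trace_on_linear_combination[OF W.vector_space_W B])
        (auto intro: W.subspace_scale[OF W.subspace_W] W.rep_closed)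
    \<comment> \<open>Each term is a rank-one map with trace \<phi>(g^-1 g w) = \<phi> w.\<close>
    also have "\<dots> = (\<Sum>g\<in>carrier G. \<phi> w)"
    proof (rule sum.cong[OF refl])
      fix g assume g: "g \<in> carrier G"
      have "linear_on sW W (*) (\<lambda>u. \<phi> (\<rho> (inv\<^bsub>G\<^esub> g) u))"
        using g W.rep_closed by (intro linear_on_compose[OF W.linear_rep _ \<phi>]) auto
      then have "trace_on sW W (\<lambda>u. sW (\<phi> (\<rho> (inv\<^bsub>G\<^esub> g) u)) (\<rho> g w)) = \<phi> (\<rho> (inv\<^bsub>G\<^esub> g) (\<rho> g w))"
        using trace_on_rank_one[OF W.vector_space_W B] g w W.rep_closed by blast
      then show "1 * trace_on sW W (\<lambda>u. sW (\<phi> (\<rho> (inv\<^bsub>G\<^esub> g) u)) (\<rho> g w)) = \<phi> w"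
        using W.rep_inv[OF g w] by simp
    qed
    finally show ?thesis using l by auto
  qed
  obtain x \<psi> where x: "x \<in> W" and \<psi>: "linear_on sW W (*) \<psi>" "\<psi> x = 1"
  proof -
    obtain x where "x \<in> W" "x \<noteq> 0"
      using irreducible_repD(2)[OF irr] W.subspace_0[OF W.subspace_W] by blast
    then show thesis using W.exists_functional[of x] that linear_on_of_linear by metis
  qed
  \<comment> \<open>Since \<psi> x = 1, the relation says that a multiple of \<open>d\<close> equals
    |G|, which is not 0.\<close>
  have d: "d \<noteq> 0" using *[OF \<psi>(1) x] \<psi>(2) n by auto
  have c: "schur_constant G sW W = ?n / d" by (simp add: schur_constant_def d_def)
  show "schur_constant G sW W \<noteq> 0" using n d c by simp
  assume "linear_on sW W (*) \<phi>" "u \<in> W" "w \<in> W"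
  moreover from this obtain l where "l * d = ?n * \<phi> w"
    "\<forall>u\<in>W. group_sum G \<rho> sW \<rho> \<phi> u w = sW l u" using * by blast
  moreover from this have "l = ?n / d * \<phi> w" using d by (simp add: field_simps)
  ultimately show "group_sum G \<rho> sW \<rho> \<phi> u w = sW (schur_constant G sW W * \<phi> w) u"
    unfolding c by blast
qed

lemma matrix_coefficient_zero:
  assumes W: "group_representation G sW W \<rho>" and U: "group_representation G sU U \<sigma>"
    and fin: "finite (carrier G)" and \<phi>: "linear_on sW W (*) \<phi>" and w: "w \<in> U" and u: "u \<in> W"
    and zero: "\<And>T x. intertwines G sW W \<rho> sU U \<sigma> T \<Longrightarrow> x \<in> W \<Longrightarrow> T x = 0"
  shows "group_sum G \<rho> sU \<sigma> \<phi> u w = 0"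
  using zero[OF matrix_coefficient_intertwines[OF W U fin \<phi> w] u] .

text \<open>
  With \<open>\<phi> u = 1\<close>, the group algebra element \<open>\<Sum>\<^sub>g \<phi>(g\<^sup>-\<^sup>1 u) g\<close> has nonzero trace on \<open>W\<close>, but
  acts as zero on any irreducible representation not isomorphic to \<open>W\<close>.
\<close>

theorem isomorphic_if_same_character:
  assumes irr: "irreducible_representation G sW W \<rho>" "irreducible_representation G sU U \<sigma>"
    and fin: "finite (carrier G)" and char: "rep_character G sW W \<rho> = rep_character G sU U \<sigma>"
  obtains T where "intertwines G sW W \<rho> sU U \<sigma> T" "bij_betw T W U"
proof (rule ccontr)
  assume neg: "\<not> thesis"
  note result = that
  have zero: "T x = 0" if T: "intertwines G sW W \<rho> sU U \<sigma> T" "x \<in> W" for T x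
    using schur_bijective[OF irr T] result[OF T(1)] neg by blast
  interpret W: group_representation G sW W \<rho> by (rule irreducible_repD[OF irr(1)])
  interpret U: group_representation G sU U \<sigma> by (rule irreducible_repD[OF irr(2)])
  interpret group G by (rule W.group_G)
  obtain BW where BW: "finite BW" "W.span BW = W" using irreducible_rep_basis[OF irr(1) fin] by metis
  obtain BU where BU: "finite BU" "U.span BU = U" using irreducible_rep_basis[OF irr(2) fin] by metis
  obtain u where u: "u \<in> W" "u \<noteq> 0"
    using irreducible_repD(2)[OF irr(1)] W.subspace_0[OF W.subspace_W] by blast
  obtain \<phi> where \<phi>: "linear_on sW W (*) \<phi>" "\<phi> u = 1"
    using W.exists_functional[OF u(2)] linear_on_of_linear by metis
  define c where "c = schur_constant G sW W"
  note c = schur_orthogonality[OF irr(1) fin, folded c_def]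
  define k where "k g = \<phi> (\<rho> (inv\<^bsub>G\<^esub> g) u)" for g
  have "c = c * \<phi> u" using \<phi> by simp
  also have "\<dots> = trace_on sW W (\<lambda>w. sW (c * \<phi> w) u)"
    by (rule trace_on_rank_one[OF W.vector_space_W BW _ u(1), symmetric])
      (use \<phi>(1) in \<open>auto simp: linear_on_def algebra_simps\<close>)
  also have "\<dots> = trace_on sW W (\<lambda>w. \<Sum>g\<in>carrier G. sW (k g) (\<rho> g w))"
    unfolding k_def using c(2)[OF \<phi>(1) u(1)] by (intro trace_on_cong[OF W.vector_space_W BW]) simp
  also have "\<dots> = (\<Sum>g\<in>carrier G. k g * trace_on sW W (\<rho> g))"
    by (rule trace_on_linear_combination[OF W.vector_space_W BW W.rep_closed])
  also have "\<dots> = (\<Sum>g\<in>carrier G. k g * trace_on sU U (\<sigma> g))"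
    using char by (intro sum.cong) (auto simp: rep_character_def fun_eq_iff restrict_def split: if_splits)
  also have "\<dots> = trace_on sU U (\<lambda>w. \<Sum>g\<in>carrier G. sU (k g) (\<sigma> g w))"
    by (rule trace_on_linear_combination[OF U.vector_space_W BU U.rep_closed, symmetric])
  \<comment> \<open>The zero map appears as an empty combination, so linearity of the trace gives
    the value 0.\<close>
  also have "\<dots> = trace_on sU U (\<lambda>w. \<Sum>g\<in>{}. sU 0 w)"
    unfolding k_def
    by (intro trace_on_cong[OF U.vector_space_W BU])
      (simp add: matrix_coefficient_zero[OF W.rep_axioms
          U.rep_axioms fin \<phi>(1) _ u(1)] zero)
  also have "\<dots> = 0"
    by (subst trace_on_linear_combination[OF U.vector_space_W BU]) auto
  finally show False using c(1) by simp
qed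

text \<open>Applying \<open>trace_on_transport\<close> to the identity of \<open>W\<close> and to
  \<open>T\<close> expresses both traces in the same basis of \<open>W\<close>.\<close>

lemma same_character_if_isomorphic:
  assumes irr: "irreducible_representation G sW W \<rho>" "irreducible_representation G sU U \<sigma>"
    and fin: "finite (carrier G)" and T: "intertwines G sW W \<rho> sU U \<sigma> T" "bij_betw T W U"
  shows "rep_character G sW W \<rho> = rep_character G sU U \<sigma>"
proof -
  interpret W: group_representation G sW W \<rho> by (rule irreducible_repD[OF irr(1)])
  interpret U: group_representation G sU U \<sigma> by (rule irreducible_repD[OF irr(2)])
  obtain B where B: "finite B" "W.independent B" "W.span B = W"
    using irreducible_rep_basis[OF irr(1) fin] by metis
  have "trace_on sW W (\<rho> g) = trace_on sU U (\<sigma> g)" if g: "g \<in> carrier G" for g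
  proof -
    have "trace_on sW W (\<rho> g) = (\<Sum>b\<in>B. W.representation B (inv_into W (\<lambda>x. x) (\<rho> g b)) b)"
      by (rule trace_on_transport[OF W.vector_space_W W.vector_space_W B _ _ W.subspace_W W.linear_rep[OF g] W.rep_closed[OF g]])
        (auto simp: linear_on_def bij_betw_def)
    also have "\<dots> = (\<Sum>b\<in>B. W.representation B (inv_into W T (\<sigma> g (T b))) b)"
    proof (rule sum.cong[OF refl])
      fix b assume "b \<in> B"
      then have b: "b \<in> W" using B(3) W.span_base by blast
      have "inv_into W T (\<sigma> g (T b)) = \<rho> g b"
        using T(2) W.rep_closed[OF g b] intertwinesD(3)[OF T(1) g b] by (simp add: bij_betw_def flip: intertwinesD(3)[OF T(1) g b])
      moreover have "inv_into W (\<lambda>x. x) (\<rho> g b) = \<rho> g b"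
        using W.rep_closed[OF g b] by (metis inj_on_id2 inv_into_f_f)
      ultimately show "W.representation B (inv_into W (\<lambda>x. x) (\<rho> g b)) b = W.representation B (inv_into W T (\<sigma> g (T b))) b"
        by simp
    qed
    also have "\<dots> = trace_on sU U (\<sigma> g)"
      by (rule trace_on_transport[OF W.vector_space_W U.vector_space_W B intertwinesD(1)[OF T(1)] T(2) U.subspace_W U.linear_rep[OF g] U.rep_closed[OF g], symmetric])
    finally show ?thesis .
  qed
  then show ?thesis by (auto simp: rep_character_def fun_eq_iff restrict_def)
qed

text \<open>The laws hold in \<open>D\<close> because they hold after the injective map \<Phi>.
  Extensionality is required separately, since elements of \<open>BijGroup\<close> are extensional
  functions. This serves both the coordinate models and the direct sum of tensor products.\<close>

lemma group_representation_transport: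
  assumes rep: "group_representation G s V \<sigma>" and s': "vector_space s'" and D: "module.subspace s' D"
    and \<Phi>: "linear_on s' D s \<Phi>" "\<Phi> \<in> D \<rightarrow> V" "inj_on \<Phi> D"
    and \<rho>: "\<And>g. g \<in> carrier G \<Longrightarrow> \<rho> g \<in> extensional D" "\<And>g t. g \<in> carrier G \<Longrightarrow> t \<in> D \<Longrightarrow> \<rho> g t \<in> D"
      "\<And>g t. g \<in> carrier G \<Longrightarrow> t \<in> D \<Longrightarrow> \<Phi> (\<rho> g t) = \<sigma> g (\<Phi> t)"
  shows "group_representation G s' D \<rho>"
proof -
  interpret V: group_representation G s V \<sigma> by fact
  interpret D: vector_space s' by fact
  interpret group G by (rule V.group_G)
  have eqI: "t = t'" if "t \<in> D" "t' \<in> D" "\<Phi> t = \<Phi> t'" for t t'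
    using that \<Phi>(3) by (simp add: inj_on_def)
  have \<Phi>V: "\<Phi> t \<in> V" if "t \<in> D" for t using \<Phi>(2) that by blast
  have mult: "\<rho> (g \<otimes>\<^bsub>G\<^esub> h) t = \<rho> g (\<rho> h t)" if "g \<in> carrier G" "h \<in> carrier G" "t \<in> D" for g h t
    using that by (intro eqI) (auto simp: \<rho> V.composition_rule \<Phi>V)
  have one: "\<rho> \<one>\<^bsub>G\<^esub> t = t" if "t \<in> D" for t
    using that by (intro eqI) (auto simp: \<rho> V.rep_one \<Phi>V)
  have bij: "\<rho> g \<in> Bij D" if g: "g \<in> carrier G" for g
  proof -
    have "bij_betw (\<rho> g) D D"
      by (rule bij_betw_byWitness[where f' = "\<rho> (inv\<^bsub>G\<^esub> g)"])
        (use g in \<open>auto simp: \<rho> one simp flip: mult\<close>)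
    then show ?thesis using \<rho>(1)[OF g] by (simp add: Bij_def)
  qed
  have "group_action G D \<rho>"
  proof (rule group_action.intro, rule group_hom.intro[OF group_axioms group_BijGroup], unfold_locales)
    show "\<rho> \<in> hom G (BijGroup D)"
    proof (rule homI)
      fix g h assume gh: "g \<in> carrier G" "h \<in> carrier G"
      then have "compose D (\<rho> g) (\<rho> h) = \<rho> (g \<otimes>\<^bsub>G\<^esub> h)"
        by (intro extensionalityI[OF compose_extensional \<rho>(1)]) (auto simp: compose_eq mult)
      then show "\<rho> (g \<otimes>\<^bsub>G\<^esub> h) = \<rho> g \<otimes>\<^bsub>BijGroup D\<^esub> \<rho> h"
        using bij gh by (simp add: BijGroup_def)
    qed (simp add: BijGroup_def bij)
  qed
  moreover have "linear_on s' D s' (\<rho> g)" if g: "g \<in> carrier G" for g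
    unfolding linear_on_def
  proof (intro conjI ballI allI)
    fix x y assume "x \<in> D" "y \<in> D"
    then show "\<rho> g (x + y) = \<rho> g x + \<rho> g y"
      using g D.subspace_add[OF D]
      by (intro eqI) (simp_all add: \<rho> linear_on_add[OF \<Phi>(1)] \<Phi>V linear_on_add[OF V.linear_rep])
  next
    fix c x assume "x \<in> D"
    then show "\<rho> g (s' c x) = s' c (\<rho> g x)"
      using g D.subspace_scale[OF D]
      by (intro eqI) (simp_all add: \<rho> linear_on_scale[OF \<Phi>(1)] \<Phi>V linear_on_scale[OF V.linear_rep])
  qed
  ultimately show ?thesis
    using D s' by (simp add: group_representation_def group_representation_axioms_def)
qed

text \<open>Needed because \<^const>\<open>irreducible_characters\<close> only takes representations on this type into account.\<close>

lemma irreducible_subspace_model: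
  assumes rep: "group_representation G s V \<sigma>"
    and E: "finite E" "\<not> module.dependent s E" "module.span s E = U" and U: "U \<subseteq> V" "U \<noteq> {0}"
    and stable: "\<forall>g\<in>carrier G. \<forall>x\<in>U. \<sigma> g x \<in> U"
    and irr: "\<forall>X. module.subspace s X \<and> X \<subseteq> U \<and> (\<forall>g\<in>carrier G. \<forall>x\<in>X. \<sigma> g x \<in> X) \<longrightarrow> X = {0} \<or> X = U"
  obtains W :: "(nat \<Rightarrow> complex) set" and \<rho> \<theta> where
    "irreducible_representation G (fun_scale (*)) W \<rho>"
    "intertwines G (fun_scale (*)) W \<rho> s V \<sigma> \<theta>" "bij_betw \<theta> W U"
proof -
  interpret V: group_representation G s V \<sigma> by fact
  interpret F: vector_space "fun_scale (*) :: _ \<Rightarrow> (nat \<Rightarrow> complex) \<Rightarrow> _"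
    by (rule vector_space_fun_scale) (rule vector_space_times)
  obtain e where e: "bij_betw e {..<card E} E"
    using ex_bij_betw_nat_finite[OF E(1)] by (auto simp: atLeast0LessThan)
  define n where "n = card E"
  \<comment> \<open>A coordinate space of dimension n inside the sequences; the zeros from index n
    on make the coordinate map \<theta> injective.\<close>
  define W where "W = {c :: nat \<Rightarrow> complex. \<forall>i\<ge>n. c i = 0}"
  define \<theta> where "\<theta> c = (\<Sum>i<n. s (c i) (e i))" for c :: "nat \<Rightarrow> complex"
  have W: "F.subspace W" by (auto simp: F.subspace_def W_def fun_scale_def)
  have lin: "linear_on (fun_scale (*)) W s \<theta>"
    by (auto simp: linear_on_def \<theta>_def fun_scale_def V.scale_left_distrib sum.distrib V.scale_sum_right)
  have inj: "inj_on \<theta> W"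
  proof (rule inj_onI)
    fix c d assume cd: "c \<in> W" "d \<in> W" "\<theta> c = \<theta> d"
    let ?i = "inv_into {..<n} e"
    have "(\<Sum>x\<in>E. s (c (?i x) - d (?i x)) x) = (\<Sum>i<n. s (c i - d i) (e i))"
      using e unfolding n_def
      by (intro sum.reindex_bij_betw[OF e, symmetric, THEN trans] sum.cong)
        (auto simp: bij_betw_def)
    also have "\<dots> = 0"
      using cd(3) by (simp add: \<theta>_def V.scale_left_diff_distrib sum_subtractf)
    finally have "\<forall>x\<in>E. c (?i x) - d (?i x) = 0"
      using E(2)[unfolded V.independent_explicit_finite_subsets, rule_format, OF subset_refl E(1),
          where u = "\<lambda>x. c (?i x) - d (?i x)"] by blast
    then have *: "c (?i x) - d (?i x) = 0" if "x \<in> E" for x using that by blast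
    have "c i = d i" if "i < n" for i
      using *[of "e i"] e that by (auto simp: bij_betw_def n_def)
    then show "c = d" using cd(1,2) by (auto simp: W_def fun_eq_iff) (metis not_le)
  qed
  have img: "\<theta> ` W = U"
  proof
    have "e i \<in> U" if "i < n" for i using that e E(3) V.span_base by (auto simp: bij_betw_def n_def)
    then show "\<theta> ` W \<subseteq> U" using E(3) V.subspace_span[of E]
      by (auto simp: \<theta>_def intro!: V.subspace_sum V.subspace_scale)
    show "U \<subseteq> \<theta> ` W"
    proof
      fix x assume "x \<in> U"
      let ?c = "\<lambda>i. if i < n then V.representation E x (e i) else 0"
      have "x = (\<Sum>b\<in>E. s (V.representation E x b) b)"
        using V.sum_representation[OF E(1,2)] E(3) \<open>x \<in> U\<close> by simp
      also have "\<dots> = \<theta> ?c"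
        unfolding \<theta>_def n_def by (subst sum.reindex_bij_betw[OF e, symmetric]) simp
      finally show "x \<in> \<theta> ` W" by (auto simp: W_def)
    qed
  qed
  define \<rho> where "\<rho> g = (\<lambda>c\<in>W. inv_into W \<theta> (\<sigma> g (\<theta> c)))" for g
  have \<rho>: "\<rho> g c \<in> W" "\<theta> (\<rho> g c) = \<sigma> g (\<theta> c)" if "g \<in> carrier G" "c \<in> W" for g c
  proof -
    have "\<sigma> g (\<theta> c) \<in> \<theta> ` W" using that img stable by blast
    then show "\<rho> g c \<in> W" "\<theta> (\<rho> g c) = \<sigma> g (\<theta> c)"
      using that by (simp_all add: \<rho>_def inv_into_into f_inv_into_f)
  qed
  have rep': "group_representation G (fun_scale (*)) W \<rho>"
    by (rule group_representation_transport[OF rep F.vector_space_axioms W lin _ inj])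
      (use \<rho> img U in \<open>auto simp: \<rho>_def\<close>)
  have "irreducible_representation G (fun_scale (*)) W \<rho>"
    unfolding irreducible_representation_def
  proof (intro conjI allI impI)
    show "W \<noteq> {0}"
    proof
      assume "W = {0}"
      then have "U = {\<theta> 0}" using img by blast
      then show False using U(2) linear_on_zero[OF F.vector_space_axioms V.vector_space_W W lin] by simp
    qed
    fix X assume X: "F.subspace X \<and> X \<subseteq> W \<and> (\<forall>g\<in>carrier G. \<forall>x\<in>X. \<rho> g x \<in> X)"
    have "\<theta> ` X = {0} \<or> \<theta> ` X = U"
    proof (rule irr[rule_format], intro conjI ballI)
      show "V.subspace (\<theta> ` X)"
        using X by (intro subspace_image[OF F.vector_space_axioms V.vector_space_W _ linear_on_subset[OF lin]]) auto
      show "\<theta> ` X \<subseteq> U" using X img by blast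
      fix g x assume g: "g \<in> carrier G" and "x \<in> \<theta> ` X"
      then obtain c where "c \<in> X" "x = \<theta> c" by blast
      then show "\<sigma> g x \<in> \<theta> ` X" using X \<rho>(2)[OF g, of c] g by (metis image_eqI subsetD)
    qed
    then show "X = {0} \<or> X = W"
    proof
      assume *: "\<theta> ` X = {0}"
      have "c = 0" if "c \<in> X" for c
        using inj that X * linear_on_zero[OF F.vector_space_axioms V.vector_space_W W lin] F.subspace_0[OF W]
        by (intro inj_onD[OF inj]) auto
      then show ?thesis using X F.subspace_0 by blast
    next
      assume "\<theta> ` X = U"
      then show ?thesis using inj_on_image_eq_iff[OF inj, of X W] X img by blast
    qed
  qed (rule rep')
  moreover have "intertwines G (fun_scale (*)) W \<rho> s V \<sigma> \<theta>"
    using lin \<rho> img U by (auto simp: intertwines_def)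
  moreover have "bij_betw \<theta> W U" using inj img by (simp add: bij_betw_def)
  ultimately show thesis by (rule that)
qed

section \<open>Operators spanned by modes\<close>

text \<open>Only linear combinations are included; composites come in through
  \<open>mode_span_comp\<close>, on finite sets.\<close>

definition mode_span ::
  "(complex \<Rightarrow> 'm::ab_group_add \<Rightarrow> 'm) \<Rightarrow> 'v set \<Rightarrow> ('v \<Rightarrow> int \<Rightarrow> 'm \<Rightarrow> 'm) \<Rightarrow> ('m \<Rightarrow> 'm) set" where
  "mode_span s U Y = module.span (fun_scale s) {Y u n | u n. u \<in> U}"

lemma Sum_any_lessThan:
  fixes f :: "nat \<Rightarrow> 'b::comm_monoid_add"
  assumes "\<And>i. i \<ge> N \<Longrightarrow> f i = 0"
  shows "Sum_any f = (\<Sum>i<N. f i)"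
  by (rule Sum_any.expand_superset) (use assms in \<open>auto simp: not_less[symmetric]\<close>)

lemma eventually_zero_uniform:
  fixes f :: "'i \<Rightarrow> int \<Rightarrow> 'b::zero"
  assumes "finite I" "\<And>i. i \<in> I \<Longrightarrow> \<exists>N. \<forall>n\<ge>N. f i n = 0"
  obtains N where "\<And>i n. i \<in> I \<Longrightarrow> n \<ge> N \<Longrightarrow> f i n = 0"
proof -
  obtain M where M: "\<And>i n. i \<in> I \<Longrightarrow> n \<ge> M i \<Longrightarrow> f i n = 0" using assms(2) by metis
  show thesis
  proof (rule that)
    fix i n assume i: "i \<in> I" and n: "n \<ge> Max (insert 0 (M ` I))"
    have "M i \<le> Max (insert 0 (M ` I))" using assms(1) i by (intro Max_ge) auto
    then show "f i n = 0" using M[OF i] n by simp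
  qed
qed

context vertex_algebra
begin

lemma vector_space_V: "vector_space s"
  by unfold_locales

lemmas linear_on_zero_V = linear_on_zero[OF vector_space_V vector_space_V subspace_V]
  and linear_on_sum_V = linear_on_sum[OF vector_space_V vector_space_V subspace_V]
  and linear_on_diff_V = linear_on_diff[OF vector_space_V vector_space_V subspace_V]

lemma mode_zero: "u \<in> V \<Longrightarrow> Y u n 0 = 0" "v \<in> V \<Longrightarrow> Y 0 n v = 0"
  using linear_on_zero_V Y_linear_left Y_linear_right
  by blast+

interpretation F: vector_space "fun_scale s :: _ \<Rightarrow> ('v \<Rightarrow> 'v) \<Rightarrow> _"
  by (rule vector_space_fun_scale[OF vector_space_V])

lemma mode_span_zero: "(\<lambda>x. 0) \<in> mode_span s U Y"
  using F.span_zero unfolding mode_span_def zero_fun_def .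

lemma mode_span_mode: "u \<in> U \<Longrightarrow> Y u n \<in> mode_span s U Y"
  unfolding mode_span_def by (rule F.span_base) blast

lemma mode_span_add: "a \<in> mode_span s U Y \<Longrightarrow> b \<in> mode_span s U Y \<Longrightarrow> (\<lambda>x. a x + b x) \<in> mode_span s U Y"
  using F.span_add unfolding mode_span_def plus_fun_def .

lemma mode_span_scale: "a \<in> mode_span s U Y \<Longrightarrow> (\<lambda>x. s c (a x)) \<in> mode_span s U Y"
  using F.span_scale unfolding mode_span_def fun_scale_def .

lemma mode_span_sum:
  "(\<And>i. i \<in> I \<Longrightarrow> a i \<in> mode_span s U Y) \<Longrightarrow> (\<lambda>x. \<Sum>i\<in>I. a i x) \<in> mode_span s U Y"
  by (induction I rule: infinite_finite_induct) (auto intro: mode_span_zero mode_span_add)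

lemma mode_span_induct [consumes 1, case_names zero step]:
  assumes "a \<in> mode_span s U Y" "P (\<lambda>x. 0)"
    and step: "\<And>c u n b. u \<in> U \<Longrightarrow> b \<in> mode_span s U Y \<Longrightarrow> P b \<Longrightarrow> P (\<lambda>x. s c (Y u n x) + b x)"
  shows "P a"
proof -
  have "a \<in> mode_span s U Y \<and> P a"
    using assms(1) unfolding mode_span_def
  proof (induction rule: F.span_induct_alt)
    case base
    then show ?case using assms(2) F.span_zero by (simp add: zero_fun_def)
  next
    case (step c x b)
    then obtain u n where "x = Y u n" "u \<in> U" by blast
    have b: "b \<in> mode_span s U Y" "P b" using step(2) by (simp_all add: mode_span_def)
    have "fun_scale s c x + b = (\<lambda>x. s c (Y u n x) + b x)"
      using \<open>x = Y u n\<close> by (simp add: fun_eq_iff fun_scale_def)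
    moreover have "(\<lambda>x. s c (Y u n x) + b x) \<in> mode_span s U Y"
      using mode_span_add[OF mode_span_scale[OF mode_span_mode[OF \<open>u \<in> U\<close>]] b(1)] .
    ultimately show ?case
      using assms(3)[OF \<open>u \<in> U\<close> b] by (simp add: mode_span_def)
  qed
  then show ?thesis ..
qed

lemma mode_span_closed: "a \<in> mode_span s U Y \<Longrightarrow> U \<subseteq> V \<Longrightarrow> x \<in> V \<Longrightarrow> a x \<in> V"
  by (induction rule: mode_span_induct)
    (auto intro!: subspace_add[OF subspace_V] subspace_scale[OF subspace_V] subspace_0[OF subspace_V] Y_closed)

lemma mode_span_linear: "a \<in> mode_span s U Y \<Longrightarrow> U \<subseteq> V \<Longrightarrow> linear_on s V s a"
proof (induction rule: mode_span_induct)
  case (step c u n b)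
  then have "linear_on s V s (Y u n)" using Y_linear_right by blast
  with step show ?case
    by (auto simp: linear_on_def scale_right_distrib mult.commute add_ac)
qed (simp add: linear_on_def)

section \<open>Products of modes and relations between modes\<close>

lemma borcherds:
  assumes "u \<in> V" "v \<in> V" "w \<in> V"
  shows "Sum_any (\<lambda>i. s ((-1) ^ i * (of_int l gchoose i)) (Y u (m + l - int i) (Y v (n + int i) w)))
      - Sum_any (\<lambda>i. s ((-1) powi l * ((-1) ^ i * (of_int l gchoose i)))
              (Y v (n + l - int i) (Y u (m + int i) w)))
      = Sum_any (\<lambda>i. s (of_int m gchoose i) (Y (Y u (l + int i) v) (m + n - int i) w))"
  using Y_jacobi[OF assms] unfolding jacobi_identity_iff[OF vector_space_V] by (elim allE)

text \<open>
  On finitely many vectors \<open>w\<close> a product \<open>u\<^sub>p v\<^sub>q\<close> of two modes is a combination of modes: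
  for \<open>m\<close> large enough that \<open>u\<^sub>m\<^sub>+\<^sub>i w = 0\<close>, the Borcherds identity with \<open>l = p - m\<close> expresses it through
  modes and through products \<open>u\<^sub>p\<^sub>-\<^sub>i v\<^sub>q\<^sub>+\<^sub>i\<close> with \<open>i > 0\<close>, which vanish for large \<open>i\<close>.
\<close>

lemma mode_product:
  assumes uv: "u \<in> V" "v \<in> V" and F: "finite F" "F \<subseteq> V"
  shows "\<exists>d\<in>mode_span s V Y. \<forall>w\<in>F. d w = Y u p (Y v q w)"
proof -
  obtain Q where Q: "\<And>w n. w \<in> F \<Longrightarrow> n \<ge> Q \<Longrightarrow> Y v n w = 0"
    using eventually_zero_uniform[OF F(1), of "\<lambda>w n. Y v n w"] Y_truncation uv F(2) by blast
  obtain m where m: "\<And>w n. w \<in> F \<Longrightarrow> n \<ge> m \<Longrightarrow> Y u n w = 0"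
    using eventually_zero_uniform[OF F(1), of "\<lambda>w n. Y u n w"] Y_truncation uv F(2) by blast
  \<comment> \<open>Descent in \<open>q\<close>: for q \<ge> Q the product is 0 on \<open>F\<close>,
    and each step lowers the bound by one, uniformly in \<open>p\<close>.\<close>
  have "\<forall>p q. q \<ge> Q - int k \<longrightarrow> (\<exists>d\<in>mode_span s V Y. \<forall>w\<in>F. d w = Y u p (Y v q w))" for k
  proof (induction k)
    case 0
    show ?case
      using Q mode_zero uv by (auto intro!: bexI[OF _ mode_span_zero])
  next
    case (Suc k)
    show ?case
    proof (intro allI impI)
      fix p q assume q: "q \<ge> Q - int (Suc k)"
      define l where "l = p - m"
      obtain N0 where N0: "\<And>n. n \<ge> N0 \<Longrightarrow> Y u n v = 0" using Y_truncation uv by blast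
      \<comment> \<open>From this index on, \<open>q + i\<close> reaches the truncation bound of
        \<open>v\<close> on \<open>F\<close> and \<open>l + i\<close> that of \<open>u\<close> on
        \<open>v\<close>, so both remaining sums are finite. They run below \<open>Suc N\<close> so
        that the term i = 0, the wanted product, can be split off.\<close>
      define N where "N = nat (max (N0 - l) (Q - q))"
      have N: "q + int i \<ge> Q" "l + int i \<ge> N0" if "i \<ge> N" for i using that by (auto simp: N_def)
      define c where "c i = (-1) ^ i * (of_int l gchoose i :: complex)" for i :: nat
      have "\<exists>d\<in>mode_span s V Y. \<forall>w\<in>F. d w = Y u (p - int (Suc i)) (Y v (q + int (Suc i)) w)" for i
        using Suc.IH q by simp
      then obtain d where d: "\<And>i. d i \<in> mode_span s V Y"
        "\<And>i w. w \<in> F \<Longrightarrow> d i w = Y u (p - int (Suc i)) (Y v (q + int (Suc i)) w)" by metis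
      define r where "r w = (\<Sum>i<Suc N. s (of_int m gchoose i) (Y (Y u (l + int i) v) (m + q - int i) w))" for w
      define t where "t w = r w + s (-1) (\<Sum>i<N. s (c (Suc i)) (d i w))" for w
      have "r \<in> mode_span s V Y"
        unfolding r_def by (intro mode_span_sum mode_span_scale mode_span_mode Y_closed uv)
      then have "t \<in> mode_span s V Y"
        unfolding t_def by (intro mode_span_add mode_span_scale mode_span_sum d)
      moreover have "t w = Y u p (Y v q w)" if w: "w \<in> F" for w
      proof -
        have wV: "w \<in> V" using w F by blast
        have "Sum_any (\<lambda>i. s (c i) (Y u (m + l - int i) (Y v (q + int i) w)))
            = (\<Sum>i<Suc N. s (c i) (Y u (m + l - int i) (Y v (q + int i) w)))"
          using N Q[OF w] mode_zero uv by (intro Sum_any_lessThan) simp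
        also have "\<dots> = Y u p (Y v q w) + (\<Sum>i<N. s (c (Suc i)) (d i w))"
          unfolding sum.lessThan_Suc_shift by (simp add: c_def l_def d(2)[OF w])
        finally have 1: "Sum_any (\<lambda>i. s (c i) (Y u (m + l - int i) (Y v (q + int i) w)))
            = Y u p (Y v q w) + (\<Sum>i<N. s (c (Suc i)) (d i w))" .
        have 2: "Sum_any (\<lambda>i. s ((-1) powi l * c i) (Y v (q + l - int i) (Y u (m + int i) w))) = 0"
          using m[OF w] mode_zero uv by simp
        have 3: "Sum_any (\<lambda>i. s (of_int m gchoose i) (Y (Y u (l + int i) v) (m + q - int i) w)) = r w"
          unfolding r_def using N N0 mode_zero wV by (intro Sum_any_lessThan) simp
        from borcherds[OF uv wV, of l m q] have "Y u p (Y v q w) + (\<Sum>i<N. s (c (Suc i)) (d i w)) = r w"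
          using 1 2 3 by (simp add: c_def)
        then show ?thesis by (simp add: t_def algebra_simps)
      qed
      ultimately show "\<exists>d\<in>mode_span s V Y. \<forall>w\<in>F. d w = Y u p (Y v q w)" by blast
    qed
  qed
  from this[of "nat (Q - q)"] show ?thesis by simp
qed

lemma mode_span_comp:
  assumes a: "a \<in> mode_span s V Y" and b: "b \<in> mode_span s V Y" and F: "finite F" "F \<subseteq> V"
  shows "\<exists>d\<in>mode_span s V Y. \<forall>w\<in>F. d w = a (b w)"
proof -
  have 1: "\<exists>d\<in>mode_span s V Y. \<forall>w\<in>F. d w = Y u p (b w)" if u: "u \<in> V" for u p
    using b
  proof (induction rule: mode_span_induct)
    case zero
    then show ?case using mode_zero u by (auto intro!: bexI[OF _ mode_span_zero])
  next
    case (step c v n b)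
    obtain d1 where d1: "d1 \<in> mode_span s V Y" "\<forall>w\<in>F. d1 w = Y u p (Y v n w)"
      using mode_product[OF u step(1) F] by blast
    obtain d2 where d2: "d2 \<in> mode_span s V Y" "\<forall>w\<in>F. d2 w = Y u p (b w)" using step by blast
    have "s c (d1 w) + d2 w = Y u p (s c (Y v n w) + b w)" if "w \<in> F" for w
    proof -
      have "w \<in> V" using that F by blast
      then have "Y v n w \<in> V" "b w \<in> V" "s c (Y v n w) \<in> V"
        using step Y_closed mode_span_closed subspace_scale[OF subspace_V] by auto
      then show ?thesis
        using that d1 d2 linear_on_add[OF Y_linear_right[OF u]] linear_on_scale[OF Y_linear_right[OF u]] by simp
    qed
    then show ?case
      by (intro bexI[OF _ mode_span_add[OF mode_span_scale[OF d1(1)] d2(1)], of _ c]) blast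
  qed
  show ?thesis
    using a
  proof (induction rule: mode_span_induct)
    case zero
    then show ?case by (auto intro!: bexI[OF _ mode_span_zero])
  next
    case (step c u n a)
    obtain d1 where d1: "d1 \<in> mode_span s V Y" "\<forall>w\<in>F. d1 w = Y u n (b w)" using 1[OF step(1)] by blast
    obtain d2 where d2: "d2 \<in> mode_span s V Y" "\<forall>w\<in>F. d2 w = a (b w)" using step by blast
    show ?case
      by (intro bexI[OF _ mode_span_add[OF mode_span_scale[OF d1(1)] d2(1)], of _ c]) (use d1 d2 in simp)
  qed
qed

text \<open>
  With \<open>l\<close> large, the Borcherds identity becomes weak commutativity of \<open>u\<close> with all \<open>a\<^sub>i\<close>, which
  allows to descend from the large \<open>q\<close> for which \<open>u\<^sub>q b\<^sub>i = 0\<close>.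
\<close>

lemma mode_sum_zero:
  assumes I: "finite I" and ab: "\<And>i. i \<in> I \<Longrightarrow> a i \<in> V" "\<And>i. i \<in> I \<Longrightarrow> b i \<in> V"
    and zero: "\<And>n. (\<Sum>i\<in>I. Y (a i) n (b i)) = 0" and u: "u \<in> V"
  shows "(\<Sum>i\<in>I. Y (a i) p (Y u q (b i))) = 0"
proof -
  obtain Q where Q: "\<And>i n. i \<in> I \<Longrightarrow> n \<ge> Q \<Longrightarrow> Y u n (b i) = 0"
    using eventually_zero_uniform[OF I, of "\<lambda>i n. Y u n (b i)"] Y_truncation u ab by blast
  obtain N0 where N0: "\<And>i n. i \<in> I \<Longrightarrow> n \<ge> N0 \<Longrightarrow> Y u n (a i) = 0"
    using eventually_zero_uniform[OF I, of "\<lambda>i n. Y u n (a i)"] Y_truncation u ab by blast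
  \<comment> \<open>With exponent N \<ge> N0 the right side of the Borcherds identity vanishes for
    every \<open>a i\<close>; as N is a natural number, the binomial coefficients also vanish beyond
    N.\<close>
  define N where "N = nat N0"
  define c where "c j = (-1) ^ j * (of_int (int N) gchoose j :: complex)" for j :: nat
  have c0: "c j = 0" if "j \<ge> Suc N" for j
    using that by (simp add: c_def binomial_gbinomial[symmetric] binomial_eq_0)
  have "\<forall>p q. q \<ge> Q - int k \<longrightarrow> (\<Sum>i\<in>I. Y (a i) p (Y u q (b i))) = 0" for k
  proof (induction k)
    case 0
    show ?case using Q mode_zero ab by simp
  next
    case (Suc k)
    show ?case
    proof (intro allI impI)
      fix p q assume q: "q \<ge> Q - int (Suc k)"
      define e :: complex where "e = (-1) powi (int N)"
      have *: "(\<Sum>j<Suc N. s (c j) (Y u (q + int N - int j) (Y (a i) (p - int N + int j) (b i))))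
          = (\<Sum>j<Suc N. s (e * c j) (Y (a i) (p - int j) (Y u (q + int j) (b i))))" if i: "i \<in> I" for i
      proof -
        have "Sum_any (\<lambda>j. s (of_int q gchoose j) (Y (Y u (int N + int j) (a i)) (q + (p - int N) - int j) (b i))) = 0"
          using N0[OF i] mode_zero ab(2)[OF i] by (simp add: N_def)
        moreover have "Sum_any (\<lambda>j. s (c j) (Y u (q + int N - int j) (Y (a i) (p - int N + int j) (b i))))
          = (\<Sum>j<Suc N. s (c j) (Y u (q + int N - int j) (Y (a i) (p - int N + int j) (b i))))"
          using c0 by (intro Sum_any_lessThan) simp
        moreover have "Sum_any (\<lambda>j. s (e * c j) (Y (a i) (p - int N + int N - int j) (Y u (q + int j) (b i))))
          = (\<Sum>j<Suc N. s (e * c j) (Y (a i) (p - int N + int N - int j) (Y u (q + int j) (b i))))"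
          using c0 by (intro Sum_any_lessThan) simp
        ultimately show ?thesis
          using borcherds[OF u ab(1,2)[OF i], of "int N" q "p - int N"] unfolding c_def e_def by simp
      qed
      have "(\<Sum>i\<in>I. \<Sum>j<Suc N. s (c j) (Y u (q + int N - int j) (Y (a i) (p - int N + int j) (b i))))
          = (\<Sum>j<Suc N. s (c j) (Y u (q + int N - int j) (\<Sum>i\<in>I. Y (a i) (p - int N + int j) (b i))))"
        by (subst sum.swap)
          (simp add: scale_sum_right linear_on_sum_V[OF Y_linear_right[OF u]] Y_closed ab)
      also have "\<dots> = 0" by (simp add: zero mode_zero u)
      finally have "0 = (\<Sum>i\<in>I. \<Sum>j<Suc N. s (e * c j) (Y (a i) (p - int j) (Y u (q + int j) (b i))))"
        using * by simp
      also have "\<dots> = (\<Sum>j<Suc N. s (e * c j) (\<Sum>i\<in>I. Y (a i) (p - int j) (Y u (q + int j) (b i))))"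
        by (subst sum.swap) (simp add: scale_sum_right)
      \<comment> \<open>The terms with j > 0 have larger \<open>q\<close> and vanish by induction;
        what remains carries the coefficient \<open>c 0 = 1\<close> and the nonzero sign
        \<open>e\<close>.\<close>
      also have "\<dots> = s e (\<Sum>i\<in>I. Y (a i) p (Y u q (b i)))"
        unfolding sum.lessThan_Suc_shift using Suc.IH q by (simp add: c_def)
      finally show "(\<Sum>i\<in>I. Y (a i) p (Y u q (b i))) = 0" by (simp add: e_def)
    qed
  qed
  from this[of "nat (Q - q)"] show ?thesis by simp
qed

text \<open>The form needed for the Dedekind argument: any operator supplied by density may be
  inserted in front of the \<open>b i\<close>.\<close>

lemma mode_span_sum_zero:
  assumes I: "finite I" and ab: "\<And>i. i \<in> I \<Longrightarrow> a i \<in> V" "\<And>i. i \<in> I \<Longrightarrow> b i \<in> V"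
    and zero: "\<And>n. (\<Sum>i\<in>I. Y (a i) n (b i)) = 0" and d: "d \<in> mode_span s V Y"
  shows "(\<Sum>i\<in>I. Y (a i) p (d (b i))) = 0"
  using d
proof (induction rule: mode_span_induct)
  case zero
  then show ?case by (simp add: mode_zero ab)
next
  case (step c u n d)
  have "Y (a i) p (s c (Y u n (b i)) + d (b i)) = s c (Y (a i) p (Y u n (b i))) + Y (a i) p (d (b i))"
    if i: "i \<in> I" for i
    using linear_on_add[OF Y_linear_right[OF ab(1)[OF i]]] linear_on_scale[OF Y_linear_right[OF ab(1)[OF i]]]
      step ab(2)[OF i] by (simp add: Y_closed mode_span_closed subspace_scale[OF subspace_V])
  then show ?case
    using step mode_sum_zero[OF I ab zero step(1)]
    by (simp add: sum.distrib flip: scale_sum_right)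
qed

end

section \<open>Simple vertex algebras of countable dimension\<close>

locale countable_simple_vertex_algebra = vertex_algebra s V vac Y
  for s :: "complex \<Rightarrow> 'v::ab_group_add \<Rightarrow> 'v" and V vac Y +
  assumes simple: "simple_vertex_algebra s V vac Y"
    and countable_dim: "countable_dimension s V"
begin

text \<open>A subspace stable under combinations of modes is a submodule, so simplicity of
  \<open>V\<close> is irreducibility of this family.\<close>

sublocale modes: dense_operators s V "mode_span s V Y"
proof
  show "V \<noteq> {0}"
    using simple by (simp add: simple_vertex_algebra_def irreducible_vertex_module_def)
  show "\<exists>B. countable B \<and> V \<subseteq> span B"
    using countable_dim by (auto simp: countable_dimension_def)
  show "\<exists>e\<in>mode_span s V Y. \<forall>x\<in>V. e x = x"
    by (rule bexI[OF _ mode_span_mode[OF vac_closed, of "-1"]]) (simp add: Y_vacuum)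
  fix N assume N: "subspace N" "N \<subseteq> V" "\<And>a x. a \<in> mode_span s V Y \<Longrightarrow> x \<in> N \<Longrightarrow> a x \<in> N"
  then have "vertex_submodule V s V Y N"
    by (auto simp: vertex_submodule_def mode_span_mode)
  then show "N = {0} \<or> N = V"
    using simple by (auto simp: simple_vertex_algebra_def irreducible_vertex_module_def)
qed (simp_all add: subspace_V mode_span_closed mode_span_linear mode_span_zero mode_span_add
    mode_span_scale mode_span_comp)

lemma vac_nonzero: "vac \<noteq> 0"
proof
  assume "vac = 0"
  then have "v = 0" if "v \<in> V" for v
    using Y_vacuum[OF that, of "-1"] mode_zero(2)[OF that, of "-1"] by simp
  then show False using modes.M_nonzero subspace_0[OF subspace_V] by blast
qed

lemma automorphismD:
  assumes "g \<in> vertex_automorphisms s V vac Y"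
  shows "g \<in> extensional V" "linear_on s V s g" "v \<in> V \<Longrightarrow> g v \<in> V" "g vac = vac"
    and "u \<in> V \<Longrightarrow> v \<in> V \<Longrightarrow> g (Y u n v) = Y (g u) n (g v)"
proof -
  have g: "g \<in> Bij V" using assms by (simp add: vertex_automorphisms_def)
  then show "g \<in> extensional V" and gV: "\<And>v. v \<in> V \<Longrightarrow> g v \<in> V"
    using Bij_imp_extensional Bij_imp_funcset by blast+
  show "linear_on s V s g" "g vac = vac"
    using assms by (simp_all add: vertex_automorphisms_def)
  assume "u \<in> V" "v \<in> V"
  moreover from this have "inv_into V g (g v) = v" using g by (simp add: Bij_def bij_betw_def)
  ultimately show "g (Y u n v) = Y (g u) n (g v)"
    using assms gV by (simp add: vertex_automorphisms_def) metis
qed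

text \<open>
  As in Dedekind's lemma, a relation gives \<open>\<Sum>\<^sub>g c\<^sub>g (g u)\<^sub>n (g w) = 0\<close> for all \<open>u\<close>, \<open>w\<close>; density then allows
  to replace \<open>g w\<close> by \<open>\<phi>(g w) vac\<close> for any linear functional \<open>\<phi>\<close>, which yields a shorter relation.
\<close>

lemma automorphisms_independent:
  assumes "finite S" "S \<subseteq> vertex_automorphisms s V vac Y"
    and "\<And>v. v \<in> V \<Longrightarrow> (\<Sum>g\<in>S. s (c g) (g v)) = 0" and "g \<in> S"
  shows "c g = 0"
  using assms
proof (induction S arbitrary: c g rule: finite_induct)
  case (insert h S)
  have aut: "k \<in> vertex_automorphisms s V vac Y" if "k \<in> insert h S" for k
    using insert.prems(1) that by blast
  have rel: "(\<Sum>k\<in>insert h S. s (c k) (k v)) = 0" if "v \<in> V" for v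
    by (rule insert.prems(2)[OF that])
  have S0: "c k = 0" if k: "k \<in> S" for k
  proof -
    \<comment> \<open>Automorphisms are extensional, so distinct ones already differ at a vector of
      \<open>V\<close>.\<close>
    have "k \<noteq> h" using k insert.hyps by blast
    then obtain w where w: "w \<in> V" "k w \<noteq> h w"
      using extensionalityI[of k V h] automorphismD(1) aut k by blast
    obtain \<phi> where \<phi>: "Vector_Spaces.linear s (*) \<phi>" "\<phi> (k w - h w) = 1"
      using exists_functional[of "k w - h w"] w(2) by auto
    interpret \<phi>: Vector_Spaces.linear s "(*)" \<phi> by fact
    let ?E = "(\<lambda>k. k w) ` insert h S"
    have "\<exists>d\<in>mode_span s V Y. \<forall>x\<in>span ?E. d x = s (\<phi> x) vac"
    proof (rule modes.density)
      show "?E \<subseteq> V" using automorphismD(3)[OF aut] w(1) by blast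
    qed (use insert.hyps in \<open>auto simp: linear_on_def \<phi>.add \<phi>.scale scale_left_distrib
        intro: subspace_scale[OF subspace_V vac_closed]\<close>)
    then obtain d where d: "d \<in> mode_span s V Y" "\<And>x. x \<in> ?E \<Longrightarrow> d x = s (\<phi> x) vac"
      using span_base by metis
    have new: "(\<Sum>k\<in>insert h S. s (c k * \<phi> (k w)) (k u)) = 0" if u: "u \<in> V" for u
    proof -
      have closed: "s (c k) (k u) \<in> V" "k w \<in> V" "k u \<in> V" if "k \<in> insert h S" for k
        using automorphismD(3)[OF aut[OF that]] u w(1) subspace_scale[OF subspace_V] by blast+
      have "(\<Sum>k\<in>insert h S. Y (s (c k) (k u)) n (k w)) = 0" for n
      proof -
        have "Y (s (c k) (k u)) n (k w) = s (c k) (k (Y u n w))" if "k \<in> insert h S" for k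
          using linear_on_scale[OF Y_linear_left[OF closed(2)[OF that]]] closed(3)[OF that]
            automorphismD(5)[OF aut[OF that] u w(1)] by simp
        then have "(\<Sum>k\<in>insert h S. Y (s (c k) (k u)) n (k w)) = (\<Sum>k\<in>insert h S. s (c k) (k (Y u n w)))"
          by (rule sum.cong[OF refl])
        then show ?thesis using rel[OF Y_closed[OF u w(1)]] by simp
      qed
      \<comment> \<open>Mode -1 is chosen because x_(-1) vac = x recovers the vector.\<close>
      then have "(\<Sum>k\<in>insert h S. Y (s (c k) (k u)) (-1) (d (k w))) = 0"
        by (intro mode_span_sum_zero[OF _ closed(1,2) _ d(1)]) (use insert.hyps in auto)
      moreover have "Y (s (c k) (k u)) (-1) (d (k w)) = s (c k * \<phi> (k w)) (k u)" if "k \<in> insert h S" for k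
      proof -
        have "Y (s (c k) (k u)) (-1) (d (k w)) = s (\<phi> (k w)) (Y (s (c k) (k u)) (-1) vac)"
          using d(2)[of "k w"] that linear_on_scale[OF Y_linear_right[OF closed(1)[OF that]] vac_closed] by auto
        then show ?thesis using Y_creation_const[OF closed(1)[OF that]] by (simp add: mult.commute)
      qed
      ultimately show ?thesis by simp
    qed
    \<comment> \<open>Subtracting \<phi>(h w) times the original relation cancels the term of
      \<open>h\<close>, while the coefficient of the chosen \<open>k\<close> keeps the factor
      \<phi>(k w - h w) = 1.\<close>
    have "(\<Sum>k\<in>S. s (c k * (\<phi> (k w) - \<phi> (h w))) (k u)) = 0" if u: "u \<in> V" for u
    proof -
      have "(\<Sum>k\<in>S. s (c k * (\<phi> (k w) - \<phi> (h w))) (k u))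
        = (\<Sum>k\<in>insert h S. s (c k * (\<phi> (k w) - \<phi> (h w))) (k u))"
        using insert.hyps by simp
      also have "\<dots> = (\<Sum>k\<in>insert h S. s (c k * \<phi> (k w)) (k u)) - s (\<phi> (h w)) (\<Sum>k\<in>insert h S. s (c k) (k u))"
        unfolding scale_sum_right sum_subtractf[symmetric]
        by (intro sum.cong) (auto simp: right_diff_distrib scale_left_diff_distrib mult.commute)
      finally show ?thesis using new[OF u] rel[OF u] by simp
    qed
    from insert.IH[OF _ this k] insert.prems(1) have "c k * (\<phi> (k w) - \<phi> (h w)) = 0" by blast
    moreover have "\<phi> (k w) - \<phi> (h w) = 1" using \<phi>(2) by (simp add: \<phi>.diff)
    ultimately show ?thesis by simp
  qed
  \<comment> \<open>The one remaining term is tested on the vacuum, which \<open>h\<close> fixes and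
    which is nonzero.\<close>
  have "s (c h) (h vac) = 0" using rel[OF vac_closed] insert.hyps S0 by simp
  then have "c h = 0" using automorphismD(4)[OF aut[of h]] vac_nonzero by simp
  with S0 insert.prems(3) show ?case by blast
qed simp

end

section \<open>Finite automorphism groups\<close>

locale finite_group_on_vertex_algebra = countable_simple_vertex_algebra s V vac Y
  for s :: "complex \<Rightarrow> 'v::ab_group_add \<Rightarrow> 'v" and V vac Y +
  fixes G :: "('v \<Rightarrow> 'v) set"
  assumes finite_automorphism_group: "finite_automorphism_group s V vac Y G"
begin

abbreviation "GG \<equiv> (BijGroup V)\<lparr>carrier := G\<rparr>"
abbreviation "VG \<equiv> fixed_points V G"
abbreviation "ginv g \<equiv> inv\<^bsub>GG\<^esub> g"

lemma finite_G: "finite G"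
  and G_automorphism: "g \<in> G \<Longrightarrow> g \<in> vertex_automorphisms s V vac Y"
  using finite_automorphism_group by (auto simp: finite_automorphism_group_def)

sublocale V: group_representation GG s V "\<lambda>g. g"
proof -
  have sub: "subgroup G (BijGroup V)"
    using finite_automorphism_group by (simp add: finite_automorphism_group_def)
  have grp: "group GG" by (rule group.subgroup_imp_group[OF group_BijGroup sub])
  have "(\<lambda>g. g) \<in> hom GG (BijGroup V)"
    using subgroup.subset[OF sub] by (auto simp: hom_def)
  then have "group_action GG V (\<lambda>g. g)"
    by (intro group_action.intro group_hom.intro[OF grp group_BijGroup] group_hom_axioms.intro)
  then show "group_representation GG s V (\<lambda>g. g)"
    using automorphismD(2)[OF G_automorphism] subspace_V vector_space_V
    by (simp add: group_representation_def group_representation_axioms_def)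
qed

lemma VG_subset: "VG \<subseteq> V"
  by (auto simp: fixed_points_def)

lemma inv_GG:
  assumes "g \<in> G"
  shows "ginv g \<in> G" "x \<in> V \<Longrightarrow> g (ginv g x) = x"
proof -
  interpret group GG by (rule V.group_G)
  show i: "ginv g \<in> G" using inv_closed[of g] assms by simp
  show "x \<in> V \<Longrightarrow> g (ginv g x) = x"
    using V.rep_inv[of "ginv g" x] i inv_inv[of g] assms by simp
qed

lemma sum_orbit_fixed:
  assumes u: "u \<in> V"
  shows "(\<Sum>g\<in>G. g u) \<in> VG"
proof -
  interpret group GG by (rule V.group_G)
  have "h (\<Sum>g\<in>G. g u) = (\<Sum>g\<in>G. g u)" if h: "h \<in> G" for h
  proof -
    note i = inv_GG(1)[OF h]
    have cancel: "ginv h \<otimes>\<^bsub>GG\<^esub> (h \<otimes>\<^bsub>GG\<^esub> g) = g" "h \<otimes>\<^bsub>GG\<^esub> (ginv h \<otimes>\<^bsub>GG\<^esub> g) = g" if "g \<in> G" for g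
      using that h i m_assoc[of h "ginv h" g] m_assoc[of "ginv h" h g] l_inv[of h] r_inv[of h] l_one[of g]
      by simp_all
    have "h (\<Sum>g\<in>G. g u) = (\<Sum>g\<in>G. h (g u))"
      using V.rep_closed u
      by (intro linear_on_sum_V[OF automorphismD(2)[OF G_automorphism[OF h]]]) auto
    also have "\<dots> = (\<Sum>g\<in>G. (h \<otimes>\<^bsub>GG\<^esub> g) u)"
      using V.composition_rule[OF u] h by (intro sum.cong) auto
    also have "\<dots> = (\<Sum>g\<in>G. g u)"
      by (rule sum.reindex_bij_witness[where i = "\<lambda>g. ginv h \<otimes>\<^bsub>GG\<^esub> g" and j = "\<lambda>g. h \<otimes>\<^bsub>GG\<^esub> g"])
        (use h i m_closed cancel in auto)
    finally show ?thesis .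
  qed
  moreover have "(\<Sum>g\<in>G. g u) \<in> V"
    using V.rep_closed u by (intro subspace_sum[OF subspace_V]) auto
  ultimately show ?thesis by (simp add: fixed_points_def)
qed

text \<open>Conjugating the mode u_n by g gives the mode (g u)_n. Averaging therefore turns u_n into
  the mode of the orbit sum \<Sum>g. g u, which is a fixed vector.\<close>

lemma mode_span_average:
  assumes "d \<in> mode_span s V Y"
  shows "\<exists>b\<in>mode_span s VG Y. \<forall>x\<in>V. b x = (\<Sum>g\<in>G. g (d (ginv g x)))"
  using assms
proof (induction rule: mode_span_induct)
  case zero
  have "(\<Sum>g\<in>G. g 0) = 0" using V.rep_zero by (intro sum.neutral) auto
  then show ?case by (auto intro!: bexI[OF _ mode_span_zero])
next
  case (step c u n d)
  then obtain b where b: "b \<in> mode_span s VG Y" "\<forall>x\<in>V. b x = (\<Sum>g\<in>G. g (d (ginv g x)))" by blast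
  let ?u = "\<Sum>g\<in>G. g u"
  have "s c (Y ?u n x) + b x = (\<Sum>g\<in>G. g (s c (Y u n (ginv g x)) + d (ginv g x)))"
    if x: "x \<in> V" for x
  proof -
    have summand: "g (s c (Y u n (ginv g x)) + d (ginv g x)) = s c (Y (g u) n x) + g (d (ginv g x))"
      if g: "g \<in> G" for g
    proof -
      have x': "ginv g x \<in> V" using V.rep_closed inv_GG(1)[OF g] x by simp
      have Yx: "Y u n (ginv g x) \<in> V" "d (ginv g x) \<in> V"
        using Y_closed[OF step(1) x'] mode_span_closed[OF step(2) _ x'] by auto
      note lin = automorphismD(2)[OF G_automorphism[OF g]]
      show ?thesis
        using linear_on_add[OF lin subspace_scale[OF subspace_V Yx(1)] Yx(2)] linear_on_scale[OF lin Yx(1)]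
          automorphismD(5)[OF G_automorphism[OF g] step(1) x'] inv_GG(2)[OF g x] by simp
    qed
    have "Y ?u n x = (\<Sum>g\<in>G. Y (g u) n x)"
      using V.rep_closed step(1)
      by (intro linear_on_sum_V[OF Y_linear_left[OF x]]) auto
    moreover have "(\<Sum>g\<in>G. g (s c (Y u n (ginv g x)) + d (ginv g x)))
        = (\<Sum>g\<in>G. s c (Y (g u) n x) + g (d (ginv g x)))"
      by (rule sum.cong[OF refl summand])
    ultimately show ?thesis using b(2) x by (simp only: sum.distrib scale_sum_right)
  qed
  then show ?case
    using b sum_orbit_fixed[OF step(1)]
    by (intro bexI[OF _ mode_span_add[OF mode_span_scale[OF mode_span_mode] b(1)], of _ c _ n]) auto
qed

text \<open>Average an operator provided by the density theorem for \<open>V\<close>.\<close>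

theorem equivariant_density:
  assumes E: "finite E" "E \<subseteq> V" and stable: "\<And>g x. g \<in> G \<Longrightarrow> x \<in> span E \<Longrightarrow> g x \<in> span E"
    and T: "linear_on s (span E) s T" "\<And>x. x \<in> span E \<Longrightarrow> T x \<in> V"
      "\<And>g x. g \<in> G \<Longrightarrow> x \<in> span E \<Longrightarrow> T (g x) = g (T x)"
  shows "\<exists>b\<in>mode_span s VG Y. \<forall>x\<in>span E. b x = T x"
proof -
  interpret group GG by (rule V.group_G)
  obtain d where d: "d \<in> mode_span s V Y" "\<forall>x\<in>span E. d x = T x"
    using modes.density[OF E T(1)] T(2) span_base by blast
  obtain b where b: "b \<in> mode_span s VG Y" "\<forall>x\<in>V. b x = (\<Sum>g\<in>G. g (d (ginv g x)))"
    using mode_span_average[OF d(1)] by blast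
  let ?n = "of_nat (card G) :: complex"
  have n: "?n \<noteq> 0" using finite_G one_closed by (auto simp: card_eq_0_iff)
  have "s (1 / ?n) (b x) = T x" if x: "x \<in> span E" for x
  proof -
    have xV: "x \<in> V" using span_minimal[OF E(2) subspace_V] x by blast
    have "g (d (ginv g x)) = T x" if g: "g \<in> G" for g
    proof -
      have "ginv g x \<in> span E" by (rule stable[OF inv_GG(1)[OF g] x])
      then show ?thesis using d(2) T(3)[OF g, of "ginv g x"] inv_GG(2)[OF g xV] by simp
    qed
    then have "(\<Sum>g\<in>G. g (d (ginv g x))) = (\<Sum>g\<in>G. T x)" by (rule sum.cong[OF refl])
    then have "b x = s ?n (T x)" using b(2) xV by (simp add: sum_constant_scale)
    then show ?thesis using n by simp
  qed
  then show ?thesis by (intro bexI[OF _ mode_span_scale[OF b(1)]]) blast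
qed

end

section \<open>Transport of module structures\<close>

text \<open>Injectivity gives \<open>f\<close> and its image the same support, so both sides agree
  even when the support is infinite and \<open>Sum_any\<close> takes its default value 0.\<close>

lemma Sum_any_linear_on:
  assumes vs: "vector_space sM" "vector_space sN" and M: "module.subspace sM M"
    and \<Phi>: "linear_on sM M sN \<Phi>" "inj_on \<Phi> M" and f: "\<And>i. f i \<in> M"
  shows "Sum_any f \<in> M" "\<Phi> (Sum_any f) = Sum_any (\<lambda>i. \<Phi> (f i))"
proof -
  interpret M: vector_space sM by fact
  have \<Phi>0: "\<Phi> 0 = 0" by (rule linear_on_zero[OF vs M \<Phi>(1)])
  have "\<Phi> (f i) = 0 \<longleftrightarrow> f i = 0" for i
    using \<Phi>(2) f[of i] M.subspace_0[OF M] \<Phi>0 by (metis inj_onD)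
  then show "\<Phi> (Sum_any f) = Sum_any (\<lambda>i. \<Phi> (f i))"
    unfolding Sum_any.expand_set using linear_on_sum[OF vs M \<Phi>(1), of _ f] f by simp
  show "Sum_any f \<in> M"
    unfolding Sum_any.expand_set using f by (intro M.subspace_sum[OF M])
qed

text \<open>The module axioms are closure properties and equations, and equations can be checked
  after the injective map \<Phi>; the Jacobi identity is taken in its coefficient form. Uses:
  evaluation at a vector for the multiplicity spaces, inclusion for submodules, and the
  decomposition map for the direct sum.\<close>

lemma vertex_module_transport:
  assumes N: "vertex_module s V vac Y sN N YN" and vs: "vector_space sM" and M: "module.subspace sM M"
    and \<Phi>: "linear_on sM M sN \<Phi>" "\<Phi> \<in> M \<rightarrow> N" "inj_on \<Phi> M"
    and YM: "\<And>v n w. v \<in> V \<Longrightarrow> w \<in> M \<Longrightarrow> YM v n w \<in> M"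
      "\<And>v n w. v \<in> V \<Longrightarrow> w \<in> M \<Longrightarrow> \<Phi> (YM v n w) = YN v n (\<Phi> w)"
  shows "vertex_module s V vac Y sM M YM"
proof -
  interpret N: vertex_module s V vac Y sN N YN by fact
  interpret M: vector_space sM by fact
  have vsN: "vector_space sN" by unfold_locales
  have \<Phi>N: "\<Phi> w \<in> N" if "w \<in> M" for w using \<Phi>(2) that by blast
  have eqI: "x = y" if "x \<in> M" "y \<in> M" "\<Phi> x = \<Phi> y" for x y
    using inj_onD[OF \<Phi>(3)] that by blast
  have \<Phi>0: "\<Phi> 0 = 0" by (rule linear_on_zero[OF vs vsN M \<Phi>(1)])
  note sc = M.subspace_scale[OF M] and ad = M.subspace_add[OF M]
  note \<Phi>add = linear_on_add[OF \<Phi>(1)] and \<Phi>sc = linear_on_scale[OF \<Phi>(1)]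
  note N.V.subspace_add[OF N.V.subspace_V, simp] N.V.subspace_scale[OF N.V.subspace_V, simp]
  show ?thesis
  proof (unfold_locales, goal_cases)
    case 1
    show ?case by (rule M)
  next
    case (2 v w n)
    then show ?case by (rule YM(1))
  next
    case (3 w n)
    have "YM (u + v) n w = YM u n w + YM v n w" if "u \<in> V" "v \<in> V" for u v
      using 3 that linear_on_add[OF N.YM_linear_left[OF \<Phi>N[OF 3]]]
      by (intro eqI) (simp_all add: YM ad \<Phi>add)
    moreover have "YM (s c u) n w = sM c (YM u n w)" if "u \<in> V" for u c
      using 3 that linear_on_scale[OF N.YM_linear_left[OF \<Phi>N[OF 3]]]
      by (intro eqI) (simp_all add: YM sc \<Phi>sc)
    ultimately show ?case by (simp add: linear_on_def)
  next
    case (4 v n)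
    have "YM v n (x + y) = YM v n x + YM v n y" if "x \<in> M" "y \<in> M" for x y
      using 4 that linear_on_add[OF N.YM_linear_right[OF 4]]
      by (intro eqI) (simp_all add: YM ad \<Phi>add \<Phi>N)
    moreover have "YM v n (sM c x) = sM c (YM v n x)" if "x \<in> M" for x c
      using 4 that linear_on_scale[OF N.YM_linear_right[OF 4]]
      by (intro eqI) (simp_all add: YM sc \<Phi>sc \<Phi>N)
    ultimately show ?case by (simp add: linear_on_def)
  next
    case (5 v w)
    then obtain K where "\<forall>n\<ge>K. YN v n (\<Phi> w) = 0" using N.YM_truncation \<Phi>N by blast
    then have "\<forall>n\<ge>K. YM v n w = 0"
      using 5 M.subspace_0[OF M] by (auto intro!: eqI simp: YM \<Phi>0)
    then show ?case by blast
  next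
    case (6 w n)
    then show ?case
      using N.YM_vacuum[OF \<Phi>N] N.V.vac_closed M.subspace_0[OF M]
      by (intro eqI) (auto simp: YM \<Phi>0)
  next
    case (7 u v w)
    note uv = 7(1,2) and w = 7(3)
    have uv': "Y u n v \<in> V" for n using N.V.Y_closed uv by blast
    show ?case
      unfolding jacobi_identity_iff[OF vs]
    proof (intro allI)
      fix l m n
      let ?A = "\<lambda>i. sM ((-1) ^ i * (of_int l gchoose i)) (YM u (m + l - int i) (YM v (n + int i) w))"
      let ?B = "\<lambda>i. sM ((-1) powi l * ((-1) ^ i * (of_int l gchoose i))) (YM v (n + l - int i) (YM u (m + int i) w))"
      let ?C = "\<lambda>i. sM (of_int m gchoose i) (YM (Y u (l + int i) v) (m + n - int i) w)"
      have in_M: "?A i \<in> M" "?B i \<in> M" "?C i \<in> M" for i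
        by (simp_all add: sc YM uv uv' w)
      note S = Sum_any_linear_on[OF vs vsN M \<Phi>(1,3)]
      have "\<Phi> (Sum_any ?A - Sum_any ?B) = \<Phi> (Sum_any ?A) - \<Phi> (Sum_any ?B)"
        by (rule linear_on_diff[OF vs vsN M \<Phi>(1) S(1)[OF in_M(1)] S(1)[OF in_M(2)]])
      also have "\<dots> = Sum_any (\<lambda>i. sN ((-1) ^ i * (of_int l gchoose i)) (YN u (m + l - int i) (YN v (n + int i) (\<Phi> w))))
          - Sum_any (\<lambda>i. sN ((-1) powi l * ((-1) ^ i * (of_int l gchoose i))) (YN v (n + l - int i) (YN u (m + int i) (\<Phi> w))))"
        unfolding S(2)[OF in_M(1)] S(2)[OF in_M(2)] by (simp add: \<Phi>sc YM uv w)
      also have "\<dots> = Sum_any (\<lambda>i. sN (of_int m gchoose i) (YN (Y u (l + int i) v) (m + n - int i) (\<Phi> w)))"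
        using N.YM_jacobi[OF uv \<Phi>N[OF w]] unfolding jacobi_identity_iff[OF vsN] by (elim allE)
      also have "\<dots> = \<Phi> (Sum_any ?C)"
        unfolding S(2)[OF in_M(3)] by (simp add: \<Phi>sc YM uv' w)
      finally show "Sum_any ?A - Sum_any ?B = Sum_any ?C"
        by (intro eqI M.subspace_diff[OF M] S(1) in_M)
    qed
  qed
qed

section \<open>Multiplicity spaces\<close>

context finite_group_on_vertex_algebra
begin

lemma group_GG: "group GG" by (rule V.group_G)

lemma finite_GG: "finite (carrier GG)" using finite_G by simp

lemma G_closed: "g \<in> G \<Longrightarrow> x \<in> V \<Longrightarrow> g x \<in> V"
  and G_add: "g \<in> G \<Longrightarrow> x \<in> V \<Longrightarrow> y \<in> V \<Longrightarrow> g (x + y) = g x + g y"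
  and G_scale: "g \<in> G \<Longrightarrow> x \<in> V \<Longrightarrow> g (s c x) = s c (g x)"
  and G_mode: "g \<in> G \<Longrightarrow> u \<in> V \<Longrightarrow> v \<in> V \<Longrightarrow> g (Y u n v) = Y (g u) n (g v)"
  and G_vac: "g \<in> G \<Longrightarrow> g vac = vac"
  using automorphismD[OF G_automorphism] linear_onD[OF automorphismD(2)[OF G_automorphism]] by blast+

lemma VG_D: "v \<in> VG \<Longrightarrow> v \<in> V" "v \<in> VG \<Longrightarrow> g \<in> G \<Longrightarrow> g v = v"
  by (auto simp: fixed_points_def)

lemma VG_subspace: "subspace VG"
  using subspace_V V.rep_zero by (auto simp: subspace_def fixed_points_def G_add G_scale)

text \<open>The locale also asserts that the fixed points form a vertex algebra; closure under modes
  is g(u_n v) = (g u)_n (g v).\<close>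

lemma vertex_module_VG: "vertex_module s VG vac Y s V Y"
proof -
  have "vac \<in> VG" using vac_closed G_vac by (simp add: fixed_points_def)
  moreover have "Y u n v \<in> VG" if uv: "u \<in> VG" "v \<in> VG" for u v n
  proof -
    have "g (Y u n v) = Y u n v" if g: "g \<in> G" for g
      using G_mode[OF g VG_D(1)[OF uv(1)] VG_D(1)[OF uv(2)], of n]
      unfolding VG_D(2)[OF uv(1) g] VG_D(2)[OF uv(2) g] .
    moreover have "Y u n v \<in> V" using uv by (simp add: Y_closed VG_D(1))
    ultimately show ?thesis by (simp add: fixed_points_def)
  qed
  ultimately show ?thesis
    by unfold_locales
      (simp_all add: VG_D(1) VG_subspace subspace_V Y_closed Y_truncation Y_vacuum Y_creation
        Y_creation_const Y_jacobi Y_linear_right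
        linear_on_subset[OF Y_linear_left VG_subset] linear_on_subset[OF Y_linear_right VG_subset])
qed

abbreviation hom_space ::
  "(complex \<Rightarrow> 'w::ab_group_add \<Rightarrow> 'w) \<Rightarrow> 'w set \<Rightarrow> (('v \<Rightarrow> 'v) \<Rightarrow> 'w \<Rightarrow> 'w) \<Rightarrow> ('w \<Rightarrow> 'v) set" where
  "hom_space sW W \<rho> \<equiv> rep_hom GG sW W \<rho> s V (\<lambda>g. g)"

lemma hom_spaceD:
  assumes "f \<in> hom_space sW W \<rho>"
  shows "linear_on sW W s f" "w \<in> W \<Longrightarrow> f w \<in> V" "g \<in> G \<Longrightarrow> w \<in> W \<Longrightarrow> f (\<rho> g w) = g (f w)"
    "w \<notin> W \<Longrightarrow> f w = 0" "intertwines GG sW W \<rho> s V (\<lambda>g. g) f"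
  using assms by (auto simp: rep_hom_def intertwines_def)

lemma hom_space_zero:
  assumes "group_representation GG sW W \<rho>" "f \<in> hom_space sW W \<rho>"
  shows "f 0 = 0"
proof -
  interpret W: group_representation GG sW W \<rho> by fact
  show ?thesis by (rule linear_on_zero[OF W.vector_space_W vector_space_V W.subspace_W hom_spaceD(1)[OF assms(2)]])
qed

lemma hom_space_restrict:
  assumes W: "group_representation GG sW W \<rho>" and T: "intertwines GG sW W \<rho> s V (\<lambda>g. g) T"
  shows "(\<lambda>w. if w \<in> W then T w else 0) \<in> hom_space sW W \<rho>"
proof -
  interpret W: group_representation GG sW W \<rho> by fact
  show ?thesis
    using intertwinesD[OF T] W.rep_closed W.subspace_add[OF W.subspace_W] W.subspace_scale[OF W.subspace_W]
    by (auto simp: rep_hom_def linear_on_def)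
qed

lemma vector_space_hom: "vector_space (fun_scale s :: complex \<Rightarrow> ('w \<Rightarrow> 'v) \<Rightarrow> 'w \<Rightarrow> 'v)"
  by (rule vector_space_fun_scale[OF vector_space_V])

lemma hom_space_subspace: "module.subspace (fun_scale s) (hom_space sW W \<rho>)"
proof -
  interpret F: vector_space "fun_scale s :: _ \<Rightarrow> ('w \<Rightarrow> 'v) \<Rightarrow> _" by (rule vector_space_hom)
  show ?thesis
    using subspace_0[OF subspace_V] subspace_add[OF subspace_V] subspace_scale[OF subspace_V] V.rep_zero
    by (auto simp: F.subspace_def rep_hom_def linear_on_def fun_scale_def scale_right_distrib
        G_add G_scale Pi_iff add_ac mult.commute)
qed

lemma hom_modes_closed:
  assumes "v \<in> VG" "f \<in> hom_space sW W \<rho>"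
  shows "hom_modes Y v n f \<in> hom_space sW W \<rho>"
proof -
  note v = VG_D(1)[OF assms(1)] and f = hom_spaceD[OF assms(2)]
  have "linear_on sW W s (\<lambda>w. Y v n (f w))"
    using f(2) by (intro linear_on_compose[OF f(1) _ Y_linear_right[OF v]]) blast
  moreover have "Y v n (f (\<rho> g w)) = g (Y v n (f w))" if "g \<in> G" "w \<in> W" for g w
    using that f(2,3) by (simp add: G_mode v VG_D(2)[OF assms(1)])
  ultimately show ?thesis
    using f(2,4) v by (simp add: rep_hom_def hom_modes_def Y_closed mode_zero)
qed

lemma mode_span_hom:
  assumes a: "a \<in> mode_span s VG Y" and f: "f \<in> N"
    and N: "vertex_submodule VG (fun_scale s) (hom_space sW W \<rho>) (hom_modes Y) N"
  shows "(\<lambda>w. a (f w)) \<in> N"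
proof -
  interpret F: vector_space "fun_scale s :: _ \<Rightarrow> ('a \<Rightarrow> 'v) \<Rightarrow> _" by (rule vector_space_hom)
  have sub: "F.subspace N" using N by (simp add: vertex_submodule_def)
  show ?thesis using a
  proof (induction rule: mode_span_induct)
    case zero
    then show ?case using F.subspace_0[OF sub] by (simp add: zero_fun_def)
  next
    case (step c u n b)
    have "hom_modes Y u n f \<in> N" using step(1) N f by (simp add: vertex_submodule_def)
    then have "fun_scale s c (hom_modes Y u n f) + (\<lambda>w. b (f w)) \<in> N"
      by (intro F.subspace_add[OF sub] F.subspace_scale[OF sub] step)
    then show ?case by (simp add: fun_scale_def hom_modes_def plus_fun_def)
  qed
qed

text \<open>By Schur an equivariant map is zero or injective. Hence evaluation at a single nonzero
  vector of \<open>W\<close> embeds the multiplicity space into \<open>V\<close>.\<close>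

lemma hom_space_eq_0:
  assumes irr: "irreducible_representation GG sW W \<rho>" and f: "f \<in> hom_space sW W \<rho>"
    and w: "w \<in> W" "w \<noteq> 0" "f w = 0"
  shows "f = 0"
proof (rule ccontr)
  interpret W: group_representation GG sW W \<rho> by (rule irreducible_repD[OF irr])
  assume "f \<noteq> 0"
  then obtain x where "f x \<noteq> 0" by (auto simp: fun_eq_iff)
  then have "inj_on f W"
    using schur_injective[OF irr V.rep_axioms hom_spaceD(5)[OF f], of x] hom_spaceD(4)[OF f] by blast
  moreover have "f 0 = 0"
    by (rule hom_space_zero[OF W.rep_axioms f])
  ultimately show False using w W.subspace_0[OF W.subspace_W] by (metis inj_onD)
qed

lemma hom_space_vertex_module:
  assumes irr: "irreducible_representation GG sW W \<rho>"
  shows "vertex_module s VG vac Y (fun_scale s) (hom_space sW W \<rho>) (hom_modes Y)"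
proof -
  interpret W: group_representation GG sW W \<rho> by (rule irreducible_repD[OF irr])
  interpret F: vector_space "fun_scale s :: _ \<Rightarrow> ('a \<Rightarrow> 'v) \<Rightarrow> _" by (rule vector_space_hom)
  obtain w where w: "w \<in> W" "w \<noteq> 0"
    using irreducible_repD(2)[OF irr] W.subspace_0[OF W.subspace_W] by blast
  show ?thesis
  proof (rule vertex_module_transport[OF vertex_module_VG vector_space_hom hom_space_subspace])
    show "linear_on (fun_scale s) (hom_space sW W \<rho>) s (\<lambda>f. f w)"
      by (simp add: linear_on_def fun_scale_def)
    show "inj_on (\<lambda>f. f w) (hom_space sW W \<rho>)"
    proof (rule inj_onI)
      fix f h assume fh: "f \<in> hom_space sW W \<rho>" "h \<in> hom_space sW W \<rho>" "f w = h w"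
      then have "f - h \<in> hom_space sW W \<rho>" by (intro F.subspace_diff[OF hom_space_subspace])
      moreover have "(f - h) w = 0" using fh(3) by simp
      ultimately have "f - h = 0" by (rule hom_space_eq_0[OF irr _ w])
      then show "f = h" by (rule eq_iff_diff_eq_0[THEN iffD2])
    qed
  qed (use w hom_spaceD(2) hom_modes_closed in \<open>auto simp: hom_modes_def\<close>)
qed

text \<open>Otherwise a matrix coefficient of \<open>W\<close> would be a linear relation between the elements of \<open>G\<close>.\<close>

lemma hom_space_nonzero:
  assumes irr: "irreducible_representation GG sW W \<rho>"
  shows "hom_space sW W \<rho> \<noteq> {0}"
proof
  assume triv: "hom_space sW W \<rho> = {0}"
  interpret W: group_representation GG sW W \<rho> by (rule irreducible_repD[OF irr])
  interpret group GG by (rule group_GG)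
  obtain u where u: "u \<in> W" "u \<noteq> 0"
    using irreducible_repD(2)[OF irr] W.subspace_0[OF W.subspace_W] by blast
  obtain \<phi> where \<phi>: "linear_on sW W (*) \<phi>" "\<phi> u = 1"
    using W.exists_functional[OF u(2)] linear_on_of_linear by metis
  have zero: "T x = 0" if T: "intertwines GG sW W \<rho> s V (\<lambda>g. g) T" "x \<in> W" for T x
  proof -
    have "(\<lambda>w. if w \<in> W then T w else 0) = 0"
      using hom_space_restrict[OF W.rep_axioms T(1)] triv by simp
    from fun_cong[OF this, of x] show ?thesis using T(2) by simp
  qed
  have "(\<Sum>g\<in>G. s (\<phi> (\<rho> (ginv g) u)) (g v)) = 0" if "v \<in> V" for v
    using matrix_coefficient_zero[OF W.rep_axioms V.rep_axioms finite_GG \<phi>(1) that u(1)] zero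
    by simp
  then have "\<phi> (\<rho> (ginv \<one>\<^bsub>GG\<^esub>) u) = 0"
    using automorphisms_independent[of G "\<lambda>g. \<phi> (\<rho> (ginv g) u)" "\<one>\<^bsub>GG\<^esub>"] finite_G G_automorphism one_closed by auto
  moreover have "\<rho> (ginv \<one>\<^bsub>GG\<^esub>) u = u" using W.rep_one[OF u(1)] inv_one by simp
  ultimately show False using \<phi>(2) by simp
qed

text \<open>Let f \<noteq> 0 lie in a submodule and let h be arbitrary. As f is injective on
  \<open>W\<close>, the map f w \<mapsto> h w is well defined and equivariant on the
  finite-dimensional space f W. Equivariant density realises it by modes of fixed vectors, which
  carry f to h inside the submodule.\<close>

lemma hom_space_irreducible:
  assumes irr: "irreducible_representation GG sW W \<rho>"
  shows "irreducible_vertex_module s VG vac Y (fun_scale s) (hom_space sW W \<rho>) (hom_modes Y)"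
  unfolding irreducible_vertex_module_def
proof (intro conjI allI impI)
  interpret W: group_representation GG sW W \<rho> by (rule irreducible_repD[OF irr])
  interpret F: vector_space "fun_scale s :: _ \<Rightarrow> ('a \<Rightarrow> 'v) \<Rightarrow> _" by (rule vector_space_hom)
  fix N assume N: "vertex_submodule VG (fun_scale s) (hom_space sW W \<rho>) (hom_modes Y) N"
  have "h \<in> N" if f: "f \<in> N" "f \<noteq> 0" and h: "h \<in> hom_space sW W \<rho>" for f h
  proof -
    have fH: "f \<in> hom_space sW W \<rho>" using f N by (auto simp: vertex_submodule_def)
    note f' = hom_spaceD[OF fH] and h' = hom_spaceD[OF h]
    obtain x where "f x \<noteq> 0" using f(2) by (auto simp: fun_eq_iff)
    then have inj: "inj_on f W"
      using schur_injective[OF irr V.rep_axioms f'(5), of x] f'(4) by blast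
    obtain B where B: "finite B" "W.span B = W"
      using irreducible_rep_basis[OF irr finite_GG] by metis
    have BW: "B \<subseteq> W" using B(2) W.span_superset by blast
    have span: "span (f ` B) = f ` W"
    proof
      show "span (f ` B) \<subseteq> f ` W"
        using BW by (intro span_minimal subspace_image[OF W.vector_space_W vector_space_V W.subspace_W f'(1)]) auto
      show "f ` W \<subseteq> span (f ` B)"
        using linear_on_image_span[OF W.vector_space_W vector_space_V W.subspace_W f'(1) BW] B(2) by auto
    qed
    define T where "T y = h (inv_into W f y)" for y
    have Tf: "T (f w) = h w" if "w \<in> W" for w using inj that by (simp add: T_def)
    have "\<exists>b\<in>mode_span s VG Y. \<forall>x\<in>span (f ` B). b x = T x"
    proof (rule equivariant_density)
      show "linear_on s (span (f ` B)) s T"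
        unfolding span linear_on_def
      proof (intro conjI ballI allI)
        fix x y assume "x \<in> f ` W" "y \<in> f ` W"
        then obtain u v where uv: "x = f u" "y = f v" "u \<in> W" "v \<in> W" by blast
        then show "T (x + y) = T x + T y"
          using Tf[of "u + v"] W.subspace_add[OF W.subspace_W] linear_on_add[OF f'(1)] linear_on_add[OF h'(1)]
          by (simp add: Tf)
      next
        fix c x assume "x \<in> f ` W"
        then obtain u where "x = f u" "u \<in> W" by blast
        then show "T (s c x) = s c (T x)"
          using Tf[of "sW c u"] W.subspace_scale[OF W.subspace_W] linear_on_scale[OF f'(1)] linear_on_scale[OF h'(1)]
          by (simp add: Tf)
      qed
      fix g x assume "g \<in> G" "x \<in> span (f ` B)"
      then obtain w where w: "w \<in> W" "x = f w" "\<rho> g w \<in> W" using span W.rep_closed by auto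
      show "g x \<in> span (f ` B)" "T (g x) = g (T x)"
        using w f'(3)[OF \<open>g \<in> G\<close> w(1)] h'(3)[OF \<open>g \<in> G\<close> w(1)] Tf[of "\<rho> g w"] unfolding span
        by (metis imageI, simp add: Tf)
    qed (use B BW f'(2) h'(2) Tf span in auto)
    then obtain b where b: "b \<in> mode_span s VG Y" "\<And>w. w \<in> W \<Longrightarrow> b (f w) = h w"
      unfolding span using Tf by auto
    \<comment> \<open>Equality of functions is also needed outside \<open>W\<close>, where
      \<open>f\<close> and \<open>h\<close> are 0.\<close>
    have "b 0 = 0"
      by (rule linear_on_zero_V[OF mode_span_linear[OF b(1) VG_subset]])
    moreover have "b (f w) = h w" for w
      using calculation b(2)[of w] f'(4)[of w] h'(4)[of w] by (cases "w \<in> W") simp_all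
    ultimately have "(\<lambda>w. b (f w)) = h" by blast
    then show ?thesis using mode_span_hom[OF b(1) f(1) N] by simp
  qed
  then show "N = {0} \<or> N = hom_space sW W \<rho>"
    using N F.subspace_0[of N] by (auto simp: vertex_submodule_def)
qed (fact hom_space_vertex_module[OF irr] hom_space_nonzero[OF irr])+

section \<open>Group algebra elements built from matrix coefficients, acting on V\<close>

definition matrix_op ::
  "(('v \<Rightarrow> 'v) \<Rightarrow> 'w \<Rightarrow> 'w) \<Rightarrow> ('w \<Rightarrow> complex) \<Rightarrow> 'w \<Rightarrow> 'v \<Rightarrow> 'v" where
  "matrix_op \<rho> \<phi> u x = (\<Sum>g\<in>G. s (\<phi> (\<rho> (ginv g) u)) (g x))"

lemma matrix_op_linear: "linear_on s V s (matrix_op \<rho> \<phi> u)"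
  by (simp add: linear_on_def matrix_op_def G_add G_scale scale_right_distrib sum.distrib
      scale_sum_right mult.commute)

lemma matrix_op_closed: "x \<in> V \<Longrightarrow> matrix_op \<rho> \<phi> u x \<in> V"
  unfolding matrix_op_def by (auto simp: G_closed intro!: subspace_sum[OF subspace_V] subspace_scale[OF subspace_V])

text \<open>An equivariant \<open>h\<close> commutes with the group algebra, so matrix operators on
  the values of \<open>h\<close> are computed inside \<open>U\<close> by Schur
  orthogonality.\<close>

lemma matrix_op_hom:
  assumes U: "group_representation GG sU U \<sigma>" and h: "h \<in> hom_space sU U \<sigma>" and w: "w \<in> U"
  shows "matrix_op \<rho> \<phi> u (h w) = h (group_sum GG \<rho> sU \<sigma> \<phi> u w)"
proof -
  interpret U: group_representation GG sU U \<sigma> by fact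
  note h' = hom_spaceD[OF h]
  have cl: "\<sigma> g w \<in> U" if "g \<in> G" for g using U.rep_closed that w by simp
  have "h (group_sum GG \<rho> sU \<sigma> \<phi> u w)
      = (\<Sum>g\<in>carrier GG. h (sU (\<phi> (\<rho> (ginv g) u)) (\<sigma> g w)))"
    using cl by (intro linear_on_sum[OF U.vector_space_W vector_space_V U.subspace_W h'(1)]
        U.subspace_scale[OF U.subspace_W]) auto
  also have "\<dots> = (\<Sum>g\<in>G. s (\<phi> (\<rho> (ginv g) u)) (g (h w)))"
    by (rule sum.cong) (use cl h'(3) w linear_on_scale[OF h'(1)] in auto)
  finally show ?thesis by (simp add: matrix_op_def)
qed

lemma matrix_op_same:
  assumes irr: "irreducible_representation GG sW W \<rho>"
    and "linear_on sW W (*) \<phi>" "u \<in> W" "w \<in> W" "f \<in> hom_space sW W \<rho>"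
  shows "matrix_op \<rho> \<phi> u (f w) = s (schur_constant GG sW W * \<phi> w) (f u)"
  using assms by (simp only: matrix_op_hom[OF irreducible_repD(1)[OF irr]]
      schur_orthogonality(2)[OF irr finite_GG] linear_on_scale[OF hom_spaceD(1)])

lemma matrix_op_other:
  assumes W: "group_representation GG sW W \<rho>" and U: "group_representation GG sU U \<sigma>"
    and zero: "\<And>T x. intertwines GG sW W \<rho> sU U \<sigma> T \<Longrightarrow> x \<in> W \<Longrightarrow> T x = 0"
    and \<phi>: "linear_on sW W (*) \<phi>" and u: "u \<in> W" and w: "w \<in> U" and h: "h \<in> hom_space sU U \<sigma>"
  shows "matrix_op \<rho> \<phi> u (h w) = 0"
proof -
  interpret U: group_representation GG sU U \<sigma> by fact
  have "group_sum GG \<rho> sU \<sigma> \<phi> u w = 0"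
    by (rule matrix_coefficient_zero[OF W U finite_GG \<phi> w u]) (rule zero)
  then show ?thesis
    using hom_space_zero[OF U.rep_axioms h]
    by (simp only: matrix_op_hom[OF U h w])
qed

text \<open>
  Summing matrix operators over a basis of \<open>W\<close> gives a multiple of the projection to the
  \<open>W\<close>-isotypic part; by density this projection is realised on \<open>f W + \<psi> f U\<close> by modes of \<open>V\<^sup>G\<close>.
\<close>

lemma hom_spaces_not_isomorphic:
  assumes irr: "irreducible_representation GG sW W \<rho>" "irreducible_representation GG sU U \<sigma>"
    and zero: "\<And>T x. intertwines GG sW W \<rho> sU U \<sigma> T \<Longrightarrow> x \<in> W \<Longrightarrow> T x = 0"
  shows "\<not> isomorphic_vertex_modules VG (fun_scale s) (hom_space sW W \<rho>) (hom_modes Y)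
           (fun_scale s) (hom_space sU U \<sigma>) (hom_modes Y)"
proof
  let ?HW = "hom_space sW W \<rho>" and ?HU = "hom_space sU U \<sigma>"
  interpret W: group_representation GG sW W \<rho> by (rule irreducible_repD[OF irr(1)])
  interpret U: group_representation GG sU U \<sigma> by (rule irreducible_repD[OF irr(2)])
  interpret FW: vector_space "fun_scale s :: _ \<Rightarrow> ('a \<Rightarrow> 'v) \<Rightarrow> _" by (rule vector_space_hom)
  assume "isomorphic_vertex_modules VG (fun_scale s) ?HW (hom_modes Y)
           (fun_scale s) ?HU (hom_modes Y)"
  then obtain \<psi> where \<psi>: "linear_on (fun_scale s) ?HW (fun_scale s) \<psi>"
    "bij_betw \<psi> ?HW ?HU"
    "\<And>v n f. v \<in> VG \<Longrightarrow> f \<in> ?HW \<Longrightarrow> \<psi> (hom_modes Y v n f) = hom_modes Y v n (\<psi> f)"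
    by (auto simp: isomorphic_vertex_modules_def)
  have \<psi>0: "\<psi> 0 = 0"
    by (rule linear_on_zero[OF vector_space_hom vector_space_hom hom_space_subspace \<psi>(1)])
  have sub: "vertex_submodule VG (fun_scale s) ?HW (hom_modes Y) ?HW"
    using hom_space_subspace hom_modes_closed by (auto simp: vertex_submodule_def)
  have \<psi>_span: "\<psi> (\<lambda>w. b (f w)) = (\<lambda>w. b (\<psi> f w))"
    if "b \<in> mode_span s VG Y" and f: "f \<in> ?HW" for b f
    using that(1)
  proof (induction rule: mode_span_induct)
    case zero
    then show ?case using \<psi>0 by (simp add: zero_fun_def)
  next
    case (step c u n b)
    have "(\<lambda>w. s c (Y u n (f w)) + b (f w)) = fun_scale s c (hom_modes Y u n f) + (\<lambda>w. b (f w))"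
      by (simp add: fun_eq_iff fun_scale_def hom_modes_def)
    moreover have "\<psi> (fun_scale s c (hom_modes Y u n f) + (\<lambda>w. b (f w)))
        = fun_scale s c (\<psi> (hom_modes Y u n f)) + \<psi> (\<lambda>w. b (f w))"
      using hom_modes_closed[OF step(1) f] mode_span_hom[OF step(2) f sub] FW.subspace_scale[OF hom_space_subspace]
      by (simp add: linear_on_add[OF \<psi>(1)] linear_on_scale[OF \<psi>(1)])
    ultimately have "\<psi> (\<lambda>w. s c (Y u n (f w)) + b (f w))
        = fun_scale s c (hom_modes Y u n (\<psi> f)) + (\<lambda>w. b (\<psi> f w))"
      by (simp only: \<psi>(3)[OF step(1) f] step(3))
    then show ?case by (simp add: fun_eq_iff fun_scale_def hom_modes_def)
  qed
  obtain f where f: "f \<in> ?HW" "f \<noteq> 0"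
    using hom_space_nonzero[OF irr(1)] FW.subspace_0[OF hom_space_subspace] by blast
  define h where "h = \<psi> f"
  have h: "h \<in> ?HU" using \<psi>(2) f(1) by (auto simp: h_def bij_betw_def)
  obtain B where B: "finite B" "W.independent B" "W.span B = W"
    using irreducible_rep_basis[OF irr(1) finite_GG] by metis
  obtain B' where B': "finite B'" "U.span B' = U"
    using irreducible_rep_basis[OF irr(2) finite_GG] by metis
  have BW: "B \<subseteq> W" and BU: "B' \<subseteq> U" using B(3) B'(2) W.span_superset U.span_superset by blast+
  \<comment> \<open>Its span is f W + h U: finite-dimensional and stable under the group, as
    equivariant density requires.\<close>
  let ?E = "f ` B \<union> h ` B'"
  have EV: "?E \<subseteq> V" using hom_spaceD(2)[OF f(1)] hom_spaceD(2)[OF h] BW BU by blast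
  have spanV: "span ?E \<subseteq> V" by (rule span_minimal[OF EV subspace_V])
  have fspan: "f w \<in> span ?E" if "w \<in> W" for w
    using linear_on_image_span[OF W.vector_space_W vector_space_V W.subspace_W hom_spaceD(1)[OF f(1)] BW, of w]
      span_mono[of "f ` B" ?E] B(3) that by blast
  have hspan: "h w \<in> span ?E" if "w \<in> U" for w
    using linear_on_image_span[OF U.vector_space_W vector_space_V U.subspace_W hom_spaceD(1)[OF h] BU, of w]
      span_mono[of "h ` B'" ?E] B'(2) that by blast
  define c where "c = schur_constant GG sW W"
  have c0: "c \<noteq> 0" unfolding c_def by (rule schur_orthogonality(1)[OF irr(1) finite_GG])
  have co: "linear_on sW W (*) (\<lambda>w. W.representation B w b)" for b
    using linear_on_representation[OF W.vector_space_W B(2), of b] unfolding B(3) .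
  define T where "T x = (\<Sum>b\<in>B. matrix_op \<rho> (\<lambda>w. W.representation B w b) b x)" for x
  have T_lin: "linear_on s V s T"
    unfolding T_def by (rule linear_on_sum_fun[OF vector_space_V matrix_op_linear])
  have Tf: "T (f w) = s c (f w)" if w: "w \<in> W" for w
  proof -
    have "T (f w) = (\<Sum>b\<in>B. s (c * W.representation B w b) (f b))"
      unfolding T_def c_def using BW w f(1) by (intro sum.cong refl matrix_op_same[OF irr(1)] co) auto
    also have "\<dots> = s c (\<Sum>b\<in>B. f (sW (W.representation B w b) b))"
      using BW by (auto simp: scale_sum_right linear_on_scale[OF hom_spaceD(1)[OF f(1)]] intro!: sum.cong)
    also have "(\<Sum>b\<in>B. f (sW (W.representation B w b) b)) = f (\<Sum>b\<in>B. sW (W.representation B w b) b)"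
      using BW by (intro linear_on_sum[OF W.vector_space_W vector_space_V W.subspace_W hom_spaceD(1)[OF f(1)], symmetric])
        (auto intro: W.subspace_scale[OF W.subspace_W])
    finally show ?thesis using W.sum_representation[OF B(1,2), of w] B(3) w by simp
  qed
  have Th: "T (h w) = 0" if w: "w \<in> U" for w
    unfolding T_def
  proof (intro sum.neutral ballI)
    fix b assume "b \<in> B"
    then have b: "b \<in> W" using BW by blast
    show "matrix_op \<rho> (\<lambda>w. W.representation B w b) b (h w) = 0"
      by (rule matrix_op_other[OF W.rep_axioms U.rep_axioms _ co b w h])
        (rule zero)
  qed
  have G_lin: "linear_on s V s g" if "g \<in> G" for g using automorphismD(2)[OF G_automorphism[OF that]] .
  have TV: "T x \<in> V" if "x \<in> V" for x
    unfolding T_def by (intro subspace_sum[OF subspace_V] matrix_op_closed that)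
  have stable: "g x \<in> span ?E" if g: "g \<in> G" and x: "x \<in> span ?E" for g x
  proof (rule V.stable_span[OF EV _ _ x])
    fix y assume "y \<in> ?E"
    then show "g y \<in> span ?E"
    proof
      assume "y \<in> f ` B"
      then obtain b where b: "b \<in> W" "y = f b" using BW by blast
      then show ?thesis using fspan[of "\<rho> g b"] hom_spaceD(3)[OF f(1) g, of b] W.rep_closed g by simp
    next
      assume "y \<in> h ` B'"
      then obtain b where b: "b \<in> U" "y = h b" using BU by blast
      then show ?thesis using hspan[of "\<sigma> g b"] hom_spaceD(3)[OF h g, of b] U.rep_closed g by simp
    qed
  qed (use g in simp)
  have "\<exists>b\<in>mode_span s VG Y. \<forall>x\<in>span ?E. b x = T x"
  proof (rule equivariant_density[OF _ EV])
    fix g x assume g: "g \<in> G" and x: "x \<in> span ?E"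
    show "T (g x) = g (T x)"
    proof (rule linear_on_eq_on_span[OF vector_space_V vector_space_V EV subspace_V _ _ _ x])
      show "linear_on s V s (\<lambda>x. T (g x))"
        by (rule linear_on_compose[OF G_lin[OF g] _ T_lin]) (simp add: G_closed[OF g])
      show "linear_on s V s (\<lambda>x. g (T x))"
        by (rule linear_on_compose[OF T_lin _ G_lin[OF g]]) (use TV in blast)
      fix y assume "y \<in> ?E"
      then show "T (g y) = g (T y)"
      proof
        assume "y \<in> f ` B"
        then obtain b where b: "b \<in> W" "y = f b" using BW by blast
        then have "T (g y) = s c (f (\<rho> g b))"
          using Tf[of "\<rho> g b"] hom_spaceD(3)[OF f(1) g b(1)] W.rep_closed g by simp
        then show ?thesis
          using Tf[OF b(1)] hom_spaceD(3)[OF f(1) g b(1)] b hom_spaceD(2)[OF f(1) b(1)] G_scale[OF g] by simp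
      next
        assume "y \<in> h ` B'"
        then obtain b where b: "b \<in> U" "y = h b" using BU by blast
        then show ?thesis
          using Th[of "\<sigma> g b"] Th[OF b(1)] hom_spaceD(3)[OF h g b(1)] U.rep_closed g V.rep_zero by simp
      qed
    qed
  next
    fix g x assume "g \<in> G" "x \<in> span ?E"
    then show "g x \<in> span ?E" by (rule stable)
  qed (use B(1) B'(1) TV spanV linear_on_subset[OF T_lin spanV] in auto)
  then obtain b where b: "b \<in> mode_span s VG Y" "\<And>x. x \<in> span ?E \<Longrightarrow> b x = T x" by blast
  have b0: "b 0 = 0"
    by (rule linear_on_zero_V[OF mode_span_linear[OF b(1) VG_subset]])
  have "b (f w) = s c (f w)" for w
    using b(2)[OF fspan] Tf b0 hom_spaceD(4)[OF f(1), of w] by (cases "w \<in> W") simp_all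
  then have "(\<lambda>w. b (f w)) = fun_scale s c f" by (simp add: fun_eq_iff fun_scale_def)
  moreover have "b (h w) = 0" for w
    using b(2)[OF hspan] Th b0 hom_spaceD(4)[OF h, of w] by (cases "w \<in> U") simp_all
  then have "(\<lambda>w. b (h w)) = 0" by (simp add: fun_eq_iff)
  \<comment> \<open>\<psi> carries b f = c f to b h = c h, while b h = 0.\<close>
  ultimately have "fun_scale s c h = 0"
    using \<psi>_span[OF b(1) f(1)] linear_on_scale[OF \<psi>(1) f(1)] by (simp add: h_def)
  then have "h = 0" using c0 by (simp add: fun_eq_iff fun_scale_def)
  then have "f = 0"
    using \<psi>(2) \<psi>0 f(1) FW.subspace_0[OF hom_space_subspace] unfolding h_def bij_betw_def
    by (metis inj_onD)
  then show False using f(2) by simp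
qed

end

section \<open>Tensor products\<close>

lemma sum_fun_apply: "(\<Sum>i\<in>I. f i) x = (\<Sum>i\<in>I. f i x)" for f :: "'i \<Rightarrow> 'a \<Rightarrow> 'b::ab_group_add"
  by (induction I rule: infinite_finite_induct) simp_all

lemma tensor_endo_sum:
  "tensor_endo s1 S1 s2 S2 A B (\<Sum>i\<in>I. t i) = (\<Sum>i\<in>I. tensor_endo s1 S1 s2 S2 A B (t i))"
  by (auto simp: tensor_endo_def fun_eq_iff sum_fun_apply)

lemma tensor_endo_zero: "tensor_endo s1 S1 s2 S2 A B 0 = 0"
  by (auto simp: tensor_endo_def fun_eq_iff)

lemma tensor_endo_pure:
  assumes A: "linear_on s1 S1 s1 A" "\<And>x. x \<in> S1 \<Longrightarrow> A x \<in> S1"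
    and B: "linear_on s2 S2 s2 B" "\<And>y. y \<in> S2 \<Longrightarrow> B y \<in> S2"
  shows "tensor_endo s1 S1 s2 S2 A B (pure_tensor s1 S1 s2 S2 x y) = pure_tensor s1 S1 s2 S2 (A x) (B y)"
proof -
  have "(\<lambda>x y. \<beta> (A x) (B y)) \<in> bilinear_forms s1 S1 s2 S2" if "\<beta> \<in> bilinear_forms s1 S1 s2 S2" for \<beta>
    using that A B by (simp add: bilinear_forms_def linear_on_def)
  then show ?thesis by (auto simp: tensor_endo_def pure_tensor_def fun_eq_iff)
qed

text \<open>Expanding the first factors in the basis collects any tensor into one term for each
  basis vector. Only existence is claimed; uniqueness of the components is obtained inside
  \<open>V\<close> from \<open>components_unique\<close>.\<close>

lemma tensor_expansion:
  assumes s1: "vector_space s1" and B: "finite B" "\<not> module.dependent s1 B" "module.span s1 B = S1"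
    and s2: "vector_space s2" and S2: "module.subspace s2 S2" and t: "t \<in> tensor s1 S1 s2 S2"
  shows "\<exists>y. (\<forall>b\<in>B. y b \<in> S2) \<and> t = (\<Sum>b\<in>B. pure_tensor s1 S1 s2 S2 b (y b))"
proof -
  interpret A: vector_space s1 by fact
  interpret C: vector_space s2 by fact
  interpret F: vector_space "fun_scale (*) :: complex \<Rightarrow> (('a \<Rightarrow> 'b \<Rightarrow> complex) \<Rightarrow> complex) \<Rightarrow> _"
    by (rule vector_space_fun_scale) (rule vector_space_times)
  let ?p = "pure_tensor s1 S1 s2 S2"
  have S1: "A.subspace S1" using B(3) A.subspace_span by blast
  have BS: "b \<in> S1" if "b \<in> B" for b using that B(3) A.span_base by blast
  note right = pure_tensor_bilinear(2)[of _ S1 s2 S2 s1] and left = pure_tensor_bilinear(1)[of _ S2 s1 S1 s2]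
  show ?thesis
    using t unfolding tensor_def
  proof (induction rule: F.span_induct_alt)
    case base
    show ?case
      using C.subspace_0[OF S2] linear_on_zero[OF s2 F.vector_space_axioms S2 right[OF BS]]
      by (intro exI[of _ "\<lambda>_. 0"]) simp
  next
    case (step c p t)
    then obtain x z where xz: "p = ?p x z" "x \<in> S1" "z \<in> S2" by blast
    obtain y where y: "\<forall>b\<in>B. y b \<in> S2" "t = (\<Sum>b\<in>B. ?p b (y b))" using step by blast
    define k where "k b = A.representation B x b" for b
    have "p = ?p (\<Sum>b\<in>B. s1 (k b) b) z"
      using A.sum_representation[OF B(1,2), of x] xz B(3) by (simp add: k_def)
    also have "\<dots> = (\<Sum>b\<in>B. ?p (s1 (k b) b) z)"
      by (rule linear_on_sum[OF s1 F.vector_space_axioms S1 left[OF xz(3)]])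
        (auto intro: A.subspace_scale[OF S1] BS)
    also have "\<dots> = (\<Sum>b\<in>B. fun_scale (*) (k b) (?p b z))"
      by (intro sum.cong refl linear_on_scale[OF left[OF xz(3)]] BS)
    finally have "fun_scale (*) c p + t = (\<Sum>b\<in>B. fun_scale (*) (c * k b) (?p b z) + ?p b (y b))"
      by (simp add: y(2) F.scale_sum_right sum.distrib)
    also have "\<dots> = (\<Sum>b\<in>B. ?p b (s2 (c * k b) z + y b))"
      using y(1) xz(3) C.subspace_scale[OF S2]
      by (intro sum.cong refl) (simp add: linear_on_add[OF right[OF BS]] linear_on_scale[OF right[OF BS]])
    finally show ?case
      using y(1) xz(3) C.subspace_scale[OF S2] C.subspace_add[OF S2]
      by (intro exI[of _ "\<lambda>b. s2 (c * k b) z + y b"]) simp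
  qed
qed

section \<open>The dual pair\<close>

text \<open>The representatives live on an arbitrary type, whereas the index set comes from
  representations on sequences; the two are tied together only by their characters.\<close>

locale dual_pair = finite_group_on_vertex_algebra s V vac Y G
  for s :: "complex \<Rightarrow> 'v::ab_group_add \<Rightarrow> 'v" and V vac Y G +
  fixes sW :: "complex \<Rightarrow> 'w::ab_group_add \<Rightarrow> 'w"
    and W :: "(('v \<Rightarrow> 'v) \<Rightarrow> complex) \<Rightarrow> 'w set"
    and \<rho> :: "(('v \<Rightarrow> 'v) \<Rightarrow> complex) \<Rightarrow> ('v \<Rightarrow> 'v) \<Rightarrow> 'w \<Rightarrow> 'w"
  assumes W_irreducible: "\<kappa> \<in> irreducible_characters GG \<Longrightarrow> irreducible_representation GG sW (W \<kappa>) (\<rho> \<kappa>)"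
    and W_character: "\<kappa> \<in> irreducible_characters GG \<Longrightarrow> rep_character GG sW (W \<kappa>) (\<rho> \<kappa>) = \<kappa>"
begin

abbreviation "\<Lambda> \<equiv> irreducible_characters GG"
abbreviation "H \<kappa> \<equiv> hom_space sW (W \<kappa>) (\<rho> \<kappa>)"
abbreviation "pure \<kappa> \<equiv> pure_tensor sW (W \<kappa>) (fun_scale s) (H \<kappa>)"
abbreviation "Tens \<kappa> \<equiv> tensor sW (W \<kappa>) (fun_scale s) (H \<kappa>)"

lemmas W_rep = irreducible_repD(1)[OF W_irreducible]

lemma intertwiner_zero:
  assumes "\<kappa> \<in> \<Lambda>" "\<eta> \<in> \<Lambda>" "\<kappa> \<noteq> \<eta>"
    and T: "intertwines GG sW (W \<kappa>) (\<rho> \<kappa>) sW (W \<eta>) (\<rho> \<eta>) T" and x: "x \<in> W \<kappa>"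
  shows "T x = 0"
proof (rule ccontr)
  note irr = W_irreducible[OF assms(1)] W_irreducible[OF assms(2)]
  assume "T x \<noteq> 0"
  then have "bij_betw T (W \<kappa>) (W \<eta>)" by (rule schur_bijective[OF irr T x])
  then have "rep_character GG sW (W \<kappa>) (\<rho> \<kappa>) = rep_character GG sW (W \<eta>) (\<rho> \<eta>)"
    by (rule same_character_if_isomorphic[OF irr finite_GG T])
  then show False using W_character assms by simp
qed

lemma isomorphic_iff:
  assumes "\<kappa> \<in> \<Lambda>" "\<eta> \<in> \<Lambda>"
  shows "isomorphic_vertex_modules VG (fun_scale s) (H \<kappa>) (hom_modes Y) (fun_scale s) (H \<eta>) (hom_modes Y)
    \<longleftrightarrow> \<kappa> = \<eta>"
proof
  assume "isomorphic_vertex_modules VG (fun_scale s) (H \<kappa>) (hom_modes Y) (fun_scale s) (H \<eta>) (hom_modes Y)"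
  then show "\<kappa> = \<eta>"
    using hom_spaces_not_isomorphic[OF W_irreducible[OF assms(1)] W_irreducible[OF assms(2)]]
      intertwiner_zero[OF assms] by blast
next
  assume "\<kappa> = \<eta>"
  then show "isomorphic_vertex_modules VG (fun_scale s) (H \<kappa>) (hom_modes Y) (fun_scale s) (H \<eta>) (hom_modes Y)"
    unfolding isomorphic_vertex_modules_def
    by (intro exI[of _ "\<lambda>x. x"]) (auto simp: linear_on_def bij_betw_def)
qed

text \<open>
  Maschke: if the values of all \<open>f \<in> H \<kappa>\<close> did not span \<open>V\<close>, an equivariant projection onto their span
  would have a nonzero kernel, hence an irreducible subrepresentation in its kernel.
\<close>

lemma hom_values_span: "V \<subseteq> span {f w | \<kappa> f w. \<kappa> \<in> \<Lambda> \<and> f \<in> H \<kappa> \<and> w \<in> W \<kappa>}"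
proof
  let ?E = "{f w | \<kappa> f w. \<kappa> \<in> \<Lambda> \<and> f \<in> H \<kappa> \<and> w \<in> W \<kappa>}"
  let ?N = "span ?E"
  interpret VP: vector_space_pair s s ..
  interpret group GG by (rule group_GG)
  have EV: "?E \<subseteq> V" by (auto intro: hom_spaceD(2))
  have NV: "?N \<subseteq> V" by (rule span_minimal[OF EV subspace_V])
  have stable: "g x \<in> ?N" if g: "g \<in> G" and x: "x \<in> ?N" for g x
  proof (rule V.stable_span[OF EV _ _ x])
    fix y assume "y \<in> ?E"
    then obtain \<kappa> f w where y: "y = f w" "\<kappa> \<in> \<Lambda>" "f \<in> H \<kappa>" "w \<in> W \<kappa>" by blast
    interpret W: group_representation GG sW "W \<kappa>" "\<rho> \<kappa>" by (rule W_rep[OF y(2)])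
    have "g y = f (\<rho> \<kappa> g w)" "\<rho> \<kappa> g w \<in> W \<kappa>"
      using y hom_spaceD(3)[OF y(3) g y(4)] W.rep_closed g by simp_all
    then have "g y \<in> ?E" using y by blast
    then show "g y \<in> ?N" by (rule span_base)
  qed (use g in simp)
  \<comment> \<open>A linear left inverse of the identity on \<open>?N\<close> with range in
    \<open>?N\<close> is a projection, not yet equivariant.\<close>
  have "Vector_Spaces.linear s s id" by (rule linear_id)
  then obtain q0 where q0: "q0 ` UNIV \<subseteq> ?N" "Vector_Spaces.linear s s q0" "\<forall>v\<in>?N. q0 v = v"
    using VP.linear_exists_left_inverse_on[of id ?N] by auto
  define q where "q = rep_average GG (\<lambda>g. g) (\<lambda>g. g) q0"
  have q_eq: "q x = (\<Sum>g\<in>G. g (q0 (ginv g x)))" for x by (simp add: q_def rep_average_def)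
  have q: "intertwines GG s V (\<lambda>g. g) s V (\<lambda>g. g) q"
    unfolding q_def using q0(1) NV
    by (intro rep_average_intertwines[OF V.rep_axioms V.rep_axioms
          finite_GG linear_on_of_linear[OF q0(2)]]) auto
  note q' = intertwinesD[OF q]
  have qN: "q x \<in> ?N" for x
    unfolding q_eq using q0(1) by (intro span_sum) (auto intro: stable)
  let ?n = "of_nat (card G) :: complex"
  have n: "?n \<noteq> 0" using finite_G one_closed by (auto simp: card_eq_0_iff)
  have q_id: "q x = s ?n x" if x: "x \<in> ?N" for x
  proof -
    have "g (q0 (ginv g x)) = x" if g: "g \<in> G" for g
    proof -
      have "q0 (ginv g x) = ginv g x"
        using q0(3) stable[OF inv_GG(1)[OF g] x] by blast
      moreover have "g (ginv g x) = x" using inv_GG(2)[OF g] x NV by blast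
      ultimately show ?thesis by simp
    qed
    then have "(\<Sum>g\<in>G. g (q0 (ginv g x))) = (\<Sum>g\<in>G. x)" by (rule sum.cong[OF refl])
    then show ?thesis by (simp add: q_eq sum_constant_scale)
  qed
  fix v assume v: "v \<in> V"
  show "v \<in> ?N"
  proof (rule ccontr)
    assume not: "v \<notin> ?N"
    let ?K = "{x \<in> V. q x = 0}"
    have q_0: "q 0 = 0" by (rule linear_on_zero_V[OF q'(1)])
    have K: "subspace ?K"
      using subspace_V by (auto simp: subspace_def q_0 linear_on_add[OF q'(1)] linear_on_scale[OF q'(1)])
    \<comment> \<open>\<open>q\<close> is |G| times a projection onto \<open>?N\<close>, so this
      difference lies in its kernel; it is nonzero because \<open>v\<close> is not in
      \<open>?N\<close>.\<close>
    let ?x = "v - s (1 / ?n) (q v)"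
    have sq: "s (1 / ?n) (q v) \<in> ?N" by (intro span_scale qN)
    then have "q ?x = q v - s (1 / ?n) (s ?n (q v))"
      using v NV qN[of v] linear_on_diff_V[OF q'(1)]
        linear_on_scale[OF q'(1)] q_id by auto
    then have "?x \<in> ?K" using n v sq NV subspace_diff[OF subspace_V] by auto
    moreover have "?x \<noteq> 0" using not sq by auto
    ultimately have K0: "?K \<noteq> {0}" by blast
    obtain U E where U: "finite E" "independent E" "span E = U" "U \<subseteq> ?K" "U \<noteq> {0}"
      "\<forall>g\<in>carrier GG. \<forall>x\<in>U. g x \<in> U"
      "\<forall>X. subspace X \<and> X \<subseteq> U \<and> (\<forall>g\<in>carrier GG. \<forall>x\<in>X. g x \<in> X) \<longrightarrow> X = {0} \<or> X = U"
    proof (rule V.exists_irreducible_subspace[OF finite_GG K _ K0])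
      fix g x assume "g \<in> carrier GG" "x \<in> ?K"
      then show "g x \<in> ?K" using q'(3)[of g x] V.rep_closed V.rep_zero by simp
    next
      show "?K \<subseteq> V" by blast
    qed (rule that)
    have UV: "U \<subseteq> V" using U(4) by blast
    obtain W' :: "(nat \<Rightarrow> complex) set" and \<rho>' \<theta> where W':
      "irreducible_representation GG (fun_scale (*)) W' \<rho>'"
      "intertwines GG (fun_scale (*)) W' \<rho>' s V (\<lambda>g. g) \<theta>" "bij_betw \<theta> W' U"
      by (rule irreducible_subspace_model[OF V.rep_axioms U(1,2,3) UV U(5,6,7)])
    define \<kappa> where "\<kappa> = rep_character GG (fun_scale (*)) W' \<rho>'"
    have \<kappa>: "\<kappa> \<in> \<Lambda>" unfolding irreducible_characters_def \<kappa>_def using W'(1) by blast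
    obtain T where T: "intertwines GG sW (W \<kappa>) (\<rho> \<kappa>) (fun_scale (*)) W' \<rho>' T" "bij_betw T (W \<kappa>) W'"
      using isomorphic_if_same_character[OF W_irreducible[OF \<kappa>] W'(1) finite_GG] W_character[OF \<kappa>] \<kappa>_def
      by metis
    have "intertwines GG sW (W \<kappa>) (\<rho> \<kappa>) s V (\<lambda>g. g) (\<lambda>w. \<theta> (T w))"
      unfolding intertwines_def
    proof (intro conjI ballI)
      show "linear_on sW (W \<kappa>) s (\<lambda>w. \<theta> (T w))"
        using intertwinesD(2)[OF T(1)]
        by (intro linear_on_compose[OF intertwinesD(1)[OF T(1)] _ intertwinesD(1)[OF W'(2)]]) blast
    qed (use intertwinesD(2,3)[OF T(1)] intertwinesD(2,3)[OF W'(2)] in auto)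
    then have f: "(\<lambda>w. if w \<in> W \<kappa> then \<theta> (T w) else 0) \<in> H \<kappa>"
      by (rule hom_space_restrict[OF W_rep[OF \<kappa>]])
    \<comment> \<open>As a value of an equivariant map, \<open>u\<close> lies in \<open>?N\<close>,
      where \<open>q\<close> is multiplication by |G|; but \<open>U\<close> lies in the kernel of
      \<open>q\<close>.\<close>
    have "u = 0" if u: "u \<in> U" for u
    proof -
      obtain w where w: "w \<in> W \<kappa>" "\<theta> (T w) = u"
        using T(2) W'(3) u unfolding bij_betw_def by blast
      define h where "h = (\<lambda>w. if w \<in> W \<kappa> then \<theta> (T w) else 0)"
      have "h \<in> H \<kappa>" "u = h w" using f w by (simp_all add: h_def)
      then have "u \<in> ?E" using \<kappa> w(1) by blast
      then have "q u = s ?n u" by (intro q_id span_base)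
      then show ?thesis using u U(4) n by auto
    qed
    moreover have "0 \<in> U" using U(3) span_zero by blast
    ultimately show False using U(5) by blast
  qed
qed

section \<open>Bases of the irreducible representations and directness of the sum\<close>

definition basis :: "(('v \<Rightarrow> 'v) \<Rightarrow> complex) \<Rightarrow> 'w set" where
  "basis \<kappa> = (SOME B. finite B \<and> \<not> module.dependent sW B \<and> module.span sW B = W \<kappa>)"

lemma basis:
  assumes "\<kappa> \<in> \<Lambda>"
  shows "finite (basis \<kappa>)" "\<not> module.dependent sW (basis \<kappa>)" "module.span sW (basis \<kappa>) = W \<kappa>"
    and "b \<in> basis \<kappa> \<Longrightarrow> b \<in> W \<kappa>" and "b \<in> basis \<kappa> \<Longrightarrow> b \<noteq> 0"
proof -
  interpret W: vector_space sW by (rule irreducible_repD[OF W_irreducible[OF assms]])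
  obtain B where "finite B \<and> W.independent B \<and> W.span B = W \<kappa>"
    using irreducible_rep_basis[OF W_irreducible[OF assms] finite_GG] by metis
  then have *: "finite (basis \<kappa>) \<and> W.independent (basis \<kappa>) \<and> W.span (basis \<kappa>) = W \<kappa>"
    unfolding basis_def by (rule someI)
  then show "finite (basis \<kappa>)" "W.independent (basis \<kappa>)" "W.span (basis \<kappa>) = W \<kappa>" by auto
  show "b \<in> basis \<kappa> \<Longrightarrow> b \<in> W \<kappa>" using * W.span_base by blast
  show "b \<in> basis \<kappa> \<Longrightarrow> b \<noteq> 0" using * W.dependent_zero by blast
qed

text \<open>Up to a nonzero scalar, \<open>extract \<kappa> b u\<close> sends \<open>w \<otimes> f\<close> to \<open>b\<^sup>*(w) f(u)\<close>, \<open>b\<^sup>*\<close> being the dual basis.\<close>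

abbreviation "extract \<kappa> b u \<equiv> matrix_op (\<rho> \<kappa>) (\<lambda>w. module.representation sW (basis \<kappa>) w b) u"

lemma extract_other:
  assumes "\<kappa> \<in> \<Lambda>" "\<eta> \<in> \<Lambda>" "\<kappa> \<noteq> \<eta>" "u \<in> W \<kappa>" "w \<in> W \<eta>" "h \<in> H \<eta>"
  shows "extract \<kappa> b u (h w) = 0"
proof (rule matrix_op_other[OF W_rep[OF assms(1)]
      W_rep[OF assms(2)] _ _ assms(4-6)])
  show "linear_on sW (W \<kappa>) (*) (\<lambda>w. module.representation sW (basis \<kappa>) w b)"
    using linear_on_representation[OF irreducible_repD(3)[OF W_irreducible[OF assms(1)]]
        basis(2)[OF assms(1)], of b] unfolding basis(3)[OF assms(1)] .
qed (rule intertwiner_zero[OF assms(1-3)])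

lemma extract_same:
  assumes \<kappa>: "\<kappa> \<in> \<Lambda>"
    and "b \<in> basis \<kappa>" "b' \<in> basis \<kappa>" "u \<in> W \<kappa>" "f \<in> H \<kappa>"
  shows "extract \<kappa> b u (f b') = (if b = b' then s (schur_constant GG sW (W \<kappa>)) (f u) else 0)"
proof -
  note irr = W_irreducible[OF \<kappa>]
  interpret W: vector_space sW by (rule irreducible_repD[OF irr])
  have co: "linear_on sW (W \<kappa>) (*) (\<lambda>w. W.representation (basis \<kappa>) w b)" for b
    using linear_on_representation[OF W.vector_space_axioms basis(2)[OF \<kappa>], of b] unfolding basis(3)[OF \<kappa>] .
  show ?thesis
    using matrix_op_same[OF irr co] basis(4)[OF \<kappa>] assms
    by (simp add: W.representation_basis[OF basis(2)[OF \<kappa>]])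
qed

text \<open>Applying \<open>extract \<kappa> b u\<close> to the relation leaves only the Schur
  constant times \<open>f \<kappa> b u\<close>; the constant is nonzero and \<open>u\<close> is
  arbitrary in \<open>W \<kappa>\<close>.\<close>

lemma components_unique:
  assumes K: "finite K" "K \<subseteq> \<Lambda>" and f: "\<And>\<kappa> b. \<kappa> \<in> K \<Longrightarrow> b \<in> basis \<kappa> \<Longrightarrow> f \<kappa> b \<in> H \<kappa>"
    and zero: "(\<Sum>\<kappa>\<in>K. \<Sum>b\<in>basis \<kappa>. f \<kappa> b b) = 0" and \<kappa>: "\<kappa> \<in> K" and b: "b \<in> basis \<kappa>"
  shows "f \<kappa> b = 0"
proof -
  have \<kappa>L: "\<kappa> \<in> \<Lambda>" using K \<kappa> by blast
  have V: "f \<eta> b b \<in> V" if "\<eta> \<in> K" "b \<in> basis \<eta>" for \<eta> b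
    using f[OF that] basis(4)[of \<eta> b] that K(2) hom_spaceD(2) by blast
  define c where "c = schur_constant GG sW (W \<kappa>)"
  have c0: "c \<noteq> 0" unfolding c_def by (rule schur_orthogonality(1)[OF W_irreducible[OF \<kappa>L] finite_GG])
  have "f \<kappa> b u = 0" if u: "u \<in> W \<kappa>" for u
  proof -
    note lin = matrix_op_linear[of "\<rho> \<kappa>" "\<lambda>w. module.representation sW (basis \<kappa>) w b" u]
    have "0 = extract \<kappa> b u (\<Sum>\<eta>\<in>K. \<Sum>b\<in>basis \<eta>. f \<eta> b b)"
      using zero linear_on_zero_V[OF lin] by simp
    also have "\<dots> = (\<Sum>\<eta>\<in>K. \<Sum>b'\<in>basis \<eta>. extract \<kappa> b u (f \<eta> b' b'))"
    proof -
      have "extract \<kappa> b u (\<Sum>\<eta>\<in>K. \<Sum>b\<in>basis \<eta>. f \<eta> b b)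
          = (\<Sum>\<eta>\<in>K. extract \<kappa> b u (\<Sum>b\<in>basis \<eta>. f \<eta> b b))"
        by (rule linear_on_sum_V[OF lin])
          (rule subspace_sum[OF subspace_V], rule V)
      also have "\<dots> = (\<Sum>\<eta>\<in>K. \<Sum>b'\<in>basis \<eta>. extract \<kappa> b u (f \<eta> b' b'))"
        by (rule sum.cong[OF refl], rule linear_on_sum_V[OF lin], rule V)
      finally show ?thesis .
    qed
    also have "\<dots> = (\<Sum>b'\<in>basis \<kappa>. extract \<kappa> b u (f \<kappa> b' b'))"
    proof (rule trans[OF sum.remove[OF K(1) \<kappa>]])
      have "(\<Sum>\<eta>\<in>K - {\<kappa>}. \<Sum>b'\<in>basis \<eta>. extract \<kappa> b u (f \<eta> b' b')) = 0"
      proof (intro sum.neutral ballI)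
        fix \<eta> b' assume "\<eta> \<in> K - {\<kappa>}" "b' \<in> basis \<eta>"
        then show "extract \<kappa> b u (f \<eta> b' b') = 0"
          using K(2) by (intro extract_other[OF \<kappa>L _ _ u basis(4) f]) auto
      qed
      then show "(\<Sum>b'\<in>basis \<kappa>. extract \<kappa> b u (f \<kappa> b' b')) +
          (\<Sum>\<eta>\<in>K - {\<kappa>}. \<Sum>b'\<in>basis \<eta>. extract \<kappa> b u (f \<eta> b' b'))
          = (\<Sum>b'\<in>basis \<kappa>. extract \<kappa> b u (f \<kappa> b' b'))" by simp
    qed
    also have "\<dots> = (\<Sum>b'\<in>basis \<kappa>. if b = b' then s c (f \<kappa> b u) else 0)"
      unfolding c_def using extract_same[OF \<kappa>L b _ u f[OF \<kappa>]] by (intro sum.cong refl) auto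
    also have "\<dots> = s c (f \<kappa> b u)" using b basis(1)[OF \<kappa>L] by (simp add: sum.delta')
    finally show ?thesis using c0 by simp
  qed
  then show ?thesis using hom_spaceD(4)[OF f[OF \<kappa> b]] by (auto simp: fun_eq_iff)
qed

text \<open>The summands are the images of b \<otimes> V_\<kappa>, that is, the values f b for a
  fixed basis vector b. Evaluation at b transfers irreducibility from V_\<kappa>.\<close>

lemma completely_reducible: "completely_reducible_vertex_module s VG vac Y s V Y"
  unfolding completely_reducible_vertex_module_def
proof (intro conjI exI ballI)
  show "vertex_module s VG vac Y s V Y" by (rule vertex_module_VG)
  define N where "N \<kappa> b = (\<lambda>f. f b) ` H \<kappa>" for \<kappa> b
  define \<N> where "\<N> = {N \<kappa> b | \<kappa> b. \<kappa> \<in> \<Lambda> \<and> b \<in> basis \<kappa>}"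
  interpret F: vector_space "fun_scale s :: _ \<Rightarrow> ('w \<Rightarrow> 'v) \<Rightarrow> _" by (rule vector_space_hom)
  have N_sub: "vertex_submodule VG s V Y (N \<kappa> b)" if "\<kappa> \<in> \<Lambda>" "b \<in> basis \<kappa>" for \<kappa> b
    unfolding vertex_submodule_def
  proof (intro conjI ballI allI)
    have ev: "linear_on (fun_scale s) (H \<kappa>) s (\<lambda>f. f b)" by (simp add: linear_on_def fun_scale_def)
    show "subspace (N \<kappa> b)"
      unfolding N_def by (rule subspace_image[OF vector_space_hom vector_space_V hom_space_subspace ev])
    show "N \<kappa> b \<subseteq> V" using hom_spaceD(2)[OF _ basis(4)[OF that]] by (auto simp: N_def)
    fix v n x assume "v \<in> VG" "x \<in> N \<kappa> b"
    then obtain f where "f \<in> H \<kappa>" "x = f b" by (auto simp: N_def)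
    then show "Y v n x \<in> N \<kappa> b"
      using hom_modes_closed[OF \<open>v \<in> VG\<close> \<open>f \<in> H \<kappa>\<close>, of n] by (auto simp: N_def hom_modes_def intro: image_eqI[rotated])
  qed
  {
    fix X assume "X \<in> \<N>"
    then obtain \<kappa> b where X: "X = N \<kappa> b" and \<kappa>: "\<kappa> \<in> \<Lambda>" and b: "b \<in> basis \<kappa>" by (auto simp: \<N>_def)
    note irr = W_irreducible[OF \<kappa>]
    have bW: "b \<in> W \<kappa>" "b \<noteq> 0" using basis(4,5)[OF \<kappa> b] .
    show "vertex_submodule VG s V Y X" using N_sub \<kappa> b X by simp
    then have sub: "subspace X" "X \<subseteq> V" "\<And>v n x. v \<in> VG \<Longrightarrow> x \<in> X \<Longrightarrow> Y v n x \<in> X"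
      by (auto simp: vertex_submodule_def)
    show "irreducible_vertex_module s VG vac Y s X Y"
      unfolding irreducible_vertex_module_def
    proof (intro conjI allI impI)
      show "vertex_module s VG vac Y s X Y"
        by (rule vertex_module_transport[OF vertex_module_VG vector_space_V sub(1), of "\<lambda>x. x"])
          (use sub in \<open>auto simp: linear_on_def\<close>)
      obtain f where f: "f \<in> H \<kappa>" "f \<noteq> 0"
        using hom_space_nonzero[OF irr] F.subspace_0[OF hom_space_subspace] by blast
      then have "f b \<noteq> 0" using hom_space_eq_0[OF irr _ bW] by blast
      then show "X \<noteq> {0}" using f by (auto simp: X N_def)
      fix Z assume Z: "vertex_submodule VG s X Y Z"
      let ?Z = "{f \<in> H \<kappa>. f b \<in> Z}"
      have Zs: "subspace Z" "Z \<subseteq> X" "\<And>v n x. v \<in> VG \<Longrightarrow> x \<in> Z \<Longrightarrow> Y v n x \<in> Z"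
        using Z by (auto simp: vertex_submodule_def)
      have "vertex_submodule VG (fun_scale s) (H \<kappa>) (hom_modes Y) ?Z"
        unfolding vertex_submodule_def
      proof (intro conjI ballI allI)
        show "F.subspace ?Z"
          using hom_space_subspace[of sW "W \<kappa>" "\<rho> \<kappa>"] Zs(1) by (auto simp: F.subspace_def subspace_def fun_scale_def)
      qed (use hom_modes_closed Zs(3) in \<open>auto simp: hom_modes_def\<close>)
      then have "?Z = {0} \<or> ?Z = H \<kappa>"
        using hom_space_irreducible[OF irr] by (simp add: irreducible_vertex_module_def)
      moreover have "Z = (\<lambda>f. f b) ` ?Z" using Zs(2) by (auto simp: X N_def)
      ultimately have "Z = (\<lambda>f. f b) ` {0} \<or> Z = (\<lambda>f. f b) ` H \<kappa>" by (metis (no_types, lifting))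
      then show "Z = {0} \<or> Z = X" by (simp add: X N_def)
    qed

    show "X \<inter> span (\<Union> (\<N> - {X})) = {0}"
    proof -
      have "x = 0" if x: "x \<in> X" "x \<in> span (\<Union> (\<N> - {X}))" for x
      proof -
        obtain f where f: "f \<in> H \<kappa>" "x = f b" using x(1) by (auto simp: X N_def)
        have UV: "\<Union> (\<N> - {X}) \<subseteq> V"
          using N_sub by (auto simp: \<N>_def vertex_submodule_def)
        \<comment> \<open>This operator kills every other summand but multiplies \<open>f b\<close>
          by the nonzero Schur constant.\<close>
        have "extract \<kappa> b b x = 0"
        proof (rule linear_on_eq_on_span[OF vector_space_V vector_space_V UV subspace_V matrix_op_linear _ _ x(2)])
          fix y assume "y \<in> \<Union> (\<N> - {X})"
          then obtain \<eta> d where d: "\<eta> \<in> \<Lambda>" "d \<in> basis \<eta>" "N \<eta> d \<noteq> X" "y \<in> N \<eta> d" by (auto simp: \<N>_def)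
          then obtain h where h: "h \<in> H \<eta>" "y = h d" by (auto simp: N_def)
          show "extract \<kappa> b b y = 0"
          proof (cases "\<kappa> = \<eta>")
            case True
            then have "b \<noteq> d" using d(3) X by blast
            then show ?thesis using extract_same[OF \<kappa> b, of d b h] d(2) h True bW by simp
          next
            case False
            then show ?thesis using extract_other[OF \<kappa> d(1) False bW(1) basis(4)[OF d(1,2)] h(1)] h(2) by simp
          qed
        qed (simp add: linear_on_def)
        then show ?thesis
          using extract_same[OF \<kappa> b b bW(1) f(1)] schur_orthogonality(1)[OF irr finite_GG] f(2) by simp
      qed
      moreover have "0 \<in> X" by (rule subspace_0[OF sub(1)])
      ultimately show ?thesis using span_zero by blast
    qed
  }
  show "span (\<Union> \<N>) = V"
  proof
    show "span (\<Union> \<N>) \<subseteq> V"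
      by (rule span_minimal[OF _ subspace_V]) (use N_sub in \<open>auto simp: \<N>_def vertex_submodule_def\<close>)
    have "{f w | \<kappa> f w. \<kappa> \<in> \<Lambda> \<and> f \<in> H \<kappa> \<and> w \<in> W \<kappa>} \<subseteq> span (\<Union> \<N>)"
    proof safe
      fix \<kappa> f w assume \<kappa>: "\<kappa> \<in> \<Lambda>" and f: "f \<in> H \<kappa>" and w: "w \<in> W \<kappa>"
      note irr = W_irreducible[OF \<kappa>]
      have "f w \<in> span (f ` basis \<kappa>)"
        using linear_on_image_span[OF irreducible_repD(3)[OF irr] vector_space_V
            irreducible_repD(4)[OF irr] hom_spaceD(1)[OF f], of "basis \<kappa>" w]
          basis(3,4)[OF \<kappa>] w by blast
      moreover have "f ` basis \<kappa> \<subseteq> \<Union> \<N>" using f \<kappa> by (auto simp: \<N>_def N_def)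
      ultimately show "f w \<in> span (\<Union> \<N>)" using span_mono by blast
    qed
    then show "V \<subseteq> span (\<Union> \<N>)"
      using hom_values_span span_minimal[OF _ subspace_span] by blast
  qed
qed

end

section \<open>The identification of the direct sum of tensor products with V\<close>

context dual_pair
begin

definition D where
  "D = direct_sum \<Lambda> Tens"

text \<open>Existence is the universal property \<open>tensor_universal\<close>; the values outside
  \<open>Tens \<kappa>\<close> are left open.\<close>

definition evaluation where
  "evaluation \<kappa> = (SOME L. linear_on (fun_scale (*)) (Tens \<kappa>) s L \<and>
     (\<forall>w\<in>W \<kappa>. \<forall>f\<in>H \<kappa>. L (pure \<kappa> w f) = f w))"

definition \<Phi> where
  "\<Phi> t = (\<Sum>\<kappa> | t \<kappa> \<noteq> 0. evaluation \<kappa> (t \<kappa>))"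

abbreviation "sT \<equiv> (fun_scale (*) :: complex \<Rightarrow> (('w \<Rightarrow> ('w \<Rightarrow> 'v) \<Rightarrow> complex) \<Rightarrow> complex) \<Rightarrow> _)"
abbreviation "sD \<equiv> (fun_scale sT :: complex \<Rightarrow> ((('v \<Rightarrow> 'v) \<Rightarrow> complex) \<Rightarrow> _) \<Rightarrow> _)"

lemma vector_space_sT: "vector_space sT"
  by (rule vector_space_fun_scale) (rule vector_space_times)

lemma vector_space_sD: "vector_space sD"
  by (rule vector_space_fun_scale) (rule vector_space_sT)

lemma evaluation:
  shows "linear_on sT (Tens \<kappa>) s (evaluation \<kappa>)"
    and "w \<in> W \<kappa> \<Longrightarrow> f \<in> H \<kappa> \<Longrightarrow> evaluation \<kappa> (pure \<kappa> w f) = f w"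
proof -
  have "\<exists>L. linear_on sT (Tens \<kappa>) s L \<and> (\<forall>w\<in>W \<kappa>. \<forall>f\<in>H \<kappa>. L (pure \<kappa> w f) = f w)"
    by (rule tensor_universal[OF vector_space_V, of "H \<kappa>" sW "W \<kappa>" "\<lambda>w f. f w"])
      (rule hom_spaceD(1), assumption, simp add: linear_on_def fun_scale_def)
  from someI_ex[OF this] show "linear_on sT (Tens \<kappa>) s (evaluation \<kappa>)"
    "w \<in> W \<kappa> \<Longrightarrow> f \<in> H \<kappa> \<Longrightarrow> evaluation \<kappa> (pure \<kappa> w f) = f w"
    unfolding evaluation_def by blast+
qed

lemma Tens_subspace: "module.subspace sT (Tens \<kappa>)"
proof -
  interpret T: vector_space sT by (rule vector_space_sT)
  show ?thesis unfolding tensor_def by (rule T.subspace_span)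
qed

lemma pure_in_Tens: "w \<in> W \<kappa> \<Longrightarrow> f \<in> H \<kappa> \<Longrightarrow> pure \<kappa> w f \<in> Tens \<kappa>"
proof -
  interpret T: vector_space sT by (rule vector_space_sT)
  show "w \<in> W \<kappa> \<Longrightarrow> f \<in> H \<kappa> \<Longrightarrow> pure \<kappa> w f \<in> Tens \<kappa>"
    unfolding tensor_def by (rule T.span_base) blast
qed

lemma Tens_expansion:
  assumes \<kappa>: "\<kappa> \<in> \<Lambda>" and t: "t \<in> Tens \<kappa>"
  shows "\<exists>y. (\<forall>b\<in>basis \<kappa>. y b \<in> H \<kappa>) \<and> t = (\<Sum>b\<in>basis \<kappa>. pure \<kappa> b (y b))"
  by (rule tensor_expansion[OF irreducible_repD(3)[OF W_irreducible[OF \<kappa>]] basis(1-3)[OF \<kappa>]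
      vector_space_hom hom_space_subspace t])

lemma evaluation_sum:
  assumes \<kappa>: "\<kappa> \<in> \<Lambda>" and x: "\<And>b. b \<in> I \<Longrightarrow> x b \<in> W \<kappa>" and y: "\<And>b. b \<in> I \<Longrightarrow> y b \<in> H \<kappa>"
  shows "evaluation \<kappa> (\<Sum>b\<in>I. pure \<kappa> (x b) (y b)) = (\<Sum>b\<in>I. y b (x b))"
proof -
  have "evaluation \<kappa> (\<Sum>b\<in>I. pure \<kappa> (x b) (y b)) = (\<Sum>b\<in>I. evaluation \<kappa> (pure \<kappa> (x b) (y b)))"
    by (rule linear_on_sum[OF vector_space_sT vector_space_V Tens_subspace evaluation(1)])
      (rule pure_in_Tens[OF x y])
  also have "\<dots> = (\<Sum>b\<in>I. y b (x b))"
    by (intro sum.cong refl evaluation(2) x y)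
  finally show ?thesis .
qed

lemma evaluation_zero: "evaluation \<kappa> 0 = 0"
  by (rule linear_on_zero[OF vector_space_sT vector_space_V Tens_subspace evaluation(1)])

lemma evaluation_closed: "\<kappa> \<in> \<Lambda> \<Longrightarrow> t \<in> Tens \<kappa> \<Longrightarrow> evaluation \<kappa> t \<in> V"
proof -
  assume \<kappa>: "\<kappa> \<in> \<Lambda>" and t: "t \<in> Tens \<kappa>"
  obtain y where y: "\<And>b. b \<in> basis \<kappa> \<Longrightarrow> y b \<in> H \<kappa>" "t = (\<Sum>b\<in>basis \<kappa>. pure \<kappa> b (y b))"
    using Tens_expansion[OF \<kappa> t] by blast
  have "evaluation \<kappa> t = (\<Sum>b\<in>basis \<kappa>. y b b)"
    unfolding y(2) by (rule evaluation_sum[OF \<kappa> basis(4)[OF \<kappa>] y(1)])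
  also have "\<dots> \<in> V"
    by (intro subspace_sum[OF subspace_V] hom_spaceD(2)[OF y(1) basis(4)[OF \<kappa>]])
  finally show ?thesis .
qed

abbreviation "supp t \<equiv> {\<kappa>. t \<kappa> \<noteq> 0}"

lemma D_D:
  assumes "t \<in> D"
  shows "\<kappa> \<in> \<Lambda> \<Longrightarrow> t \<kappa> \<in> Tens \<kappa>" "\<kappa> \<notin> \<Lambda> \<Longrightarrow> t \<kappa> = 0" "finite (supp t)" "t \<kappa> \<noteq> 0 \<Longrightarrow> \<kappa> \<in> \<Lambda>"
  using assms by (auto simp: D_def direct_sum_def)

lemma D_subspace: "module.subspace sD D"
proof -
  interpret T: vector_space sT by (rule vector_space_sT)
  interpret S: vector_space sD by (rule vector_space_sD)
  show ?thesis
  proof (rule S.subspaceI)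
    show "0 \<in> D" using T.subspace_0[OF Tens_subspace] by (simp add: D_def direct_sum_def)
  next
    fix t u assume tu: "t \<in> D" "u \<in> D"
    have "finite (supp (t + u))"
      by (rule finite_subset[OF _ finite_UnI[OF D_D(3)[OF tu(1)] D_D(3)[OF tu(2)]]]) auto
    then show "t + u \<in> D"
      using tu T.subspace_add[OF Tens_subspace] by (simp add: D_def direct_sum_def)
  next
    fix c t assume t: "t \<in> D"
    have "finite (supp (sD c t))"
      by (rule finite_subset[OF _ D_D(3)[OF t]]) (auto simp: fun_scale_def)
    then show "sD c t \<in> D"
      using t T.subspace_scale[OF Tens_subspace] by (simp add: D_def direct_sum_def fun_scale_def[of sT])
  qed
qed

lemma \<Phi>_superset: "finite K \<Longrightarrow> supp t \<subseteq> K \<Longrightarrow> \<Phi> t = (\<Sum>\<kappa>\<in>K. evaluation \<kappa> (t \<kappa>))"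
  unfolding \<Phi>_def by (rule sum.mono_neutral_left) (auto simp: evaluation_zero)

lemma \<Phi>_linear: "linear_on sD D s \<Phi>"
  unfolding linear_on_def
proof (intro conjI ballI allI)
  fix t u assume tu: "t \<in> D" "u \<in> D"
  let ?K = "supp t \<union> supp u"
  have K: "finite ?K" using D_D(3) tu by blast
  have "\<Phi> (t + u) = (\<Sum>\<kappa>\<in>?K. evaluation \<kappa> ((t + u) \<kappa>))" by (rule \<Phi>_superset[OF K]) auto
  also have "\<dots> = (\<Sum>\<kappa>\<in>?K. evaluation \<kappa> (t \<kappa>) + evaluation \<kappa> (u \<kappa>))"
  proof (rule sum.cong[OF refl])
    fix \<kappa> assume "\<kappa> \<in> ?K"
    then have "\<kappa> \<in> \<Lambda>" using D_D(4) tu by blast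
    then show "evaluation \<kappa> ((t + u) \<kappa>) = evaluation \<kappa> (t \<kappa>) + evaluation \<kappa> (u \<kappa>)"
      using linear_on_add[OF evaluation(1)] D_D(1) tu by simp
  qed
  also have "\<dots> = \<Phi> t + \<Phi> u"
    by (subst (1 2) \<Phi>_superset[OF K]) (auto simp: sum.distrib)
  finally show "\<Phi> (t + u) = \<Phi> t + \<Phi> u" .
next
  fix c t assume t: "t \<in> D"
  let ?K = "supp t"
  have "\<Phi> (sD c t) = (\<Sum>\<kappa>\<in>?K. evaluation \<kappa> (sT c (t \<kappa>)))"
    by (subst \<Phi>_superset[OF D_D(3)[OF t]]) (auto simp: fun_scale_def)
  also have "\<dots> = (\<Sum>\<kappa>\<in>?K. s c (evaluation \<kappa> (t \<kappa>)))"
    using D_D(1,4)[OF t] by (intro sum.cong refl linear_on_scale[OF evaluation(1)]) blast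
  finally show "\<Phi> (sD c t) = s c (\<Phi> t)" by (simp add: \<Phi>_def scale_sum_right)
qed

lemma \<Phi>_closed: "t \<in> D \<Longrightarrow> \<Phi> t \<in> V"
  unfolding \<Phi>_def using D_D(1,4) by (intro subspace_sum[OF subspace_V] evaluation_closed) blast+

text \<open>Tensor expansions turn \<Phi> t = 0 into a vanishing sum of values y b, and
  \<open>components_unique\<close> makes every y zero.\<close>

lemma \<Phi>_injective: "inj_on \<Phi> D"
proof (rule inj_onI)
  interpret S: vector_space sD by (rule vector_space_sD)
  fix t' t'' assume t: "t' \<in> D" "t'' \<in> D" "\<Phi> t' = \<Phi> t''"
  define t where "t = t' - t''"
  have tD: "t \<in> D" unfolding t_def by (rule S.subspace_diff[OF D_subspace t(1,2)])
  have "\<Phi> t = 0"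
    using linear_on_diff[OF vector_space_sD vector_space_V D_subspace \<Phi>_linear t(1,2)] t(3) by (simp add: t_def)
  let ?K = "supp t"
  have "\<forall>\<kappa>\<in>?K. \<exists>y. (\<forall>b\<in>basis \<kappa>. y b \<in> H \<kappa>) \<and> t \<kappa> = (\<Sum>b\<in>basis \<kappa>. pure \<kappa> b (y b))"
  proof
    fix \<kappa> assume "\<kappa> \<in> ?K"
    then have \<kappa>: "\<kappa> \<in> \<Lambda>" using D_D(4)[OF tD] by simp
    show "\<exists>y. (\<forall>b\<in>basis \<kappa>. y b \<in> H \<kappa>) \<and> t \<kappa> = (\<Sum>b\<in>basis \<kappa>. pure \<kappa> b (y b))"
      by (rule Tens_expansion[OF \<kappa> D_D(1)[OF tD \<kappa>]])
  qed
  from bchoice[OF this] obtain y where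
    *: "\<forall>\<kappa>\<in>?K. (\<forall>b\<in>basis \<kappa>. y \<kappa> b \<in> H \<kappa>) \<and> t \<kappa> = (\<Sum>b\<in>basis \<kappa>. pure \<kappa> b (y \<kappa> b))" ..
  have y: "y \<kappa> b \<in> H \<kappa>" if "\<kappa> \<in> ?K" "b \<in> basis \<kappa>" for \<kappa> b
    by (rule bspec[OF conjunct1[OF bspec[OF * that(1)]] that(2)])
  have t_eq: "t \<kappa> = (\<Sum>b\<in>basis \<kappa>. pure \<kappa> b (y \<kappa> b))" if "\<kappa> \<in> ?K" for \<kappa>
    by (rule conjunct2[OF bspec[OF * that]])
  have KL: "?K \<subseteq> \<Lambda>" using D_D(4)[OF tD] by blast
  have "evaluation \<kappa> (t \<kappa>) = (\<Sum>b\<in>basis \<kappa>. y \<kappa> b b)" if \<kappa>: "\<kappa> \<in> ?K" for \<kappa>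
  proof -
    have \<kappa>L: "\<kappa> \<in> \<Lambda>" using KL \<kappa> by blast
    show ?thesis
      unfolding t_eq[OF \<kappa>] by (rule evaluation_sum[OF \<kappa>L basis(4)[OF \<kappa>L] y[OF \<kappa>]])
  qed
  then have zero: "(\<Sum>\<kappa>\<in>?K. \<Sum>b\<in>basis \<kappa>. y \<kappa> b b) = 0"
    using \<open>\<Phi> t = 0\<close> by (simp add: \<Phi>_def)
  have y0: "y \<kappa> b = 0" if "\<kappa> \<in> ?K" "b \<in> basis \<kappa>" for \<kappa> b
    by (rule components_unique[OF D_D(3)[OF tD] KL y zero that])
  have "t \<kappa> = 0" for \<kappa>
  proof (rule ccontr)
    assume \<kappa>: "t \<kappa> \<noteq> 0"
    have "pure \<kappa> b 0 = 0" if "b \<in> W \<kappa>" for b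
      by (rule linear_on_zero[OF vector_space_hom vector_space_sT hom_space_subspace pure_tensor_bilinear(2)[OF that]])
    then have "(\<Sum>b\<in>basis \<kappa>. pure \<kappa> b (y \<kappa> b)) = 0"
      using y0 basis(4) KL \<kappa> by (intro sum.neutral) auto
    then show False using t_eq[of \<kappa>] \<kappa> by simp
  qed
  then have "t = 0" by (simp add: fun_eq_iff)
  then show "t' = t''" unfolding t_def by (rule eq_iff_diff_eq_0[THEN iffD2])
qed

lemma \<Phi>_summand:
  assumes "\<kappa> \<in> \<Lambda>" "t \<in> Tens \<kappa>"
  shows "summand \<kappa> t \<in> D" "\<Phi> (summand \<kappa> t) = evaluation \<kappa> t"
proof -
  interpret T: vector_space sT by (rule vector_space_sT)
  have sub: "{\<eta>. summand \<kappa> t \<eta> \<noteq> 0} \<subseteq> {\<kappa>}" by (auto simp: summand_def)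
  show "summand \<kappa> t \<in> D"
    using assms T.subspace_0[OF Tens_subspace] finite_subset[OF sub]
    by (auto simp: D_def direct_sum_def summand_def)
  show "\<Phi> (summand \<kappa> t) = evaluation \<kappa> t"
    using \<Phi>_superset[OF _ sub] by (simp add: summand_def)
qed

lemma \<Phi>_bij: "bij_betw \<Phi> D V"
proof -
  have "subspace (\<Phi> ` D)"
    by (rule subspace_image[OF vector_space_sD vector_space_V D_subspace \<Phi>_linear])
  moreover have "{f w | \<kappa> f w. \<kappa> \<in> \<Lambda> \<and> f \<in> H \<kappa> \<and> w \<in> W \<kappa>} \<subseteq> \<Phi> ` D"
  proof safe
    fix \<kappa> f w assume *: "\<kappa> \<in> \<Lambda>" "f \<in> H \<kappa>" "w \<in> W \<kappa>"
    then have "f w = \<Phi> (summand \<kappa> (pure \<kappa> w f))"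
      using \<Phi>_summand(2)[OF _ pure_in_Tens] evaluation(2) by simp
    then show "f w \<in> \<Phi> ` D" using \<Phi>_summand(1)[OF _ pure_in_Tens] * by blast
  qed
  ultimately have "V \<subseteq> \<Phi> ` D" using hom_values_span span_minimal by blast
  then show ?thesis using \<Phi>_injective \<Phi>_closed by (auto simp: bij_betw_def)
qed

text \<open>One statement for both actions: the group acts through \<open>A\<close> with
  \<open>B\<close> the identity, the fixed-point algebra through \<open>B\<close> with
  \<open>A\<close> the identity.\<close>

lemma \<Phi>_endo:
  assumes P: "linear_on s V s P"
    and A: "\<And>\<kappa>. \<kappa> \<in> \<Lambda> \<Longrightarrow> linear_on sW (W \<kappa>) sW (A \<kappa>)" "\<And>\<kappa> w. \<kappa> \<in> \<Lambda> \<Longrightarrow> w \<in> W \<kappa> \<Longrightarrow> A \<kappa> w \<in> W \<kappa>"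
    and B: "\<And>\<kappa>. \<kappa> \<in> \<Lambda> \<Longrightarrow> linear_on (fun_scale s) (H \<kappa>) (fun_scale s) B"
      "\<And>\<kappa> f. \<kappa> \<in> \<Lambda> \<Longrightarrow> f \<in> H \<kappa> \<Longrightarrow> B f \<in> H \<kappa>"
    and AB: "\<And>\<kappa> w f. \<kappa> \<in> \<Lambda> \<Longrightarrow> w \<in> W \<kappa> \<Longrightarrow> f \<in> H \<kappa> \<Longrightarrow> B f (A \<kappa> w) = P (f w)"
    and t: "t \<in> D"
  defines "t' \<equiv> \<lambda>\<kappa>. tensor_endo sW (W \<kappa>) (fun_scale s) (H \<kappa>) (A \<kappa>) B (t \<kappa>)"
  shows "t' \<in> D" "\<Phi> t' = P (\<Phi> t)"
proof -
  interpret T: vector_space sT by (rule vector_space_sT)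
  have *: "t' \<kappa> \<in> Tens \<kappa> \<and> evaluation \<kappa> (t' \<kappa>) = P (evaluation \<kappa> (t \<kappa>))" if \<kappa>: "\<kappa> \<in> \<Lambda>" for \<kappa>
  proof -
    obtain y where y: "\<And>b. b \<in> basis \<kappa> \<Longrightarrow> y b \<in> H \<kappa>" "t \<kappa> = (\<Sum>b\<in>basis \<kappa>. pure \<kappa> b (y b))"
      using Tens_expansion[OF \<kappa> D_D(1)[OF t \<kappa>]] by blast
    have t': "t' \<kappa> = (\<Sum>b\<in>basis \<kappa>. pure \<kappa> (A \<kappa> b) (B (y b)))"
      unfolding t'_def y(2) tensor_endo_sum
      by (intro sum.cong refl tensor_endo_pure A[OF \<kappa>] B[OF \<kappa>])
    have "evaluation \<kappa> (t' \<kappa>) = (\<Sum>b\<in>basis \<kappa>. B (y b) (A \<kappa> b))"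
      unfolding t' by (rule evaluation_sum[OF \<kappa> A(2)[OF \<kappa> basis(4)[OF \<kappa>]] B(2)[OF \<kappa> y(1)]])
    also have "\<dots> = (\<Sum>b\<in>basis \<kappa>. P (y b b))"
      by (intro sum.cong refl AB[OF \<kappa> basis(4)[OF \<kappa>] y(1)])
    also have "\<dots> = P (\<Sum>b\<in>basis \<kappa>. y b b)"
      by (rule linear_on_sum_V[OF P, symmetric])
        (rule hom_spaceD(2)[OF y(1) basis(4)[OF \<kappa>]])
    also have "(\<Sum>b\<in>basis \<kappa>. y b b) = evaluation \<kappa> (t \<kappa>)"
      unfolding y(2) by (rule evaluation_sum[OF \<kappa> basis(4)[OF \<kappa>] y(1), symmetric])
    finally have "evaluation \<kappa> (t' \<kappa>) = P (evaluation \<kappa> (t \<kappa>))" .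
    moreover have "t' \<kappa> \<in> Tens \<kappa>"
      unfolding t'
      by (intro T.subspace_sum[OF Tens_subspace] pure_in_Tens A(2)[OF \<kappa> basis(4)[OF \<kappa>]] B(2)[OF \<kappa> y(1)])
    ultimately show ?thesis by blast
  qed
  \<comment> \<open>\<open>tensor_endo\<close> sends 0 to 0, so the support stays finite and inside
    the index set.\<close>
  have supp: "supp t' \<subseteq> supp t"
    by (auto simp: t'_def tensor_endo_zero)
  show "t' \<in> D"
    using * finite_subset[OF supp D_D(3)[OF t]] D_D(2)[OF t]
    by (simp add: D_def direct_sum_def) (simp add: t'_def tensor_endo_zero)
  have "\<Phi> t' = (\<Sum>\<kappa> | t \<kappa> \<noteq> 0. evaluation \<kappa> (t' \<kappa>))" by (rule \<Phi>_superset[OF D_D(3)[OF t] supp])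
  also have "\<dots> = (\<Sum>\<kappa> | t \<kappa> \<noteq> 0. P (evaluation \<kappa> (t \<kappa>)))"
    using * D_D(4)[OF t] by (intro sum.cong) auto
  also have "\<dots> = P (\<Phi> t)"
    unfolding \<Phi>_def using D_D(1,4)[OF t]
    by (intro linear_on_sum_V[OF P, symmetric] evaluation_closed) auto
  finally show "\<Phi> t' = P (\<Phi> t)" .
qed

text \<open>Restricted to \<open>D\<close> because group actions are by extensional
  bijections.\<close>

definition \<rho>D where
  "\<rho>D g = (\<lambda>t\<in>D. \<lambda>\<kappa>. tensor_endo sW (W \<kappa>) (fun_scale s) (H \<kappa>) (\<rho> \<kappa> g) (\<lambda>f. f) (t \<kappa>))"

definition YD where
  "YD v n t = (\<lambda>\<kappa>. tensor_endo sW (W \<kappa>) (fun_scale s) (H \<kappa>) (\<lambda>w. w) (hom_modes Y v n) (t \<kappa>))"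

lemma \<rho>D:
  assumes g: "g \<in> G" and t: "t \<in> D"
  shows "\<rho>D g t \<in> D" "\<Phi> (\<rho>D g t) = g (\<Phi> t)"
proof -
  have rep: "linear_on sW (W \<kappa>) sW (\<rho> \<kappa> g)" "\<And>w. w \<in> W \<kappa> \<Longrightarrow> \<rho> \<kappa> g w \<in> W \<kappa>" if \<kappa>: "\<kappa> \<in> \<Lambda>" for \<kappa>
  proof -
    interpret W: group_representation GG sW "W \<kappa>" "\<rho> \<kappa>" by (rule W_rep[OF \<kappa>])
    show "linear_on sW (W \<kappa>) sW (\<rho> \<kappa> g)" "\<And>w. w \<in> W \<kappa> \<Longrightarrow> \<rho> \<kappa> g w \<in> W \<kappa>"
      using W.linear_rep W.rep_closed g by simp_all
  qed
  note * = \<Phi>_endo[of g "\<lambda>\<kappa>. \<rho> \<kappa> g" "\<lambda>f. f" t, OF automorphismD(2)[OF G_automorphism[OF g]] rep _ _ _ t]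
  have "(\<lambda>\<kappa>. tensor_endo sW (W \<kappa>) (fun_scale s) (H \<kappa>) (\<rho> \<kappa> g) (\<lambda>f. f) (t \<kappa>)) = \<rho>D g t"
    using t by (simp add: \<rho>D_def)
  then show "\<rho>D g t \<in> D" "\<Phi> (\<rho>D g t) = g (\<Phi> t)"
    using * by (simp_all add: linear_on_def hom_spaceD(3)[OF _ g])
qed

lemma YD:
  assumes v: "v \<in> VG" and t: "t \<in> D"
  shows "YD v n t \<in> D" "\<Phi> (YD v n t) = Y v n (\<Phi> t)"
proof -
  have lin: "linear_on (fun_scale s) (H \<kappa>) (fun_scale s) (hom_modes Y v n)" for \<kappa>
  proof -
    note Yl = Y_linear_right[OF VG_D(1)[OF v], of n]
    have "f w \<in> V" if "f \<in> H \<kappa>" for f w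
      using hom_spaceD(2,4)[OF that, of w] subspace_0[OF subspace_V] by (cases "w \<in> W \<kappa>") auto
    then show ?thesis
      by (simp add: linear_on_def hom_modes_def fun_scale_def fun_eq_iff linear_on_add[OF Yl] linear_on_scale[OF Yl])
  qed
  have "linear_on sW (W \<kappa>) sW (\<lambda>w. w)" for \<kappa> by (simp add: linear_on_def)
  note * = \<Phi>_endo[of "Y v n" "\<lambda>\<kappa> w. w" "hom_modes Y v n" t, OF Y_linear_right[OF VG_D(1)[OF v]] this _ lin
      hom_modes_closed[OF v] _ t]
  show "YD v n t \<in> D" "\<Phi> (YD v n t) = Y v n (\<Phi> t)"
    using * by (simp_all add: YD_def hom_modes_def)
qed

lemma group_vertex_module_V: "group_vertex_module GG s VG vac Y s V (\<lambda>g. g) Y"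
proof -
  have "g (Y v n w) = Y v n (g w)" if "g \<in> G" "v \<in> VG" "w \<in> V" for g v n w
    using G_mode[OF that(1) VG_D(1)[OF that(2)] that(3)] VG_D(2)[OF that(2,1)] by simp
  then show ?thesis
    using V.rep_axioms vertex_module_VG by (simp add: group_vertex_module_def)
qed

lemma group_vertex_module_D: "group_vertex_module GG s VG vac Y sD D \<rho>D YD"
  unfolding group_vertex_module_def
proof (intro conjI ballI allI)
  show "group_representation GG sD D \<rho>D"
    by (rule group_representation_transport[OF V.rep_axioms vector_space_sD D_subspace \<Phi>_linear _ \<Phi>_injective])
      (use \<Phi>_closed \<rho>D in \<open>auto simp: \<rho>D_def\<close>)
  show "vertex_module s VG vac Y sD D YD"
    by (rule vertex_module_transport[OF vertex_module_VG vector_space_sD D_subspace \<Phi>_linear _ \<Phi>_injective])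
      (use \<Phi>_closed YD in auto)
  fix g v n t assume g: "g \<in> carrier GG" and v: "v \<in> VG" and t: "t \<in> D"
  have "\<Phi> (\<rho>D g (YD v n t)) = \<Phi> (YD v n (\<rho>D g t))"
    using g v t \<rho>D YD \<Phi>_closed group_vertex_module_V by (simp add: group_vertex_module_def)
  then show "\<rho>D g (YD v n t) = YD v n (\<rho>D g t)"
    using \<Phi>_injective g v t \<rho>D YD by (simp add: inj_on_def)
qed

end

theorem theorem5p5:
  fixes s :: "complex \<Rightarrow> 'v::ab_group_add \<Rightarrow> 'v" and V :: "'v set" and vac :: 'v
    and Y :: "'v \<Rightarrow> int \<Rightarrow> 'v \<Rightarrow> 'v" and G :: "('v \<Rightarrow> 'v) set" and GG :: "('v \<Rightarrow> 'v) monoid"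
    and \<Lambda> :: "(('v \<Rightarrow> 'v) \<Rightarrow> complex) set"
    and sW :: "complex \<Rightarrow> 'w::ab_group_add \<Rightarrow> 'w"
    and W :: "(('v \<Rightarrow> 'v) \<Rightarrow> complex) \<Rightarrow> 'w set"
    and \<rho> :: "(('v \<Rightarrow> 'v) \<Rightarrow> complex) \<Rightarrow> ('v \<Rightarrow> 'v) \<Rightarrow> 'w \<Rightarrow> 'w"
    and VG :: "'v set"
    and H :: "(('v \<Rightarrow> 'v) \<Rightarrow> complex) \<Rightarrow> ('w \<Rightarrow> 'v) set"
    and D :: "((('v \<Rightarrow> 'v) \<Rightarrow> complex) \<Rightarrow> ('w \<Rightarrow> ('w \<Rightarrow> 'v) \<Rightarrow> complex) \<Rightarrow> complex) set"
    and sH :: "complex \<Rightarrow> ('w \<Rightarrow> 'v) \<Rightarrow> ('w \<Rightarrow> 'v)" and sD \<rho>D YD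
  assumes simple: "simple_vertex_algebra s V vac Y"
    and dim: "countable_dimension s V"
    and fin: "finite_automorphism_group s V vac Y G"
    and GG_def: "GG = (BijGroup V)\<lparr>carrier := G\<rparr>"
    and \<Lambda>_def: "\<Lambda> = irreducible_characters GG"
    and W_irred: "\<And>\<kappa>. \<kappa> \<in> \<Lambda> \<Longrightarrow> irreducible_representation GG sW (W \<kappa>) (\<rho> \<kappa>)"
    and W_char: "\<And>\<kappa>. \<kappa> \<in> \<Lambda> \<Longrightarrow> rep_character GG sW (W \<kappa>) (\<rho> \<kappa>) = \<kappa>"
    and VG_def: "VG = fixed_points V G"
    and H_def: "\<And>\<kappa>. H \<kappa> = rep_hom GG sW (W \<kappa>) (\<rho> \<kappa>) s V (\<lambda>g. g)"
    and sH_def: "sH = fun_scale s"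
    and D_def: "D = direct_sum \<Lambda> (\<lambda>\<kappa>. tensor sW (W \<kappa>) sH (H \<kappa>))"
    and sD_def: "sD = fun_scale (fun_scale (*))"
    and \<rho>D_def: "\<And>g. \<rho>D g =
          (\<lambda>t\<in>D. \<lambda>\<kappa>. tensor_endo sW (W \<kappa>) sH (H \<kappa>) (\<rho> \<kappa> g) (\<lambda>f. f) (t \<kappa>))"
    and YD_def: "\<And>v n t. YD v n t =
          (\<lambda>\<kappa>. tensor_endo sW (W \<kappa>) sH (H \<kappa>) (\<lambda>w. w) (hom_modes Y v n) (t \<kappa>))"
  shows "group_vertex_module GG s VG vac Y s V (\<lambda>g. g) Y \<and>
         group_vertex_module GG s VG vac Y sD D \<rho>D YD \<and>
         (\<exists>\<Phi>. linear_on sD D s \<Phi> \<and> bij_betw \<Phi> D V \<and>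
            (\<forall>\<kappa>\<in>\<Lambda>. \<forall>w\<in>W \<kappa>. \<forall>f\<in>H \<kappa>.
               \<Phi> (summand \<kappa> (pure_tensor sW (W \<kappa>) sH (H \<kappa>) w f)) = f w) \<and>
            (\<forall>g\<in>G. \<forall>t\<in>D. \<Phi> (\<rho>D g t) = g (\<Phi> t)) \<and>
            (\<forall>v\<in>VG. \<forall>n. \<forall>t\<in>D. \<Phi> (YD v n t) = Y v n (\<Phi> t))) \<and>
         (\<forall>\<kappa>\<in>\<Lambda>. H \<kappa> \<noteq> {0}) \<and>
         (\<forall>\<kappa>\<in>\<Lambda>. irreducible_vertex_module s VG vac Y sH (H \<kappa>) (hom_modes Y)) \<and>
         (\<forall>\<kappa>\<in>\<Lambda>. \<forall>\<eta>\<in>\<Lambda>.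
            isomorphic_vertex_modules VG sH (H \<kappa>) (hom_modes Y) sH (H \<eta>) (hom_modes Y)
              \<longleftrightarrow> \<kappa> = \<eta>) \<and>
         completely_reducible_vertex_module s VG vac Y s V Y"
proof -
  have "vertex_algebra s V vac Y" using simple by (simp add: simple_vertex_algebra_def)
  then interpret P: dual_pair s V vac Y G sW W \<rho>
    by (intro dual_pair.intro finite_group_on_vertex_algebra.intro countable_simple_vertex_algebra.intro
        countable_simple_vertex_algebra_axioms.intro finite_group_on_vertex_algebra_axioms.intro
        dual_pair_axioms.intro simple dim fin)
      (use W_irred W_char in \<open>simp_all add: \<Lambda>_def GG_def\<close>)
  \<comment> \<open>The objects named in the statement coincide with the constants of the locale, so
    its results transfer directly.\<close>
  have H: "H = P.H" using H_def by (simp add: fun_eq_iff GG_def)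
  have D: "D = P.D" unfolding D_def P.D_def H sH_def \<Lambda>_def GG_def ..
  have \<rho>D: "\<rho>D = P.\<rho>D" unfolding fun_eq_iff \<rho>D_def P.\<rho>D_def D H sH_def by simp
  have YD: "YD = P.YD" unfolding fun_eq_iff YD_def P.YD_def H sH_def by simp
  show ?thesis
    unfolding sD_def D \<rho>D YD H sH_def VG_def
  proof (intro conjI exI[of _ P.\<Phi>] ballI allI)
    show "group_vertex_module GG s (fixed_points V G) vac Y s V (\<lambda>g. g) Y"
      unfolding GG_def by (rule P.group_vertex_module_V)
    show "group_vertex_module GG s (fixed_points V G) vac Y (fun_scale (fun_scale (*))) P.D P.\<rho>D P.YD"
      unfolding GG_def by (rule P.group_vertex_module_D)
    show "completely_reducible_vertex_module s (fixed_points V G) vac Y s V Y"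
      by (rule P.completely_reducible)
  next
    fix \<kappa> w f assume "\<kappa> \<in> \<Lambda>" "w \<in> W \<kappa>" "f \<in> P.H \<kappa>"
    then show "P.\<Phi> (summand \<kappa> (pure_tensor sW (W \<kappa>) (fun_scale s) (P.H \<kappa>) w f)) = f w"
      using P.\<Phi>_summand(2)[OF _ P.pure_in_Tens] P.evaluation(2) by (simp add: \<Lambda>_def GG_def)
  next
    fix \<kappa> assume "\<kappa> \<in> \<Lambda>"
    then have irr: "irreducible_representation P.GG sW (W \<kappa>) (\<rho> \<kappa>)" using W_irred by (simp add: GG_def)
    show "P.H \<kappa> \<noteq> {0}" by (rule P.hom_space_nonzero[OF irr])
    show "irreducible_vertex_module s (fixed_points V G) vac Y (fun_scale s) (P.H \<kappa>) (hom_modes Y)"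
      by (rule P.hom_space_irreducible[OF irr])
    fix \<eta> assume "\<eta> \<in> \<Lambda>"
    then show "isomorphic_vertex_modules (fixed_points V G) (fun_scale s) (P.H \<kappa>) (hom_modes Y)
        (fun_scale s) (P.H \<eta>) (hom_modes Y) \<longleftrightarrow> \<kappa> = \<eta>"
      using P.isomorphic_iff \<open>\<kappa> \<in> \<Lambda>\<close> by (simp add: \<Lambda>_def GG_def)
  qed (use P.\<Phi>_linear P.\<Phi>_bij P.\<rho>D P.YD in simp_all)
qed

end
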